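(* If an isometric immersion $\phi: M^m\to \mathbb{R}^{n+1}$ with $\Delta^2\phi=-\mu\,\Delta\phi$ for some function $\mu$ on $M$ realizes as a biharmonic submanifold $\phi: M\to S^n$, then $\mu=2m$ and the biharmonic submanifold $\phi: M\to S^n$ has constant mean curvature $|\eta|=1$, and hence it is the composition of a minimal submanifold $\psi: M^m\to S^{n-1}\big(\tfrac{1}{\sqrt2}\big)$ followed by the standard biharmonic isometric immersion $S^{n-1}\big(\tfrac{1}{\sqrt2}\big)\to S^n$.
   Context: $M^m$ is an $m$-dimensional Riemannian manifold with metric $g$. $S^n\subset\mathbb{R}^{n+1}$ is the unit sphere centered at the origin with its standard metric, and $S^{n-1}(r)\subset\mathbb{R}^n$ is the sphere of radius $r$ centered at the origin; the standard biharmonic isometric immersion $S^{n-1}(\tfrac{1}{\sqrt2})\to S^n$ is $x\mapsto (x,\tfrac{1}{\sqrt2})$. $\Delta f=\mathrm{div}(\nabla f)$ is the Laplace operator of $(M,g)$ acting on functions; it is applied componentwise to $\mathbb{R}^{n+1}$-valued maps, and $\Delta^2\phi=\Delta(\Delta\phi)$. For a map $\varphi:(M,g)\to(N,h)$ between Riemannian manifolds, $\tau(\varphi)=\mathrm{Tr}_g\nabla d\varphi$ is its tension field; $\varphi$ is harmonic if $\tau(\varphi)=0$, and biharmonic if it is a critical point of the bienergy functional $E_2(\varphi)=\frac12\int_M|\tau(\varphi)|^2\,dv_g$. A biharmonic submanifold is the image of an isometric immersion that is a biharmonic map. That $\phi: M^m\to\mathbb{R}^{n+1}$ realizes as a biharmonic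 submanifold $\phi: M\to S^n$ means that $\phi(M)\subset S^n$, so that $\phi$ is the composition $M\to S^n\to\mathbb{R}^{n+1}$, and that the isometric immersion $M\to S^n$ is biharmonic. The vector field $\eta$ is the mean curvature vector field of the submanifold $\phi: M\to S^n$, normalized so that $\Delta\phi=m\eta-m\phi$ (that is, $\eta$ is $\frac1m$ times the trace of the second fundamental form of $M$ in $S^n$); a submanifold is minimal if its mean curvature vector field vanishes identically.
   Formalization: M is assumed connected and φ: M → S^n not minimal (an equator is minimal, hence biharmonic, with μ=m and η=0, so the claim fails there), and the composition with the standard immersion holds up to an orthogonal transformation of R^{n+1}. *)

theory Defs
  imports "HOL-Analysis.Analysis"
begin

section \<open>Smooth functions on open subsets of Euclidean spaces\<close>

fun Ck_on :: "nat \<Rightarrow> 'b::euclidean_space set \<Rightarrow> ('b \<Rightarrow> 'c::real_normed_vector) \<Rightarrow> bool" where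
  "Ck_on 0 S f \<longleftrightarrow> continuous_on S f"
| "Ck_on (Suc k) S f \<longleftrightarrow> (\<forall>x\<in>S. f differentiable (at x)) \<and>
     (\<forall>v. Ck_on k S (\<lambda>x. frechet_derivative f (at x) v))"

text \<open>Only used for open \<open>S\<close>.\<close>

definition smooth_on :: "'b::euclidean_space set \<Rightarrow> ('b \<Rightarrow> 'c::real_normed_vector) \<Rightarrow> bool" where
  "smooth_on S f \<longleftrightarrow> (\<forall>k. Ck_on k S f)"


section \<open>Smooth manifolds\<close>

text \<open>The manifold is the whole type \<open>'a\<close>. A chart is a pair \<open>(U, x)\<close> of its domain and its
  coordinate map; the values of \<open>x\<close> outside \<open>U\<close> play no role. The dimension is \<open>CARD('m)\<close>.\<close>

type_synonym ('a, 'm) chart = "'a set \<times> ('a \<Rightarrow> real ^ 'm)"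

abbreviation dom_of :: "('a, 'm) chart \<Rightarrow> 'a set" where
  "dom_of c \<equiv> fst c"

abbreviation coord :: "('a, 'm) chart \<Rightarrow> 'a \<Rightarrow> real ^ 'm" where
  "coord c \<equiv> snd c"

abbreviation img_of :: "('a, 'm) chart \<Rightarrow> (real ^ 'm) set" where
  "img_of c \<equiv> coord c ` dom_of c"

abbreviation coord_inv :: "('a, 'm) chart \<Rightarrow> real ^ 'm \<Rightarrow> 'a" where
  "coord_inv c \<equiv> inv_into (dom_of c) (coord c)"

definition smooth_atlas ::
  "('a::{second_countable_topology, t2_space}, 'm::finite) chart set \<Rightarrow> bool" where
  "smooth_atlas A \<longleftrightarrow>
     (\<Union>c\<in>A. dom_of c) = UNIV \<and>
     (\<forall>c\<in>A. open (dom_of c) \<and> open (img_of c) \<and>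
        homeomorphism (dom_of c) (img_of c) (coord c) (coord_inv c)) \<and>
     (\<forall>c\<in>A. \<forall>c'\<in>A. smooth_on (coord c ` (dom_of c \<inter> dom_of c')) (coord c' \<circ> coord_inv c))"

definition chart_at :: "('a, 'm) chart set \<Rightarrow> 'a \<Rightarrow> ('a, 'm) chart" where
  "chart_at A p = (SOME c. c \<in> A \<and> p \<in> dom_of c)"

definition smooth_map ::
  "('a, 'm::finite) chart set \<Rightarrow> ('a \<Rightarrow> 'e::real_normed_vector) \<Rightarrow> bool" where
  "smooth_map A f \<longleftrightarrow> (\<forall>c\<in>A. smooth_on (img_of c) (f \<circ> coord_inv c))"

text \<open>The coordinate vector field of index \<open>i\<close> of the chart \<open>c\<close>, acting on functions.\<close>

definition pd ::
  "('a, 'm::finite) chart \<Rightarrow> 'm \<Rightarrow> ('a \<Rightarrow> 'e::real_normed_vector) \<Rightarrow> 'a \<Rightarrow> 'e" where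
  "pd c i f p = frechet_derivative (f \<circ> coord_inv c) (at (coord c p)) (axis i 1)"


section \<open>Riemannian metrics\<close>

text \<open>A metric is given by its Gram matrices \<open>g c p\<close> in the charts \<open>c\<close> around \<open>p\<close>, which obey the
  transformation law of a covariant 2-tensor.\<close>

type_synonym ('a, 'm) metric = "('a, 'm) chart \<Rightarrow> 'a \<Rightarrow> real ^ 'm ^ 'm"

definition riemannian_metric :: "('a, 'm::finite) chart set \<Rightarrow> ('a, 'm) metric \<Rightarrow> bool" where
  "riemannian_metric A g \<longleftrightarrow>
     (\<forall>c\<in>A. smooth_on (img_of c) (g c \<circ> coord_inv c)) \<and>
     (\<forall>c\<in>A. \<forall>p\<in>dom_of c. transpose (g c p) = g c p \<and> (\<forall>v. v \<noteq> 0 \<longrightarrow> v \<bullet> (g c p *v v) > 0)) \<and>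
     (\<forall>c\<in>A. \<forall>c'\<in>A. \<forall>p\<in>dom_of c \<inter> dom_of c'. \<forall>i j.
        g c p $ i $ j =
          (\<Sum>k\<in>UNIV. \<Sum>l\<in>UNIV. pd c i (\<lambda>q. coord c' q $ k) p * pd c j (\<lambda>q. coord c' q $ l) p
             * g c' p $ k $ l))"

definition ginv :: "('a, 'm::finite) metric \<Rightarrow> ('a, 'm) chart \<Rightarrow> 'a \<Rightarrow> 'm \<Rightarrow> 'm \<Rightarrow> real" where
  "ginv g c p i j = matrix_inv (g c p) $ i $ j"

text \<open>\<open>christoffel g c k i j\<close> has upper index \<open>k\<close> and lower indices \<open>i\<close>, \<open>j\<close>.\<close>

definition christoffel ::
  "('a, 'm::finite) metric \<Rightarrow> ('a, 'm) chart \<Rightarrow> 'm \<Rightarrow> 'm \<Rightarrow> 'm \<Rightarrow> 'a \<Rightarrow> real" where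
  "christoffel g c k i j p =
     1 / 2 * (\<Sum>l\<in>UNIV. ginv g c p k l *
       (pd c i (\<lambda>q. g c q $ j $ l) p + pd c j (\<lambda>q. g c q $ i $ l) p - pd c l (\<lambda>q. g c q $ i $ j) p))"

text \<open>The Riemannian volume measure, specified by its densities in the charts. For a smooth atlas
  and a Riemannian metric there is exactly one such measure.\<close>

definition riemannian_volume ::
  "('a::{second_countable_topology, t2_space}, 'm::finite) chart set \<Rightarrow> ('a, 'm) metric \<Rightarrow>
     'a measure \<Rightarrow> bool" where
  "riemannian_volume A g dv \<longleftrightarrow> sets dv = sets borel \<and>
     (\<forall>c\<in>A. \<forall>B\<in>sets borel. B \<subseteq> dom_of c \<longrightarrow>
        emeasure dv B =
          (\<integral>\<^sup>+u. ennreal (sqrt (det (g c (coord_inv c u)))) * indicator (coord c ` B) u \<partial>lborel))"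


section \<open>The Laplace operator\<close>

text \<open>Vector fields are represented by their components in a chart; the divergence is the trace
  of the covariant derivative.\<close>

definition gradient ::
  "('a, 'm::finite) metric \<Rightarrow> ('a, 'm) chart \<Rightarrow> ('a \<Rightarrow> real) \<Rightarrow> 'a \<Rightarrow> real ^ 'm" where
  "gradient g c f p = (\<chi> i. \<Sum>j\<in>UNIV. ginv g c p i j * pd c j f p)"

definition divergence ::
  "('a, 'm::finite) metric \<Rightarrow> ('a, 'm) chart \<Rightarrow> ('a \<Rightarrow> real ^ 'm) \<Rightarrow> 'a \<Rightarrow> real" where
  "divergence g c X p =
     (\<Sum>i\<in>UNIV. pd c i (\<lambda>q. X q $ i) p + (\<Sum>j\<in>UNIV. christoffel g c i i j p * X p $ j))"

definition laplacian ::
  "('a, 'm::finite) chart set \<Rightarrow> ('a, 'm) metric \<Rightarrow> ('a \<Rightarrow> real) \<Rightarrow> 'a \<Rightarrow> real" where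
  "laplacian A g f p = (let c = chart_at A p in divergence g c (gradient g c f) p)"

definition laplacian_vec ::
  "('a, 'm::finite) chart set \<Rightarrow> ('a, 'm) metric \<Rightarrow> ('a \<Rightarrow> 'e::euclidean_space) \<Rightarrow> 'a \<Rightarrow> 'e" where
  "laplacian_vec A g f p = (\<Sum>b\<in>Basis. laplacian A g (\<lambda>q. f q \<bullet> b) p *\<^sub>R b)"


section \<open>Maps into spheres centered at the origin\<close>

definition isometric_immersion ::
  "('a, 'm::finite) chart set \<Rightarrow> ('a, 'm) metric \<Rightarrow> ('a \<Rightarrow> 'e::euclidean_space) \<Rightarrow> bool" where
  "isometric_immersion A g f \<longleftrightarrow> smooth_map A f \<and>
     (\<forall>c\<in>A. \<forall>p\<in>dom_of c. \<forall>i j. pd c i f p \<bullet> pd c j f p = g c p $ i $ j)"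

text \<open>The orthogonal projection onto the tangent space at \<open>y \<noteq> 0\<close> of the sphere centered at the
  origin that contains \<open>y\<close>. The Levi-Civita connection of that sphere is the ambient derivative
  followed by this projection.\<close>

definition sphere_tan :: "'e::euclidean_space \<Rightarrow> 'e \<Rightarrow> 'e" where
  "sphere_tan y v = v - ((v \<bullet> y) / (y \<bullet> y)) *\<^sub>R y"

text \<open>\<open>nabla_d\<close> gives the components of the second covariant derivative of a map \<open>f\<close> from the
  manifold to such a sphere, and \<open>tension\<close> is its trace.\<close>

definition nabla_d ::
  "('a, 'm::finite) metric \<Rightarrow> ('a, 'm) chart \<Rightarrow> ('a \<Rightarrow> 'e::euclidean_space) \<Rightarrow> 'm \<Rightarrow> 'm \<Rightarrow> 'a \<Rightarrow> 'e" where
  "nabla_d g c f i j p =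
     sphere_tan (f p) (pd c i (pd c j f) p) - (\<Sum>k\<in>UNIV. christoffel g c k i j p *\<^sub>R pd c k f p)"

definition tension ::
  "('a, 'm::finite) chart set \<Rightarrow> ('a, 'm) metric \<Rightarrow> ('a \<Rightarrow> 'e::euclidean_space) \<Rightarrow> 'a \<Rightarrow> 'e" where
  "tension A g f p = (let c = chart_at A p in
     \<Sum>i\<in>UNIV. \<Sum>j\<in>UNIV. ginv g c p i j *\<^sub>R nabla_d g c f i j p)"

definition bienergy ::
  "('a::topological_space, 'm::finite) chart set \<Rightarrow> ('a, 'm) metric \<Rightarrow> 'a measure \<Rightarrow> 'a set \<Rightarrow>
     ('a \<Rightarrow> 'e::euclidean_space) \<Rightarrow> real" where
  "bienergy A g dv K f = 1 / 2 * (LINT p:K|dv. (norm (tension A g f p))\<^sup>2)"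

text \<open>A smooth variation \<open>F\<close> of \<open>f\<close>, through maps into the sphere of radius \<open>r\<close>, that is
  supported in the compact set \<open>K\<close>.\<close>

definition variation ::
  "('a::topological_space, 'm::finite) chart set \<Rightarrow> real \<Rightarrow> ('a \<Rightarrow> 'e::euclidean_space) \<Rightarrow>
     'a set \<Rightarrow> real \<Rightarrow> (real \<Rightarrow> 'a \<Rightarrow> 'e) \<Rightarrow> bool" where
  "variation A r f K \<epsilon> F \<longleftrightarrow> compact K \<and> \<epsilon> > 0 \<and>
     (\<forall>c\<in>A. smooth_on ({-\<epsilon><..<\<epsilon>} \<times> img_of c) (\<lambda>(t, u). F t (coord_inv c u))) \<and>
     (\<forall>t\<in>{-\<epsilon><..<\<epsilon>}. \<forall>p. F t p \<in> sphere 0 r) \<and>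
     F 0 = f \<and>
     (\<forall>t\<in>{-\<epsilon><..<\<epsilon>}. \<forall>p. p \<notin> K \<longrightarrow> F t p = f p)"

text \<open>Critical points of the bienergy among maps into the sphere of radius \<open>r\<close>. Since the manifold
  need not be compact, criticality refers to all compactly supported variations, with the bienergy
  taken over a compact set that contains the support. By uniqueness, \<open>dv\<close> is the Riemannian
  volume measure.\<close>

definition biharmonic ::
  "('a::{second_countable_topology, t2_space}, 'm::finite) chart set \<Rightarrow> ('a, 'm) metric \<Rightarrow> real \<Rightarrow>
     ('a \<Rightarrow> 'e::euclidean_space) \<Rightarrow> bool" where
  "biharmonic A g r f \<longleftrightarrow> smooth_map A f \<and> range f \<subseteq> sphere 0 r \<and>
     (\<exists>dv. riemannian_volume A g dv \<and>
        (\<forall>K \<epsilon> F. variation A r f K \<epsilon> F \<longrightarrow>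
           ((\<lambda>t. bienergy A g dv K (F t)) has_real_derivative 0) (at 0)))"


section \<open>Submanifolds of spheres centered at the origin\<close>

text \<open>For an isometric immersion \<open>f\<close>, the component of \<open>v\<close> orthogonal to the image of the
  differential of \<open>f\<close> at \<open>p\<close>.\<close>

definition normal_part ::
  "('a, 'm::finite) metric \<Rightarrow> ('a, 'm) chart \<Rightarrow> ('a \<Rightarrow> 'e::euclidean_space) \<Rightarrow> 'a \<Rightarrow> 'e \<Rightarrow> 'e" where
  "normal_part g c f p v =
     v - (\<Sum>k\<in>UNIV. \<Sum>l\<in>UNIV. (ginv g c p k l * (v \<bullet> pd c l f p)) *\<^sub>R pd c k f p)"

definition second_fundamental_form ::
  "('a, 'm::finite) metric \<Rightarrow> ('a, 'm) chart \<Rightarrow> ('a \<Rightarrow> 'e::euclidean_space) \<Rightarrow> 'm \<Rightarrow> 'm \<Rightarrow> 'a \<Rightarrow> 'e" where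
  "second_fundamental_form g c f i j p =
     normal_part g c f p (sphere_tan (f p) (pd c i (pd c j f) p))"

definition mean_curvature ::
  "('a, 'm::finite) chart set \<Rightarrow> ('a, 'm) metric \<Rightarrow> ('a \<Rightarrow> 'e::euclidean_space) \<Rightarrow> 'a \<Rightarrow> 'e" where
  "mean_curvature A g f p = (let c = chart_at A p in
     (1 / real CARD('m)) *\<^sub>R
       (\<Sum>i\<in>UNIV. \<Sum>j\<in>UNIV. ginv g c p i j *\<^sub>R second_fundamental_form g c f i j p))"

definition minimal ::
  "('a, 'm::finite) chart set \<Rightarrow> ('a, 'm) metric \<Rightarrow> ('a \<Rightarrow> 'e::euclidean_space) \<Rightarrow> bool" where
  "minimal A g f \<longleftrightarrow> (\<forall>p. mean_curvature A g f p = 0)"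

text \<open>The ambient space of dimension \<open>n + 1\<close> is \<open>(real ^ 'n) \<times> real\<close>, whose inner product is the
  Euclidean one.\<close>

definition standard_immersion :: "real ^ 'n \<Rightarrow> (real ^ 'n) \<times> real" where
  "standard_immersion x = (x, 1 / sqrt 2)"

end

theory Submission
  imports Defs
begin

text \<open>
  Write \<open>m\<close> for the dimension and \<open>\<tau> = \<Delta>\<phi> + m \<phi> = m \<eta>\<close> for the tension field of \<open>\<phi>\<close> in the unit
  sphere. Since \<open>\<tau>\<close> is orthogonal to \<open>\<phi>\<close> and to the image of \<open>d\<phi>\<close>, one has
  \<open>\<langle>\<Delta>\<tau>, \<phi>\<rangle> = |\<tau>|\<^sup>2\<close>, and the hypothesis \<open>\<Delta>\<^sup>2\<phi> = - \<mu> \<Delta>\<phi>\<close>, that is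
  \<open>\<Delta>\<tau> = (m - \<mu>) (\<tau> - m \<phi>)\<close>, forces \<open>|\<tau>|\<^sup>2 = m (\<mu> - m)\<close>. Hence the part of \<open>\<Delta>\<tau> + m \<tau>\<close> tangent
  to the sphere is \<open>(2 m - \<mu>) \<tau>\<close>, and a compactly supported variation in the direction of a
  multiple of \<open>\<tau>\<close> turns biharmonicity into \<open>(m\<^sup>2 - |\<tau>|\<^sup>2) |\<tau>|\<^sup>2 = 0\<close>. By connectedness and
  non-minimality \<open>|\<tau>| = m\<close>, so \<open>\<mu> = 2 m\<close> and \<open>|\<eta>| = 1\<close>. The vector \<open>a = \<eta> + \<phi>\<close> now is harmonic and
  has constant norm \<open>\<surd>2\<close>, so it is constant. As \<open>\<langle>\<phi>, a\<rangle> = 1\<close>, the image of \<open>\<phi>\<close> lies in a small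
  sphere of radius \<open>1 / \<surd>2\<close>, where \<open>\<Delta>\<phi> = m a - 2 m \<phi>\<close> expresses minimality.
\<close>

section \<open>Calculus of smooth functions\<close>

text \<open>Biharmonicity is given variationally, through a measure and energies over compact sets,
  while the argument is pointwise. The bridge is one explicit family of spherical maps supported in
  a box of a single chart: for V orthogonal to \<phi>, the curve ((1 - t^2 |V|^2) \<phi> + 2 t V) /
  (1 + t^2 |V|^2) is an inverse stereographic projection, so it stays on the sphere and is rational
  in t and V. Integration by parts then takes place in a box of R^m.

  The other obstacle is that \<open>laplacian\<close> picks some chart at each point. As the metric
  is the Gram matrix of the vectors \<open>pd c i \<phi>\<close>, the Christoffel symbols are scalar
  products of derivatives of \<phi>, and both the independence of the chart and the orthogonality of
  \<Delta>\<phi> to the image of d\<phi> become linear algebra.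

  The multiple of \<tau> that serves as direction is (m^2 - |\<tau>|^2) \<tau>: it makes the
  integrand of the first variation a nonnegative multiple of (m^2 - |\<tau>|^2)^2 |\<tau>|^2. The
  small sphere has centre a / 2, since |a|^2 = 2 and \<langle>\<phi>, a\<rangle> = 1 give |\<phi> -
  a / 2|^2 = 1 / 2.\<close>

lemma Ck_on_cong:
  assumes "open S" "\<And>x. x \<in> S \<Longrightarrow> f x = g x" "Ck_on k S f"
  shows "Ck_on k S g"
  using assms(2,3)
proof (induction k arbitrary: f g)
  case 0
  then show ?case by (auto cong: continuous_on_cong)
next
  case (Suc k)
  have "g differentiable (at x) \<and> frechet_derivative g (at x) = frechet_derivative f (at x)"
    if x: "x \<in> S" for x
  proof -
    have df: "(f has_derivative frechet_derivative f (at x)) (at x)"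
      using Suc.prems(2) x by (simp add: frechet_derivative_works)
    have "(g has_derivative frechet_derivative f (at x)) (at x)"
      by (rule has_derivative_transform_within_open[OF df \<open>open S\<close> x]) (rule Suc.prems(1))
    then show ?thesis
      using frechet_derivative_at differentiable_def by metis
  qed
  moreover have "Ck_on k S (\<lambda>x. frechet_derivative g (at x) v)" for v
    by (rule Suc.IH[of "\<lambda>x. frechet_derivative f (at x) v"])
      (use Suc.prems(2) calculation in auto)
  ultimately show ?case by simp
qed

text \<open>\<open>frechet_derivative\<close> is a choice, and inductions over \<open>k\<close> need
  an explicit derivative instead. Any family of derivatives on an open set may replace it, because
  derivatives at interior points are unique.\<close>

lemma Ck_on_Suc_iff:
  assumes "open S" "\<And>x. x \<in> S \<Longrightarrow> (f has_derivative f' x) (at x)"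
  shows "Ck_on (Suc k) S f \<longleftrightarrow> (\<forall>v. Ck_on k S (\<lambda>x. f' x v))"
proof -
  have eq: "frechet_derivative f (at x) v = f' x v" if "x \<in> S" for x v
    using frechet_derivative_at[OF assms(2)[OF that]] by simp
  have "Ck_on k S (\<lambda>x. frechet_derivative f (at x) v) \<longleftrightarrow> Ck_on k S (\<lambda>x. f' x v)" for v
    using eq by (intro iffI; elim Ck_on_cong[OF assms(1), rotated]) auto
  then show ?thesis
    using assms(2) by (auto simp: differentiable_def)
qed

lemma Ck_on_has_derivative:
  "Ck_on (Suc k) S f \<Longrightarrow> x \<in> S \<Longrightarrow> (f has_derivative frechet_derivative f (at x)) (at x)"
  by (simp add: frechet_derivative_works)

lemma Ck_on_mono: "Ck_on k S f \<Longrightarrow> T \<subseteq> S \<Longrightarrow> Ck_on k T f"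
  by (induction k arbitrary: f) (auto intro: continuous_on_subset)

lemma Ck_on_SucD: "Ck_on (Suc k) S f \<Longrightarrow> Ck_on k S f"
proof (induction k arbitrary: f)
  case 0
  then show ?case
    by (auto intro!: differentiable_imp_continuous_on differentiable_at_imp_differentiable_on)
next
  case (Suc k)
  show ?case
    unfolding Ck_on.simps(2)[of k]
  proof (intro conjI allI)
    show "\<forall>x\<in>S. f differentiable at x" using Suc.prems by simp
    show "Ck_on k S (\<lambda>x. frechet_derivative f (at x) v)" for v
      by (rule Suc.IH) (use Suc.prems in \<open>simp only: Ck_on.simps(2)[of "Suc k"]\<close>)
  qed
qed

lemma Ck_on_Un:
  assumes "open S" "open T" "Ck_on k S f" "Ck_on k T f"
  shows "Ck_on k (S \<union> T) f"
  using assms by (induction k arbitrary: f) (auto intro: continuous_on_open_Un)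

lemma Ck_on_const: "Ck_on k S (\<lambda>x. c)"
  by (induction k arbitrary: c) auto

lemma Ck_on_bounded_linear:
  assumes "bounded_linear l" "open S" "Ck_on k S f"
  shows "Ck_on k S (\<lambda>x. l (f x))"
  using assms(3)
proof (induction k arbitrary: f)
  case 0
  then show ?case
    using assms(1) by (auto intro: bounded_linear.continuous_on)
next
  case (Suc k)
  show ?case
  proof (subst Ck_on_Suc_iff[OF assms(2)])
    show "((\<lambda>x. l (f x)) has_derivative (\<lambda>v. l (frechet_derivative f (at x) v))) (at x)"
      if "x \<in> S" for x
      using Ck_on_has_derivative[OF Suc.prems that] assms(1)
      by (rule bounded_linear.has_derivative[rotated])
    show "\<forall>v. Ck_on k S (\<lambda>x. l (frechet_derivative f (at x) v))"
      using Suc by auto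
  qed
qed

lemma Ck_on_ident: "Ck_on k S (\<lambda>x. x)"
  by (cases k) (auto intro: Ck_on_const continuous_on_id)

lemma Ck_on_add:
  assumes "open S" "Ck_on k S f" "Ck_on k S g"
  shows "Ck_on k S (\<lambda>x. f x + g x)"
  using assms(2,3)
proof (induction k arbitrary: f g)
  case 0
  then show ?case by (auto intro: continuous_on_add)
next
  case (Suc k)
  show ?case
  proof (subst Ck_on_Suc_iff[OF assms(1)])
    show "((\<lambda>x. f x + g x) has_derivative
        (\<lambda>v. frechet_derivative f (at x) v + frechet_derivative g (at x) v)) (at x)"
      if "x \<in> S" for x
      by (intro has_derivative_add Ck_on_has_derivative[OF Suc.prems(1) that]
          Ck_on_has_derivative[OF Suc.prems(2) that])
    show "\<forall>v. Ck_on k S (\<lambda>x. frechet_derivative f (at x) v + frechet_derivative g (at x) v)"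
      using Suc by auto
  qed
qed

text \<open>The product rule pairs one factor with the derivative of the other; the undifferentiated
  factor is lowered by \<open>Ck_on_SucD\<close> to meet the induction hypothesis.\<close>

lemma Ck_on_bilinear:
  assumes "bounded_bilinear p" "open S" "Ck_on k S f" "Ck_on k S g"
  shows "Ck_on k S (\<lambda>x. p (f x) (g x))"
  using assms(3,4)
proof (induction k arbitrary: f g)
  case 0
  then show ?case
    using assms(1) by (auto intro: bounded_bilinear.continuous_on)
next
  case (Suc k)
  show ?case
  proof (subst Ck_on_Suc_iff[OF assms(2)])
    show "((\<lambda>x. p (f x) (g x)) has_derivative
        (\<lambda>v. p (f x) (frechet_derivative g (at x) v) + p (frechet_derivative f (at x) v) (g x))) (at x)"
      if "x \<in> S" for x
      by (intro bounded_bilinear.FDERIV[OF assms(1)] Ck_on_has_derivative[OF Suc.prems(1) that]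
          Ck_on_has_derivative[OF Suc.prems(2) that])
    show "\<forall>v. Ck_on k S (\<lambda>x. p (f x) (frechet_derivative g (at x) v) +
        p (frechet_derivative f (at x) v) (g x))"
    proof (intro allI Ck_on_add[OF assms(2)])
      show "Ck_on k S (\<lambda>x. p (f x) (frechet_derivative g (at x) v))" for v
        using Suc.prems(2) by (intro Suc.IH Ck_on_SucD[OF Suc.prems(1)]) auto
      show "Ck_on k S (\<lambda>x. p (frechet_derivative f (at x) v) (g x))" for v
        using Suc.prems(1) by (intro Suc.IH Ck_on_SucD[OF Suc.prems(2)]) auto
    qed
  qed
qed

lemma Ck_on_sum:
  assumes "open S" "\<And>i. i \<in> I \<Longrightarrow> Ck_on k S (f i)"
  shows "Ck_on k S (\<lambda>x. \<Sum>i\<in>I. f i x)"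
  using assms(2)
  by (induction I rule: infinite_finite_induct) (auto intro: Ck_on_const Ck_on_add[OF assms(1)])

lemma Ck_on_compose:
  fixes g :: "'b::euclidean_space \<Rightarrow> 'c::euclidean_space"
  assumes "open S" "open T" "g ` S \<subseteq> T" "Ck_on k S g" "Ck_on k T f"
  shows "Ck_on k S (\<lambda>x. f (g x))"
  using assms(4,5)
proof (induction k arbitrary: f)
  case 0
  then show ?case
    using assms(3) by (auto intro: continuous_on_compose2)
next
  case (Suc k)
  \<comment> \<open>The argument of the derivative of \<open>f\<close> in the chain rule varies with
    x. Expanding it in \<open>Basis\<close> leaves scalars times derivatives of \<open>f\<close> at
    \<open>g x\<close> in fixed directions, to which the induction hypothesis applies.\<close>
  let ?F = "\<lambda>x v. \<Sum>b\<in>Basis. (frechet_derivative g (at x) v \<bullet> b) *\<^sub>R frechet_derivative f (at (g x)) b"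
  show ?case
  proof (subst Ck_on_Suc_iff[OF assms(1)])
    show "((\<lambda>x. f (g x)) has_derivative ?F x) (at x)" if x: "x \<in> S" for x
    proof -
      have f: "(f has_derivative frechet_derivative f (at (g x))) (at (g x))"
        using Ck_on_has_derivative[OF Suc.prems(2)] x assms(3) by blast
      have 1: "((\<lambda>x. f (g x)) has_derivative
          (\<lambda>v. frechet_derivative f (at (g x)) (frechet_derivative g (at x) v))) (at x)"
        using diff_chain_at[OF Ck_on_has_derivative[OF Suc.prems(1) x] f] by (simp add: o_def)
      have "frechet_derivative f (at (g x)) w =
          (\<Sum>b\<in>Basis. (w \<bullet> b) *\<^sub>R frechet_derivative f (at (g x)) b)" for w
      proof -
        have "frechet_derivative f (at (g x)) (\<Sum>b\<in>Basis. (w \<bullet> b) *\<^sub>R b) =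
            (\<Sum>b\<in>Basis. (w \<bullet> b) *\<^sub>R frechet_derivative f (at (g x)) b)"
          using has_derivative_linear[OF f] by (simp add: linear_sum linear_scale)
        then show ?thesis by (simp only: euclidean_representation)
      qed
      then have "(\<lambda>v. frechet_derivative f (at (g x)) (frechet_derivative g (at x) v)) = ?F x"
        by (rule ext)
      with 1 show ?thesis by (rule has_derivative_eq_rhs)
    qed
    show "\<forall>v. Ck_on k S (\<lambda>x. ?F x v)"
    proof (intro allI Ck_on_sum[OF assms(1)] Ck_on_bilinear[OF bounded_bilinear_scaleR assms(1)])
      show "Ck_on k S (\<lambda>x. frechet_derivative g (at x) v \<bullet> b)" for v b
        using Suc.prems by (intro Ck_on_bounded_linear[OF bounded_linear_inner_left assms(1)]) auto
      show "Ck_on k S (\<lambda>x. frechet_derivative f (at (g x)) b)" for b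
        using Suc.prems(2) by (intro Suc.IH[OF Ck_on_SucD[OF Suc.prems(1)]]) auto
    qed
  qed
qed

text \<open>The derivative is a polynomial in \<open>inverse\<close> itself, so each order of
  smoothness yields the next.\<close>

lemma Ck_on_inverse: "Ck_on k (- {0}) (inverse :: real \<Rightarrow> real)"
proof (induction k)
  case 0
  show ?case by (auto intro: continuous_intros)
next
  case (Suc k)
  have o: "open (- {0::real})" by (simp add: open_Compl)
  show ?case
  proof (subst Ck_on_Suc_iff[OF o])
    show "(inverse has_derivative (\<lambda>v. - (inverse x * v * inverse x))) (at x)"
      if "x \<in> - {0}" for x :: real
      using that by (auto intro!: derivative_eq_intros)
    show "\<forall>v::real. Ck_on k (- {0}) (\<lambda>x. - (inverse x * v * inverse x))"
      by (intro allI Ck_on_bounded_linear[OF bounded_linear_minus[OF bounded_linear_ident] o]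
          Ck_on_bilinear[OF bounded_bilinear_mult o] Suc Ck_on_const)
  qed
qed

lemma Ck_on_sqrt: "Ck_on k {0<..} sqrt"
proof (induction k)
  case 0
  show ?case by (auto intro: continuous_intros)
next
  case (Suc k)
  have o: "open {0::real<..}" by simp
  have o': "open (- {0::real})" by (simp add: open_Compl)
  show ?case
  proof (subst Ck_on_Suc_iff[OF o])
    show "(sqrt has_derivative (\<lambda>v. inverse (sqrt x) / 2 * v)) (at x)"
      if "x \<in> {0<..}" for x :: real
      using DERIV_real_sqrt[of x] that by (simp add: has_field_derivative_def del: times_divide_eq_left)
    show "\<forall>v::real. Ck_on k {0<..} (\<lambda>x. inverse (sqrt x) / 2 * v)"
      by (intro allI Ck_on_bilinear[OF bounded_bilinear_mult o] Ck_on_const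
          Ck_on_bounded_linear[OF bounded_linear_divide o]
          Ck_on_compose[OF o o' _ Suc Ck_on_inverse]) auto
  qed
qed

lemma smooth_on_cong:
  "open S \<Longrightarrow> (\<And>x. x \<in> S \<Longrightarrow> f x = g x) \<Longrightarrow> smooth_on S f \<Longrightarrow> smooth_on S g"
  unfolding smooth_on_def using Ck_on_cong by blast

lemma smooth_on_subset: "smooth_on S f \<Longrightarrow> T \<subseteq> S \<Longrightarrow> smooth_on T f"
  unfolding smooth_on_def using Ck_on_mono by blast

lemma smooth_on_Un: "open S \<Longrightarrow> open T \<Longrightarrow> smooth_on S f \<Longrightarrow> smooth_on T f \<Longrightarrow> smooth_on (S \<union> T) f"
  unfolding smooth_on_def using Ck_on_Un by blast

lemma smooth_on_const: "smooth_on S (\<lambda>x. c)"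
  unfolding smooth_on_def using Ck_on_const by blast

lemma smooth_on_ident: "smooth_on S (\<lambda>x. x)"
  unfolding smooth_on_def using Ck_on_ident by blast

lemma smooth_on_bounded_linear:
  "bounded_linear l \<Longrightarrow> open S \<Longrightarrow> smooth_on S f \<Longrightarrow> smooth_on S (\<lambda>x. l (f x))"
  unfolding smooth_on_def using Ck_on_bounded_linear by blast

lemma smooth_on_add:
  "open S \<Longrightarrow> smooth_on S f \<Longrightarrow> smooth_on S g \<Longrightarrow> smooth_on S (\<lambda>x. f x + g x)"
  unfolding smooth_on_def using Ck_on_add by blast

lemma smooth_on_bilinear:
  "bounded_bilinear p \<Longrightarrow> open S \<Longrightarrow> smooth_on S f \<Longrightarrow> smooth_on S g \<Longrightarrow>
    smooth_on S (\<lambda>x. p (f x) (g x))"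
  unfolding smooth_on_def using Ck_on_bilinear by blast

lemma smooth_on_sum:
  "open S \<Longrightarrow> (\<And>i. i \<in> I \<Longrightarrow> smooth_on S (f i)) \<Longrightarrow> smooth_on S (\<lambda>x. \<Sum>i\<in>I. f i x)"
  unfolding smooth_on_def by (auto intro: Ck_on_sum)

lemma smooth_on_compose:
  fixes g :: "'b::euclidean_space \<Rightarrow> 'c::euclidean_space"
  shows "open S \<Longrightarrow> open T \<Longrightarrow> g ` S \<subseteq> T \<Longrightarrow> smooth_on S g \<Longrightarrow> smooth_on T f \<Longrightarrow>
    smooth_on S (\<lambda>x. f (g x))"
  unfolding smooth_on_def using Ck_on_compose by blast

lemma smooth_on_uminus: "open S \<Longrightarrow> smooth_on S f \<Longrightarrow> smooth_on S (\<lambda>x. - f x)"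
  by (rule smooth_on_bounded_linear[OF bounded_linear_minus[OF bounded_linear_ident]])

lemma smooth_on_diff:
  "open S \<Longrightarrow> smooth_on S f \<Longrightarrow> smooth_on S g \<Longrightarrow> smooth_on S (\<lambda>x. f x - g x)"
  using smooth_on_add[of S f "\<lambda>x. - g x"] smooth_on_uminus[of S g] by simp

lemmas smooth_on_scaleR = smooth_on_bilinear[OF bounded_bilinear_scaleR]
lemmas smooth_on_inner = smooth_on_bilinear[OF bounded_bilinear_inner]

lemma smooth_on_mult:
  fixes f g :: "'b::euclidean_space \<Rightarrow> real"
  shows "open S \<Longrightarrow> smooth_on S f \<Longrightarrow> smooth_on S g \<Longrightarrow> smooth_on S (\<lambda>x. f x * g x)"
  by (rule smooth_on_bilinear[OF bounded_bilinear_mult])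

lemma smooth_on_inverse:
  fixes f :: "'b::euclidean_space \<Rightarrow> real"
  shows "open S \<Longrightarrow> smooth_on S f \<Longrightarrow> (\<And>x. x \<in> S \<Longrightarrow> f x \<noteq> 0) \<Longrightarrow> smooth_on S (\<lambda>x. inverse (f x))"
  by (rule smooth_on_compose[where T = "- {0}"]) (auto simp: smooth_on_def Ck_on_inverse)

lemma smooth_on_divide:
  fixes f g :: "'b::euclidean_space \<Rightarrow> real"
  shows "open S \<Longrightarrow> smooth_on S f \<Longrightarrow> smooth_on S g \<Longrightarrow> (\<And>x. x \<in> S \<Longrightarrow> g x \<noteq> 0) \<Longrightarrow>
    smooth_on S (\<lambda>x. f x / g x)"
  unfolding divide_inverse by (intro smooth_on_mult smooth_on_inverse)

lemma smooth_on_sqrt: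
  fixes f :: "'b::euclidean_space \<Rightarrow> real"
  shows "open S \<Longrightarrow> smooth_on S f \<Longrightarrow> (\<And>x. x \<in> S \<Longrightarrow> f x > 0) \<Longrightarrow> smooth_on S (\<lambda>x. sqrt (f x))"
  by (rule smooth_on_compose[where T = "{0<..}"]) (auto simp: smooth_on_def Ck_on_sqrt)

lemma smooth_on_prod:
  fixes f :: "'i \<Rightarrow> 'b::euclidean_space \<Rightarrow> real"
  shows "open S \<Longrightarrow> (\<And>i. i \<in> I \<Longrightarrow> smooth_on S (f i)) \<Longrightarrow> smooth_on S (\<lambda>x. \<Prod>i\<in>I. f i x)"
  by (induction I rule: infinite_finite_induct) (auto intro: smooth_on_const smooth_on_mult)

lemma smooth_on_det:
  fixes M :: "'b::euclidean_space \<Rightarrow> real ^ 'm ^ 'm"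
  assumes "open S" "\<And>i j. smooth_on S (\<lambda>x. M x $ i $ j)"
  shows "smooth_on S (\<lambda>x. det (M x))"
  unfolding det_def
  by (intro smooth_on_sum smooth_on_mult smooth_on_prod smooth_on_const assms)

lemma smooth_on_frechet_derivative:
  "smooth_on S f \<Longrightarrow> smooth_on S (\<lambda>x. frechet_derivative f (at x) v)"
  unfolding smooth_on_def by (metis Ck_on.simps(2))

lemma smooth_on_imp_has_derivative:
  "smooth_on S f \<Longrightarrow> x \<in> S \<Longrightarrow> (f has_derivative frechet_derivative f (at x)) (at x)"
  unfolding smooth_on_def using Ck_on_has_derivative by blast

lemma smooth_on_imp_continuous_on: "smooth_on S f \<Longrightarrow> continuous_on S f"
  unfolding smooth_on_def by (metis Ck_on.simps(1))

section \<open>Inverse matrices\<close>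

lemma matrix_inv_inverse:
  fixes G :: "real ^ 'm ^ 'm"
  assumes "det G \<noteq> 0"
  shows "G ** matrix_inv G = mat 1" "matrix_inv G ** G = mat 1"
proof -
  have "\<exists>H. G ** H = mat 1 \<and> H ** G = mat 1"
    using assms unfolding invertible_det_nz[symmetric] invertible_def .
  from someI_ex[OF this] show "G ** matrix_inv G = mat 1" "matrix_inv G ** G = mat 1"
    unfolding matrix_inv_def by auto
qed

text \<open>Cramer's rule with right-hand side \<open>axis l 1\<close>. It exhibits the entries of
  the inverse as quotients of polynomials in the entries of \<open>G\<close>, which gives smoothness
  of the inverse metric.\<close>

lemma matrix_inv_entry:
  fixes G :: "real ^ 'm ^ 'm"
  assumes "det G \<noteq> 0"
  shows "matrix_inv G $ k $ l = det (\<chi> i j. if j = k then (if i = l then 1 else 0) else G $ i $ j) / det G"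
proof -
  have "G *v (matrix_inv G *v axis l 1) = axis l 1"
    by (simp add: matrix_vector_mul_assoc matrix_inv_inverse[OF assms])
  then have "matrix_inv G *v axis l 1 = (\<chi> k. det (\<chi> i j. if j = k then axis l 1 $ i else G $ i $ j) / det G)"
    using cramer[OF assms] by blast
  then have "(matrix_inv G *v axis l 1) $ k = det (\<chi> i j. if j = k then axis l 1 $ i else G $ i $ j) / det G"
    by simp
  moreover have "(matrix_inv G *v axis l 1) $ k = matrix_inv G $ k $ l"
    by (simp add: matrix_vector_mult_def axis_def if_distrib cong: if_cong)
  ultimately show ?thesis by (simp add: axis_def cong: if_cong)
qed

lemma smooth_on_matrix_inv:
  fixes M :: "'b::euclidean_space \<Rightarrow> real ^ 'm ^ 'm"
  assumes "open S" "\<And>i j. smooth_on S (\<lambda>x. M x $ i $ j)" "\<And>x. x \<in> S \<Longrightarrow> det (M x) \<noteq> 0"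
  shows "smooth_on S (\<lambda>x. matrix_inv (M x) $ k $ l)"
proof (rule smooth_on_cong[OF assms(1)])
  let ?N = "\<lambda>x. \<chi> i j. if j = k then (if i = l then 1 else 0) else M x $ i $ j"
  show "det (?N x) / det (M x) = matrix_inv (M x) $ k $ l" if "x \<in> S" for x
    using matrix_inv_entry[OF assms(3)[OF that]] by simp
  have "smooth_on S (\<lambda>x. ?N x $ i $ j)" for i j
    using assms(2)[of i j] by (cases "j = k"; cases "i = l") (auto intro: smooth_on_const)
  then show "smooth_on S (\<lambda>x. det (?N x) / det (M x))"
    by (intro smooth_on_divide smooth_on_det assms)
qed

section \<open>Symmetry of second derivatives\<close>

lemma smooth_on_isCont: "open S \<Longrightarrow> smooth_on S f \<Longrightarrow> x \<in> S \<Longrightarrow> isCont f x"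
  using smooth_on_imp_continuous_on continuous_on_eq_continuous_at by blast

lemma frechet_derivative_bounded_linear:
  "bounded_linear l \<Longrightarrow> f differentiable (at x) \<Longrightarrow>
    frechet_derivative (\<lambda>x. l (f x)) (at x) v = l (frechet_derivative f (at x) v)"
  by (rule frechet_derivative_at[THEN fun_cong, symmetric, OF bounded_linear.has_derivative])
    (simp_all add: frechet_derivative_works)

lemma has_real_derivative_along_line:
  fixes f :: "'b::euclidean_space \<Rightarrow> real"
  assumes "(f has_derivative f') (at (p + r *\<^sub>R v))"
  shows "((\<lambda>r. f (p + r *\<^sub>R v)) has_real_derivative f' v) (at r)"
proof -
  have "((\<lambda>r. p + r *\<^sub>R v) has_derivative (\<lambda>h. h *\<^sub>R v)) (at r)"
    by (auto intro!: derivative_eq_intros)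
  from diff_chain_at[OF this assms]
  have "((\<lambda>r. f (p + r *\<^sub>R v)) has_derivative (\<lambda>h. f' (h *\<^sub>R v))) (at r)"
    by (simp add: o_def)
  then show ?thesis
    using linear_scale[OF has_derivative_linear[OF assms]]
    by (simp add: has_field_derivative_def mult_commute_abs)
qed

text \<open>The mean value theorem is applied twice: to a \<mapsto> f (x + a v + s w) - f (x + a v),
  then to the derivative along v in the direction w. The point is that the second difference is
  symmetric in v and w.\<close>

lemma second_difference_mvt:
  fixes f :: "'b::euclidean_space \<Rightarrow> real"
  assumes "smooth_on S f" "ball x r \<subseteq> S" "s > 0" "s * norm v + s * norm w < r"
  obtains y where "dist x y \<le> s * norm v + s * norm w"
    "f (x + s *\<^sub>R v + s *\<^sub>R w) - f (x + s *\<^sub>R v) - f (x + s *\<^sub>R w) + f x =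
      s\<^sup>2 * frechet_derivative (\<lambda>y. frechet_derivative f (at y) v) (at y) w"
proof -
  let ?D = "\<lambda>y. frechet_derivative f (at y) v"
  let ?DD = "\<lambda>y. frechet_derivative ?D (at y) w"
  have d: "dist x (x + a *\<^sub>R v + b *\<^sub>R w) \<le> s * norm v + s * norm w"
    if "0 \<le> a" "a \<le> s" "0 \<le> b" "b \<le> s" for a b
  proof -
    have "dist x (x + a *\<^sub>R v + b *\<^sub>R w) = norm (a *\<^sub>R v + b *\<^sub>R w)"
      by (metis add.assoc add_diff_cancel_left' dist_commute dist_norm)
    also have "\<dots> \<le> a * norm v + b * norm w"
      using that by (intro norm_triangle_le) simp
    also have "\<dots> \<le> s * norm v + s * norm w"
      using that by (intro add_mono mult_right_mono) auto
    finally show ?thesis .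
  qed
  have mem: "x + a *\<^sub>R v + b *\<^sub>R w \<in> S" if "0 \<le> a" "a \<le> s" "0 \<le> b" "b \<le> s" for a b
  proof -
    have "dist x (x + a *\<^sub>R v + b *\<^sub>R w) < r"
      using d[OF that] assms(4) by linarith
    then show ?thesis using assms(2) by (auto simp: subset_iff)
  qed
  have 1: "((\<lambda>a. f (x + a *\<^sub>R v + s *\<^sub>R w) - f (x + a *\<^sub>R v)) has_real_derivative
      ?D (x + a *\<^sub>R v + s *\<^sub>R w) - ?D (x + a *\<^sub>R v)) (at a)" if "0 \<le> a" "a \<le> s" for a
  proof (rule DERIV_diff)
    have "((\<lambda>a. f ((x + s *\<^sub>R w) + a *\<^sub>R v)) has_real_derivative ?D ((x + s *\<^sub>R w) + a *\<^sub>R v)) (at a)"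
      using mem[of a s] that assms(3)
      by (intro has_real_derivative_along_line smooth_on_imp_has_derivative[OF assms(1)])
        (simp add: add_ac)
    then show "((\<lambda>a. f (x + a *\<^sub>R v + s *\<^sub>R w)) has_real_derivative ?D (x + a *\<^sub>R v + s *\<^sub>R w)) (at a)"
      by (simp add: add_ac)
    show "((\<lambda>a. f (x + a *\<^sub>R v)) has_real_derivative ?D (x + a *\<^sub>R v)) (at a)"
      using mem[of a 0] that assms(3)
      by (intro has_real_derivative_along_line smooth_on_imp_has_derivative[OF assms(1)]) simp
  qed
  obtain a where a: "0 < a" "a < s"
    "f (x + s *\<^sub>R v + s *\<^sub>R w) - f (x + s *\<^sub>R v) - (f (x + 0 *\<^sub>R v + s *\<^sub>R w) - f (x + 0 *\<^sub>R v)) =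
     (s - 0) * (?D (x + a *\<^sub>R v + s *\<^sub>R w) - ?D (x + a *\<^sub>R v))"
    using MVT2[OF assms(3) 1] by blast
  have 2: "((\<lambda>b. ?D (x + a *\<^sub>R v + b *\<^sub>R w)) has_real_derivative ?DD (x + a *\<^sub>R v + b *\<^sub>R w)) (at b)"
    if "0 \<le> b" "b \<le> s" for b
    using mem[of a b] that a
    by (intro has_real_derivative_along_line
        smooth_on_imp_has_derivative[OF smooth_on_frechet_derivative[OF assms(1)]]) simp
  obtain b where b: "0 < b" "b < s"
    "?D (x + a *\<^sub>R v + s *\<^sub>R w) - ?D (x + a *\<^sub>R v + 0 *\<^sub>R w) = (s - 0) * ?DD (x + a *\<^sub>R v + b *\<^sub>R w)"
    using MVT2[OF assms(3) 2] by blast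
  show thesis
  proof (rule that[of "x + a *\<^sub>R v + b *\<^sub>R w"])
    show "dist x (x + a *\<^sub>R v + b *\<^sub>R w) \<le> s * norm v + s * norm w"
      using a b by (intro d) auto
    show "f (x + s *\<^sub>R v + s *\<^sub>R w) - f (x + s *\<^sub>R v) - f (x + s *\<^sub>R w) + f x =
        s\<^sup>2 * ?DD (x + a *\<^sub>R v + b *\<^sub>R w)"
      using a(3) b(3) by (simp add: power2_eq_square algebra_simps)
  qed
qed

text \<open>The same second difference is read in both orders. Divided by s^2 it is one iterated
  derivative at a point near x and the other one at another such point; continuity of both does the
  rest.\<close>

lemma frechet_derivative_commute_real:
  fixes f :: "'b::euclidean_space \<Rightarrow> real"
  assumes "open S" "smooth_on S f" "x \<in> S"
  shows "frechet_derivative (\<lambda>y. frechet_derivative f (at y) v) (at x) w =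
    frechet_derivative (\<lambda>y. frechet_derivative f (at y) w) (at x) v"
proof -
  let ?A = "\<lambda>x. frechet_derivative (\<lambda>y. frechet_derivative f (at y) v) (at x) w"
  let ?B = "\<lambda>x. frechet_derivative (\<lambda>y. frechet_derivative f (at y) w) (at x) v"
  obtain r where r: "r > 0" "ball x r \<subseteq> S"
    using assms(1,3) open_contains_ball by blast
  have cont: "isCont ?A x" "isCont ?B x"
    by (rule smooth_on_isCont[OF assms(1) smooth_on_frechet_derivative assms(3)],
        rule smooth_on_frechet_derivative[OF assms(2)])+
  have "\<bar>?A x - ?B x\<bar> \<le> e" if e: "e > 0" for e
  proof -
    obtain d1 where d1: "d1 > 0" "\<And>y. dist y x < d1 \<Longrightarrow> dist (?A y) (?A x) < e/2"
      using cont(1) e unfolding continuous_at_eps_delta by (meson half_gt_zero)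
    obtain d2 where d2: "d2 > 0" "\<And>y. dist y x < d2 \<Longrightarrow> dist (?B y) (?B x) < e/2"
      using cont(2) e unfolding continuous_at_eps_delta by (meson half_gt_zero)
    define d where "d = min r (min d1 d2)"
    \<comment> \<open>The 1 keeps the denominator positive for v = w = 0, and the factor 2 puts the
      parallelogram spanned by s v and s w strictly inside the ball of radius
      \<open>d\<close>.\<close>
    define s where "s = d / (2 * (1 + norm v + norm w))"
    have pos: "1 + norm v + norm w > 0"
      using norm_ge_zero[of v] norm_ge_zero[of w] by linarith
    have d: "d > 0" using r d1 d2 by (simp add: d_def)
    have s: "s > 0" using d pos by (simp add: s_def)
    have "s * (1 + norm v + norm w) = d / 2"
      using pos by (simp add: s_def field_simps)
    then have sd: "s * norm v + s * norm w < d" "s * norm w + s * norm v < d"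
      using s d by (simp_all add: algebra_simps)
    obtain y where y: "dist x y \<le> s * norm v + s * norm w"
      "f (x + s *\<^sub>R v + s *\<^sub>R w) - f (x + s *\<^sub>R v) - f (x + s *\<^sub>R w) + f x = s\<^sup>2 * ?A y"
      using second_difference_mvt[OF assms(2) r(2) s, of v w] sd by (auto simp: d_def)
    obtain z where z: "dist x z \<le> s * norm w + s * norm v"
      "f (x + s *\<^sub>R w + s *\<^sub>R v) - f (x + s *\<^sub>R w) - f (x + s *\<^sub>R v) + f x = s\<^sup>2 * ?B z"
      using second_difference_mvt[OF assms(2) r(2) s, of w v] sd by (auto simp: d_def)
    have "s\<^sup>2 * ?A y = s\<^sup>2 * ?B z"
      using y(2) z(2) by (simp add: algebra_simps)
    then have "?A y = ?B z" using s by simp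
    moreover have "dist (?A y) (?A x) < e/2" "dist (?B z) (?B x) < e/2"
      using y(1) z(1) sd d1(2)[of y] d2(2)[of z] by (auto simp: d_def dist_commute)
    ultimately show ?thesis
      unfolding dist_real_def by linarith
  qed
  then have "\<bar>?A x - ?B x\<bar> \<le> 0"
    by - (rule field_le_epsilon, simp)
  then show ?thesis by simp
qed

lemma frechet_derivative_commute:
  fixes f :: "'b::euclidean_space \<Rightarrow> 'c::euclidean_space"
  assumes "open S" "smooth_on S f" "x \<in> S"
  shows "frechet_derivative (\<lambda>y. frechet_derivative f (at y) v) (at x) w =
    frechet_derivative (\<lambda>y. frechet_derivative f (at y) w) (at x) v"
proof (rule euclidean_eqI)
  fix b :: 'c
  have diff: "f differentiable (at y)" if "y \<in> S" for y
    using smooth_on_imp_has_derivative[OF assms(2) that] differentiable_def by blast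
  have fb: "smooth_on S (\<lambda>y. f y \<bullet> b)"
    by (rule smooth_on_bounded_linear[OF bounded_linear_inner_left assms(1,2)])
  have *: "frechet_derivative (\<lambda>y. frechet_derivative f (at y) v) (at x) w \<bullet> b =
    frechet_derivative (\<lambda>y. frechet_derivative (\<lambda>y. f y \<bullet> b) (at y) v) (at x) w" for v w
  proof -
    have D: "((\<lambda>y. frechet_derivative f (at y) v) has_derivative
        frechet_derivative (\<lambda>y. frechet_derivative f (at y) v) (at x)) (at x)"
      by (rule smooth_on_imp_has_derivative[OF smooth_on_frechet_derivative[OF assms(2)] assms(3)])
    have "((\<lambda>y. frechet_derivative (\<lambda>y. f y \<bullet> b) (at y) v) has_derivative
        (\<lambda>w. frechet_derivative (\<lambda>y. frechet_derivative f (at y) v) (at x) w \<bullet> b)) (at x)"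
      by (rule has_derivative_transform_within_open[OF
            bounded_linear.has_derivative[OF bounded_linear_inner_left D] assms(1,3)])
        (simp add: frechet_derivative_bounded_linear[OF bounded_linear_inner_left diff])
    from frechet_derivative_at[OF this, THEN fun_cong] show ?thesis .
  qed
  show "frechet_derivative (\<lambda>y. frechet_derivative f (at y) v) (at x) w \<bullet> b =
    frechet_derivative (\<lambda>y. frechet_derivative f (at y) w) (at x) v \<bullet> b"
    unfolding * by (rule frechet_derivative_commute_real[OF assms(1) fb assms(3)])
qed

section \<open>A smooth bump function\<close>

definition flat_exp :: "nat \<Rightarrow> real \<Rightarrow> real" where
  "flat_exp n x = (if x > 0 then exp (- inverse x) * inverse x ^ n else 0)"

lemma flat_exp_tendsto_0: "(flat_exp n \<longlongrightarrow> 0) (at 0)"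
proof (rule filterlim_split_at)
  show "(flat_exp n \<longlongrightarrow> 0) (at_left 0)"
    by (rule tendsto_eventually) (auto simp: eventually_at_filter flat_exp_def)
  have "((\<lambda>z. z ^ n / exp z) \<longlongrightarrow> (0::real)) at_top"
    by (rule tendsto_power_div_exp_0)
  then have "((\<lambda>x. inverse x ^ n / exp (inverse x)) \<longlongrightarrow> (0::real)) (at_right 0)"
    by (rule filterlim_compose) (rule filterlim_inverse_at_top_right)
  then show "(flat_exp n \<longlongrightarrow> 0) (at_right 0)"
    by (rule Lim_transform_eventually)
      (auto simp: eventually_at_filter flat_exp_def exp_minus field_simps)
qed

text \<open>The factor \<open>inverse x ^ n\<close> in \<open>flat_exp\<close> exists for this
  formula: differentiating exp (-1/x) produces powers of 1/x, and with these included the family is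
  closed under differentiation. Smoothness is then an induction over the order with \<open>n\<close>
  arbitrary.\<close>

lemma flat_exp_has_derivative:
  "(flat_exp n has_real_derivative flat_exp (n + 2) x - real n * flat_exp (n + 1) x) (at x)"
proof -
  consider "x < 0" | "x = 0" | "x > 0" by linarith
  then show ?thesis
  proof cases
    case 1
    have "((\<lambda>_. 0) has_real_derivative flat_exp (n + 2) x - real n * flat_exp (n + 1) x) (at x)"
      using 1 by (simp add: flat_exp_def)
    then show ?thesis
      by (rule has_field_derivative_transform_within_open[where S = "{..<0}"])
        (use 1 in \<open>auto simp: flat_exp_def\<close>)
  next
    case 2
    \<comment> \<open>The difference quotient at 0 is \<open>flat_exp (n + 1)\<close>, whose limit
      is known.\<close>
    have "((\<lambda>y. (flat_exp n y - flat_exp n 0) / (y - 0)) \<longlongrightarrow> 0) (at 0)"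
      by (rule Lim_transform_eventually[OF flat_exp_tendsto_0[of "n + 1"]])
        (auto simp: eventually_at_filter flat_exp_def field_simps)
    then show ?thesis
      using 2 by (simp add: has_field_derivative_iff flat_exp_def)
  next
    case 3
    have "((\<lambda>y. exp (- inverse y) * inverse y ^ n) has_real_derivative
        flat_exp (n + 2) x - real n * flat_exp (n + 1) x) (at x)"
    proof (cases n)
      case 0
      then show ?thesis
        using 3 by (auto intro!: derivative_eq_intros simp: flat_exp_def algebra_simps)
    next
      case (Suc k)
      have "(inverse has_real_derivative - (inverse x * inverse x)) (at x)"
        using DERIV_inverse[of x UNIV] 3 by (simp add: power2_eq_square)
      note i = DERIV_mult[OF DERIV_chain2[OF DERIV_exp DERIV_minus[OF this]] DERIV_power_Suc[OF this, of k]]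
      show ?thesis
        unfolding Suc by (rule DERIV_cong[OF i]) (use 3 in \<open>simp add: flat_exp_def algebra_simps\<close>)
    qed
    then show ?thesis
      by (rule has_field_derivative_transform_within_open[where S = "{0<..}"])
        (use 3 in \<open>auto simp: flat_exp_def\<close>)
  qed
qed

lemma smooth_on_flat_exp: "smooth_on UNIV (flat_exp n)"
proof -
  have "Ck_on k UNIV (flat_exp n)" for k
  proof (induction k arbitrary: n)
    case 0
    then show ?case
      using DERIV_isCont[OF flat_exp_has_derivative] by (simp add: continuous_on_eq_continuous_at)
  next
    case (Suc k)
    show ?case
    proof (subst Ck_on_Suc_iff[OF open_UNIV])
      show "(flat_exp n has_derivative (\<lambda>v. (flat_exp (n + 2) x + - real n * flat_exp (n + 1) x) * v)) (at x)"
        for x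
        using flat_exp_has_derivative[of n x] by (simp add: has_field_derivative_def)
      show "\<forall>v. Ck_on k UNIV (\<lambda>x. (flat_exp (n + 2) x + - real n * flat_exp (n + 1) x) * v)"
        by (intro allI Ck_on_bilinear[OF bounded_bilinear_mult open_UNIV] Ck_on_const
            Ck_on_add[OF open_UNIV] Suc)
    qed
  qed
  then show ?thesis by (simp add: smooth_on_def)
qed

lemma bump_function:
  fixes u0 :: "'b::euclidean_space"
  assumes "r > 0"
  shows "\<exists>\<beta>. smooth_on UNIV \<beta> \<and> (\<forall>u. \<beta> u \<ge> (0::real)) \<and> (\<forall>u. u \<notin> ball u0 r \<longrightarrow> \<beta> u = 0) \<and> \<beta> u0 > 0"
proof (intro exI conjI allI impI)
  \<comment> \<open>Positive exactly inside the ball. The squared distance is a polynomial, whereas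
    the norm is not smooth at the centre.\<close>
  let ?b = "\<lambda>u. flat_exp 0 (r\<^sup>2 - (u - u0) \<bullet> (u - u0))"
  show "smooth_on UNIV ?b"
    by (rule smooth_on_compose[OF open_UNIV open_UNIV _ _ smooth_on_flat_exp])
      (auto intro!: smooth_on_diff smooth_on_inner smooth_on_const smooth_on_ident)
  show "?b u \<ge> 0" for u by (simp add: flat_exp_def)
  show "?b u = 0" if "u \<notin> ball u0 r" for u
  proof -
    have "r \<le> norm (u - u0)" using that by (simp add: dist_norm norm_minus_commute)
    then have "r\<^sup>2 \<le> (u - u0) \<bullet> (u - u0)"
      using assms by (simp add: power_mono flip: power2_norm_eq_inner)
    then show ?thesis by (simp add: flat_exp_def)
  qed
  show "?b u0 > 0" using assms by (simp add: flat_exp_def)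
qed

section \<open>Integrals of compactly supported derivatives\<close>

lemma integral_cbox_eq_lborel:
  fixes f :: "'b::euclidean_space \<Rightarrow> real"
  assumes "continuous_on (cbox a b) f" "\<And>x. x \<notin> cbox a b \<Longrightarrow> f x = 0"
  shows "integral (cbox a b) f = integral\<^sup>L lborel f"
proof -
  have "set_integrable lborel (cbox a b) f"
    using borel_integrable_compact[OF compact_cbox assms(1)] by (simp add: set_integrable_def)
  from set_borel_integral_eq_integral(2)[OF this]
  have "(LINT x:cbox a b|lborel. f x) = integral (cbox a b) f" .
  moreover have "(\<lambda>x. indicator (cbox a b) x *\<^sub>R f x) = f"
    by (rule ext) (use assms(2) in \<open>auto simp: indicator_def\<close>)
  ultimately show ?thesis by (simp add: set_lebesgue_integral_def)
qed

lemma lborel_integral_translation: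
  fixes f :: "'b::euclidean_space \<Rightarrow> real"
  assumes [measurable]: "f \<in> borel_measurable borel"
  shows "(\<integral>x. f (x + c) \<partial>lborel) = integral\<^sup>L lborel f"
proof -
  have "integral\<^sup>L lborel f = integral\<^sup>L (distr lborel borel ((+) c)) f"
    by (simp add: lborel_distr_plus)
  also have "\<dots> = (\<integral>x. f (c + x) \<partial>lborel)"
    by (rule integral_distr) auto
  finally show ?thesis by (simp add: add.commute)
qed

text \<open>Translation invariance makes \<open>t \<mapsto> \<integral> h (x + t v)\<close> constant; differentiate it at \<open>t = 0\<close>.\<close>

lemma integral_directional_derivative_eq_0:
  fixes h :: "'b::euclidean_space \<Rightarrow> real"
  assumes h: "\<And>x. (h has_derivative h' x) (at x)" and c: "continuous_on UNIV (\<lambda>x. h' x v)"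
    and supp: "\<And>x. x \<notin> cbox a b \<Longrightarrow> h x = 0"
  shows "integral (cbox a b) (\<lambda>x. h' x v) = 0"
proof -
  \<comment> \<open>All points that a translation by t v with |t| \<le> 1 can move into the box. The
    set is compact, so one larger box contains the supports of all these translates of
    \<open>h\<close>.\<close>
  let ?S = "(\<lambda>(x, t). x - t *\<^sub>R v) ` (cbox a b \<times> {-1..1::real})"
  have "compact ?S"
    by (intro compact_continuous_image compact_Times compact_cbox compact_Icc)
      (auto intro!: continuous_intros simp: case_prod_beta)
  then obtain B where B: "?S \<subseteq> cbox (- B) B"
    using bounded_subset_cbox_symmetric compact_imp_bounded by blast
  have in_B: "x \<in> cbox (- B) B" if "x + t *\<^sub>R v \<in> cbox a b" "\<bar>t\<bar> \<le> 1" for x t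
  proof -
    have "x \<in> ?S" using that by (intro image_eqI[of _ _ "(x + t *\<^sub>R v, t)"]) auto
    then show ?thesis using B by blast
  qed
  have ch: "continuous_on UNIV h"
    using has_derivative_continuous[OF h] by (simp add: continuous_on_eq_continuous_at)
  have ct: "continuous_on T (\<lambda>x. h (x + t *\<^sub>R v))" for t T
    by (rule continuous_on_compose2[OF ch]) (auto intro!: continuous_intros)
  \<comment> \<open>An integral over a fixed box, to which the Leibniz rule applies; for |t| \<le> 1
    it equals the Lebesgue integral over the whole space, which is invariant under
    translation.\<close>
  define F where "F t = integral (cbox (- B) B) (\<lambda>x. h (x + t *\<^sub>R v))" for t
  have F: "F t = integral\<^sup>L lborel h" if "\<bar>t\<bar> \<le> 1" for t
  proof -
    have "F t = (\<integral>x. h (x + t *\<^sub>R v) \<partial>lborel)"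
      unfolding F_def using in_B[of _ t] that supp
      by (intro integral_cbox_eq_lborel ct) blast
    also have "\<dots> = integral\<^sup>L lborel h"
      by (intro lborel_integral_translation borel_measurable_continuous_onI ch)
    finally show ?thesis .
  qed
  have "(F has_field_derivative integral (cbox (- B) B) (\<lambda>x. h' (x + 0 *\<^sub>R v) v)) (at 0 within UNIV)"
    unfolding F_def
  proof (rule leibniz_rule_field_derivative)
    show "((\<lambda>t. h (x + t *\<^sub>R v)) has_field_derivative h' (x + t *\<^sub>R v) v) (at t within UNIV)" for x t
      using has_real_derivative_along_line[OF h] by simp
    show "(\<lambda>x. h (x + t *\<^sub>R v)) integrable_on cbox (- B) B" for t
      by (intro integrable_continuous ct)
    show "continuous_on (UNIV \<times> cbox (- B) B) (\<lambda>(t, x). h' (x + t *\<^sub>R v) v)"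
      unfolding case_prod_beta
      by (rule continuous_on_compose2[OF c]) (auto intro!: continuous_intros)
  qed auto
  moreover have "(F has_field_derivative 0) (at 0)"
  proof (rule has_field_derivative_transform_within_open[where S = "{-1<..<1}"])
    show "((\<lambda>t. integral\<^sup>L lborel h) has_field_derivative 0) (at 0)" by simp
  qed (use F in auto)
  ultimately have *: "integral (cbox (- B) B) (\<lambda>x. h' x v) = 0"
    using DERIV_unique by fastforce
  \<comment> \<open>\<open>h\<close> vanishes on the open complement of the original box, hence so
    does its derivative. This brings the integral back from the larger box to the given one.\<close>
  have zero: "h' x v = 0" if x: "x \<notin> cbox a b" for x
  proof -
    have "((\<lambda>_. 0) has_derivative (\<lambda>_. 0)) (at x)" by simp
    then have "(h has_derivative (\<lambda>_. 0)) (at x)"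
      by (rule has_derivative_transform_within_open[where s = "- cbox a b"])
        (use x supp in \<open>auto simp: open_Compl closed_cbox\<close>)
    with h have "h' x = (\<lambda>_. 0)" by (rule has_derivative_unique)
    then show ?thesis by simp
  qed
  have "integral (cbox a b) (\<lambda>x. h' x v) = integral\<^sup>L lborel (\<lambda>x. h' x v)"
    using continuous_on_subset[OF c] zero by (intro integral_cbox_eq_lborel) auto
  also have "\<dots> = integral (cbox (- B) B) (\<lambda>x. h' x v)"
    using continuous_on_subset[OF c] zero in_B[of _ 0]
    by (intro integral_cbox_eq_lborel[symmetric]) auto
  finally show ?thesis using * by simp
qed

section \<open>Derivative of the determinant\<close>

lemma has_derivative_det_at_identity:
  fixes N :: "'b::real_normed_vector \<Rightarrow> real ^ 'm ^ 'm"
  assumes "\<And>i j. ((\<lambda>x. N x $ i $ j) has_derivative N' i j) (at x)" "N x = mat 1"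
  shows "((\<lambda>x. det (N x)) has_derivative (\<lambda>v. \<Sum>i\<in>UNIV. N' i i v)) (at x)"
proof -
  let ?P = "{p. p permutes (UNIV :: 'm set)}"
  have "((\<lambda>x. det (N x)) has_derivative
     (\<lambda>v. \<Sum>p\<in>?P. of_int (sign p) * (\<Sum>i\<in>UNIV. N' i (p i) v * (\<Prod>j\<in>UNIV - {i}. N x $ j $ p j)))) (at x)"
    unfolding det_def by (intro has_derivative_sum has_derivative_mult_right has_derivative_prod assms)
  moreover have "(\<Sum>p\<in>?P. of_int (sign p) * (\<Sum>i\<in>UNIV. N' i (p i) v * (\<Prod>j\<in>UNIV - {i}. N x $ j $ p j))) =
      (\<Sum>i\<in>UNIV. N' i i v)" for v
  proof -
    \<comment> \<open>A permutation other than \<open>id\<close> moves at least two indices. When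
      the factor with index i is removed, an off-diagonal entry of \<open>mat 1\<close> remains, so
      only \<open>id\<close> contributes.\<close>
    have "(\<Prod>j\<in>UNIV - {i}. N x $ j $ p j) = 0" if p: "p \<in> ?P - {id}" for p i
    proof -
      have "\<exists>j. j \<noteq> i \<and> p j \<noteq> j"
      proof (rule ccontr)
        assume "\<not> ?thesis"
        then have fixed: "p j = j" if "j \<noteq> i" for j using that by blast
        moreover have "p i = i"
        proof (rule ccontr)
          assume "p i \<noteq> i"
          then have "p (p i) = p i" by (rule fixed)
          moreover have "inj p" using p permutes_inj by blast
          ultimately show False using \<open>p i \<noteq> i\<close> by (metis injD)
        qed
        ultimately have "p = id" by (metis eq_id_iff)
        then show False using p by simp
      qed
      then obtain j where "j \<noteq> i" "p j \<noteq> j" by blast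
      then show ?thesis
        using assms(2) by (intro prod_zero) (auto simp: mat_def intro!: bexI[of _ j])
    qed
    then have "(\<Sum>p\<in>?P. of_int (sign p) * (\<Sum>i\<in>UNIV. N' i (p i) v * (\<Prod>j\<in>UNIV - {i}. N x $ j $ p j))) =
       (\<Sum>p\<in>{id}. of_int (sign p) * (\<Sum>i\<in>UNIV. N' i (p i) v * (\<Prod>j\<in>UNIV - {i}. N x $ j $ p j)))"
      by (intro sum.mono_neutral_right) (simp_all add: permutes_id del: prod_zero_iff)
    also have "\<dots> = (\<Sum>i\<in>UNIV. N' i i v)"
      using assms(2) by (simp add: mat_def)
    finally show ?thesis .
  qed
  ultimately show ?thesis by (simp add: has_derivative_eq_rhs)
qed

text \<open>Jacobi's formula, reduced to the identity matrix by factoring det (M y) = det (M x) det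
  (I M y), where I is the inverse of M x.\<close>

lemma has_derivative_det:
  fixes M :: "'b::real_normed_vector \<Rightarrow> real ^ 'm ^ 'm"
  assumes M: "\<And>i j. ((\<lambda>x. M x $ i $ j) has_derivative M' i j) (at x)" and "det (M x) \<noteq> 0"
  shows "((\<lambda>x. det (M x)) has_derivative
    (\<lambda>v. det (M x) * (\<Sum>k\<in>UNIV. \<Sum>l\<in>UNIV. matrix_inv (M x) $ k $ l * M' l k v))) (at x)"
proof -
  let ?I = "matrix_inv (M x)"
  have "((\<lambda>y. det (?I ** M y)) has_derivative
      (\<lambda>v. \<Sum>k\<in>UNIV. \<Sum>l\<in>UNIV. ?I $ k $ l * M' l k v)) (at x)"
  proof (rule has_derivative_det_at_identity[where N' = "\<lambda>i j v. \<Sum>l\<in>UNIV. ?I $ i $ l * M' l j v"])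
    show "((\<lambda>y. (?I ** M y) $ i $ j) has_derivative (\<lambda>v. \<Sum>l\<in>UNIV. ?I $ i $ l * M' l j v)) (at x)"
      for i j
      unfolding matrix_matrix_mult_def vec_lambda_beta
      by (intro has_derivative_sum has_derivative_mult_right M)
    show "?I ** M x = mat 1" by (rule matrix_inv_inverse[OF assms(2)])
  qed
  then have "((\<lambda>y. det (M x) * det (?I ** M y)) has_derivative
      (\<lambda>v. det (M x) * (\<Sum>k\<in>UNIV. \<Sum>l\<in>UNIV. ?I $ k $ l * M' l k v))) (at x)"
    by (rule has_derivative_mult_right)
  moreover have "det (M x) * det (?I ** M y) = det (M y)" for y
  proof -
    have "det (M x) * det ?I = 1"
      by (simp add: matrix_inv_inverse(1)[OF assms(2)] flip: det_mul)
    then show ?thesis by (simp add: det_mul flip: mult.assoc)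
  qed
  ultimately show ?thesis by simp
qed

section \<open>Calculus in charts\<close>

text \<open>A chart restricted to a part U of its domain, with the inverse
  \<open>coord_inv c\<close> of the whole chart kept. Thus the same \<open>pd c i\<close> serves on
  the domain, on overlaps with other charts and on complements of supports.\<close>

definition chart_open :: "('a, 'm::finite) chart \<Rightarrow> 'a set \<Rightarrow> bool" where
  "chart_open c U \<longleftrightarrow> U \<subseteq> dom_of c \<and> open (coord c ` U) \<and> inj_on (coord c) (dom_of c)"

definition smooth_in ::
  "('a, 'm::finite) chart \<Rightarrow> 'a set \<Rightarrow> ('a \<Rightarrow> 'e::real_normed_vector) \<Rightarrow> bool" where
  "smooth_in c U f \<longleftrightarrow> smooth_on (coord c ` U) (f \<circ> coord_inv c)"

lemma coord_inv_coord: "chart_open c U \<Longrightarrow> p \<in> U \<Longrightarrow> coord_inv c (coord c p) = p"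
  by (auto simp: chart_open_def intro: inv_into_f_f)

lemma chart_open_coord_inv: "chart_open c U \<Longrightarrow> u \<in> coord c ` U \<Longrightarrow> coord_inv c u \<in> U"
  by (auto simp: coord_inv_coord)

lemma coord_coord_inv: "chart_open c U \<Longrightarrow> u \<in> coord c ` U \<Longrightarrow> coord c (coord_inv c u) = u"
  by (auto simp: coord_inv_coord)

lemma chart_openD: "chart_open c U \<Longrightarrow> open (coord c ` U)"
  by (simp add: chart_open_def)

lemma pd_eqI:
  "((f \<circ> coord_inv c) has_derivative D) (at (coord c p)) \<Longrightarrow> pd c i f p = D (axis i 1)"
  unfolding pd_def by (drule frechet_derivative_at) simp

lemma smooth_in_has_derivative:
  "smooth_in c U f \<Longrightarrow> p \<in> U \<Longrightarrow> ((\<lambda>u. f (coord_inv c u)) has_derivative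
    frechet_derivative (f \<circ> coord_inv c) (at (coord c p))) (at (coord c p))"
  using smooth_on_imp_has_derivative[of "coord c ` U" "f \<circ> coord_inv c" "coord c p"]
  by (auto simp: smooth_in_def o_def)

lemma smooth_in_cong:
  "chart_open c U \<Longrightarrow> (\<And>q. q \<in> U \<Longrightarrow> f q = g q) \<Longrightarrow> smooth_in c U f \<Longrightarrow> smooth_in c U g"
  unfolding smooth_in_def
  by (erule smooth_on_cong[rotated 2]) (auto simp: chart_open_coord_inv chart_openD)

lemma smooth_in_subset: "smooth_in c U f \<Longrightarrow> V \<subseteq> U \<Longrightarrow> smooth_in c V f"
  unfolding smooth_in_def by (rule smooth_on_subset) auto

lemma smooth_in_const: "smooth_in c U (\<lambda>q. k)"
  by (simp add: smooth_in_def o_def smooth_on_const)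

lemma smooth_in_bounded_linear:
  "bounded_linear l \<Longrightarrow> chart_open c U \<Longrightarrow> smooth_in c U f \<Longrightarrow> smooth_in c U (\<lambda>q. l (f q))"
  unfolding smooth_in_def o_def by (rule smooth_on_bounded_linear[OF _ chart_openD])

lemma smooth_in_bilinear:
  "bounded_bilinear m \<Longrightarrow> chart_open c U \<Longrightarrow> smooth_in c U f \<Longrightarrow> smooth_in c U h \<Longrightarrow>
    smooth_in c U (\<lambda>q. m (f q) (h q))"
  unfolding smooth_in_def o_def by (rule smooth_on_bilinear[OF _ chart_openD])

lemma smooth_in_add:
  "chart_open c U \<Longrightarrow> smooth_in c U f \<Longrightarrow> smooth_in c U h \<Longrightarrow> smooth_in c U (\<lambda>q. f q + h q)"
  unfolding smooth_in_def o_def by (intro smooth_on_add chart_openD)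

lemma smooth_in_diff:
  "chart_open c U \<Longrightarrow> smooth_in c U f \<Longrightarrow> smooth_in c U h \<Longrightarrow> smooth_in c U (\<lambda>q. f q - h q)"
  unfolding smooth_in_def o_def by (intro smooth_on_diff chart_openD)

lemma smooth_in_sum:
  "chart_open c U \<Longrightarrow> (\<And>i. i \<in> I \<Longrightarrow> smooth_in c U (f i)) \<Longrightarrow> smooth_in c U (\<lambda>q. \<Sum>i\<in>I. f i q)"
  unfolding smooth_in_def o_def by (intro smooth_on_sum chart_openD)

lemmas smooth_in_scaleR = smooth_in_bilinear[OF bounded_bilinear_scaleR]
lemmas smooth_in_inner = smooth_in_bilinear[OF bounded_bilinear_inner]
lemmas smooth_in_mult = smooth_in_bilinear[OF bounded_bilinear_mult]

lemma pd_coord_inv: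
  assumes "chart_open c U" "u \<in> coord c ` U"
  shows "pd c i f (coord_inv c u) = frechet_derivative (f \<circ> coord_inv c) (at u) (axis i 1)"
proof -
  have "coord c (coord_inv c u) = u"
    by (rule coord_coord_inv[OF assms])
  then show ?thesis by (simp add: pd_def)
qed

lemma smooth_in_pd:
  assumes "chart_open c U" "smooth_in c U f"
  shows "smooth_in c U (pd c i f)"
  unfolding smooth_in_def
  by (rule smooth_on_cong[OF chart_openD[OF assms(1)]
        _ smooth_on_frechet_derivative[OF assms(2)[unfolded smooth_in_def], where v = "axis i 1"]])
    (simp add: pd_coord_inv[OF assms(1)])

lemmas smooth_in_intros = smooth_in_const smooth_in_add smooth_in_diff smooth_in_sum
  smooth_in_scaleR smooth_in_inner smooth_in_mult smooth_in_pd

lemma pd_cong: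
  assumes "chart_open c U" "smooth_in c U f" "p \<in> U" "\<And>q. q \<in> U \<Longrightarrow> f q = h q"
  shows "pd c i f p = pd c i h p"
proof -
  have "((\<lambda>u. h (coord_inv c u)) has_derivative
      frechet_derivative (f \<circ> coord_inv c) (at (coord c p))) (at (coord c p))"
    by (rule has_derivative_transform_within_open[OF smooth_in_has_derivative[OF assms(2,3)]
          chart_openD[OF assms(1)]])
      (use assms in \<open>auto simp: chart_open_coord_inv\<close>)
  then have "pd c i h p = frechet_derivative (f \<circ> coord_inv c) (at (coord c p)) (axis i 1)"
    by (intro pd_eqI) (simp add: o_def)
  then show ?thesis by (simp add: pd_def)
qed

lemma pd_const: "pd c i (\<lambda>q. k) p = 0"
  by (subst pd_eqI[where D = "\<lambda>_. 0"]) (auto simp: o_def)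

lemma pd_add:
  assumes "smooth_in c U f" "smooth_in c U h" "p \<in> U"
  shows "pd c i (\<lambda>q. f q + h q) p = pd c i f p + pd c i h p"
proof -
  let ?F = "frechet_derivative (f \<circ> coord_inv c) (at (coord c p))"
  let ?H = "frechet_derivative (h \<circ> coord_inv c) (at (coord c p))"
  have "((\<lambda>u. f (coord_inv c u) + h (coord_inv c u)) has_derivative (\<lambda>v. ?F v + ?H v)) (at (coord c p))"
    by (intro has_derivative_add smooth_in_has_derivative[OF _ assms(3)] assms)
  then show ?thesis
    by (subst pd_eqI[where D = "\<lambda>v. ?F v + ?H v"]) (simp_all add: o_def pd_def)
qed

lemma pd_diff:
  assumes "smooth_in c U f" "smooth_in c U h" "p \<in> U"
  shows "pd c i (\<lambda>q. f q - h q) p = pd c i f p - pd c i h p"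
proof -
  let ?F = "frechet_derivative (f \<circ> coord_inv c) (at (coord c p))"
  let ?H = "frechet_derivative (h \<circ> coord_inv c) (at (coord c p))"
  have "((\<lambda>u. f (coord_inv c u) - h (coord_inv c u)) has_derivative (\<lambda>v. ?F v - ?H v)) (at (coord c p))"
    by (intro has_derivative_diff smooth_in_has_derivative[OF _ assms(3)] assms)
  then show ?thesis
    by (subst pd_eqI[where D = "\<lambda>v. ?F v - ?H v"]) (simp_all add: o_def pd_def)
qed

lemma pd_sum:
  assumes "\<And>j. j \<in> I \<Longrightarrow> smooth_in c U (f j)" "p \<in> U"
  shows "pd c i (\<lambda>q. \<Sum>j\<in>I. f j q) p = (\<Sum>j\<in>I. pd c i (f j) p)"
proof -
  have "((\<lambda>u. \<Sum>j\<in>I. f j (coord_inv c u)) has_derivative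
      (\<lambda>v. \<Sum>j\<in>I. frechet_derivative (f j \<circ> coord_inv c) (at (coord c p)) v)) (at (coord c p))"
    by (intro has_derivative_sum smooth_in_has_derivative[OF assms(1)] assms(2))
  then show ?thesis
    by (subst pd_eqI[where D = "\<lambda>v. \<Sum>j\<in>I. frechet_derivative (f j \<circ> coord_inv c) (at (coord c p)) v"])
      (simp_all add: o_def pd_def)
qed

lemma pd_bounded_linear:
  assumes "bounded_linear l" "smooth_in c U f" "p \<in> U"
  shows "pd c i (\<lambda>q. l (f q)) p = l (pd c i f p)"
proof -
  have "((\<lambda>u. l (f (coord_inv c u))) has_derivative
      (\<lambda>v. l (frechet_derivative (f \<circ> coord_inv c) (at (coord c p)) v))) (at (coord c p))"
    by (rule bounded_linear.has_derivative[OF assms(1) smooth_in_has_derivative[OF assms(2,3)]])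
  then show ?thesis
    by (subst pd_eqI[where D = "\<lambda>v. l (frechet_derivative (f \<circ> coord_inv c) (at (coord c p)) v)"])
      (simp_all add: o_def pd_def)
qed

lemma pd_bilinear:
  assumes "bounded_bilinear m" "chart_open c U" "smooth_in c U f" "smooth_in c U h" "p \<in> U"
  shows "pd c i (\<lambda>q. m (f q) (h q)) p = m (f p) (pd c i h p) + m (pd c i f p) (h p)"
proof -
  let ?F = "frechet_derivative (f \<circ> coord_inv c) (at (coord c p))"
  let ?H = "frechet_derivative (h \<circ> coord_inv c) (at (coord c p))"
  have "((\<lambda>u. m (f (coord_inv c u)) (h (coord_inv c u))) has_derivative
      (\<lambda>v. m (f (coord_inv c (coord c p))) (?H v) + m (?F v) (h (coord_inv c (coord c p))))) (at (coord c p))"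
    by (rule bounded_bilinear.FDERIV[OF assms(1)] smooth_in_has_derivative[OF _ assms(5)] assms)+
  then show ?thesis
    by (subst pd_eqI[where D = "\<lambda>v. m (f p) (?H v) + m (?F v) (h p)"])
      (simp_all add: o_def pd_def coord_inv_coord[OF assms(2,5)])
qed

lemmas pd_scaleR = pd_bilinear[OF bounded_bilinear_scaleR]
lemmas pd_inner = pd_bilinear[OF bounded_bilinear_inner]
lemmas pd_mult = pd_bilinear[OF bounded_bilinear_mult]

lemma pd_commute:
  fixes f :: "'a \<Rightarrow> 'e::euclidean_space"
  assumes "chart_open c U" "smooth_in c U f" "p \<in> U"
  shows "pd c i (pd c j f) p = pd c j (pd c i f) p"
proof -
  let ?f = "f \<circ> coord_inv c"
  have sm: "smooth_on (coord c ` U) ?f" using assms(2) by (simp add: smooth_in_def)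
  have "pd c i (pd c j f) p =
      frechet_derivative (\<lambda>u. frechet_derivative ?f (at u) (axis j 1)) (at (coord c p)) (axis i 1)" for i j
  proof (rule pd_eqI, rule has_derivative_transform_within_open[where s = "coord c ` U"])
    show "((\<lambda>u. frechet_derivative ?f (at u) (axis j 1)) has_derivative
      frechet_derivative (\<lambda>u. frechet_derivative ?f (at u) (axis j 1)) (at (coord c p))) (at (coord c p))"
      by (rule smooth_on_imp_has_derivative[OF smooth_on_frechet_derivative[OF sm]])
        (use assms(3) in auto)
  qed (use assms(3) in \<open>auto simp: chart_openD[OF assms(1)] pd_coord_inv[OF assms(1)]\<close>)
  then show ?thesis
    using frechet_derivative_commute[OF chart_openD[OF assms(1)] sm] assms(3) by simp
qed

text \<open>The chain rule for the transition map, with the image of \<open>axis i 1\<close> under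
  its derivative expanded in the standard basis.\<close>

lemma pd_change_chart:
  fixes f :: "'a \<Rightarrow> 'e::euclidean_space"
  assumes "chart_open c U" "chart_open c' U'" "U \<subseteq> U'"
    "smooth_on (coord c ` U) (coord c' \<circ> coord_inv c)" "smooth_in c' U' f" "p \<in> U"
  shows "pd c i f p = (\<Sum>a\<in>UNIV. pd c i (\<lambda>q. coord c' q $ a) p *\<^sub>R pd c' a f p)"
proof -
  let ?T = "coord c' \<circ> coord_inv c"
  let ?DT = "frechet_derivative ?T (at (coord c p))"
  let ?Df = "frechet_derivative (f \<circ> coord_inv c') (at (coord c' p))"
  have inv: "coord_inv c (coord c p) = p" by (rule coord_inv_coord[OF assms(1,6)])
  have T: "(?T has_derivative ?DT) (at (coord c p))"
    by (rule smooth_on_imp_has_derivative[OF assms(4)]) (use assms(6) in auto)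
  have "((\<lambda>u. f (coord_inv c' u)) has_derivative ?Df) (at (?T (coord c p)))"
    using smooth_in_has_derivative[OF assms(5)] assms(3,6) inv by auto
  from diff_chain_at[OF T this]
  have "((f \<circ> coord_inv c) has_derivative (?Df \<circ> ?DT)) (at (coord c p))"
  proof (rule has_derivative_transform_within_open)
    show "coord c p \<in> coord c ` U" using assms(6) by blast
    show "((\<lambda>u. f (coord_inv c' u)) \<circ> ?T) u = (f \<circ> coord_inv c) u" if "u \<in> coord c ` U" for u
      using that assms(3) coord_inv_coord[OF assms(1)] coord_inv_coord[OF assms(2)] by auto
  qed (rule chart_openD[OF assms(1)])
  then have 1: "pd c i f p = ?Df (?DT (axis i 1))"
    by (simp add: pd_eqI)
  have 2: "pd c i (\<lambda>q. coord c' q $ a) p = ?DT (axis i 1) $ a" for a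
  proof (rule pd_eqI)
    show "((\<lambda>q. coord c' q $ a) \<circ> coord_inv c has_derivative (\<lambda>v. ?DT v $ a)) (at (coord c p))"
      using bounded_linear.has_derivative[OF bounded_linear_vec_nth T] by (simp add: o_def)
  qed
  have "linear ?Df"
    using smooth_in_has_derivative[OF assms(5)] assms(3,6) has_derivative_linear by blast
  then have "?Df (\<Sum>a\<in>UNIV. ?DT (axis i 1) $ a *\<^sub>R axis a 1) =
      (\<Sum>a\<in>UNIV. ?DT (axis i 1) $ a *\<^sub>R ?Df (axis a 1))"
    by (simp add: linear_sum linear_scale)
  moreover have "(\<Sum>a\<in>UNIV. ?DT (axis i 1) $ a *\<^sub>R axis a 1) = ?DT (axis i 1)"
    using basis_expansion[of "?DT (axis i 1)"] by (simp add: scalar_mult_eq_scaleR)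
  ultimately have "?Df (?DT (axis i 1)) = (\<Sum>a\<in>UNIV. ?DT (axis i 1) $ a *\<^sub>R ?Df (axis a 1))"
    by simp
  with 1 2 show ?thesis by (simp add: pd_def[of c'])
qed

lemma smooth_in_change_chart:
  fixes f :: "'a \<Rightarrow> 'e::euclidean_space"
  assumes "chart_open c U" "chart_open c' U'" "U \<subseteq> U'"
    "smooth_on (coord c ` U) (coord c' \<circ> coord_inv c)" "smooth_in c' U' f"
  shows "smooth_in c U f"
  unfolding smooth_in_def
proof (rule smooth_on_cong[OF chart_openD[OF assms(1)]])
  show "smooth_on (coord c ` U) (\<lambda>u. (f \<circ> coord_inv c') ((coord c' \<circ> coord_inv c) u))"
    by (rule smooth_on_compose[OF chart_openD[OF assms(1)] chart_openD[OF assms(2)] _ assms(4)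
          assms(5)[unfolded smooth_in_def]])
      (use assms(3) coord_inv_coord[OF assms(1)] in auto)
  show "(f \<circ> coord_inv c') ((coord c' \<circ> coord_inv c) u) = (f \<circ> coord_inv c) u"
    if "u \<in> coord c ` U" for u
    using that assms(3) coord_inv_coord[OF assms(1)] coord_inv_coord[OF assms(2)] by auto
qed

text \<open>The trace of the covariant Hessian. Unlike the divergence of the gradient, it contains
  no derivative of the inverse metric and applies directly to vector-valued maps.
  \<open>divergence_gradient\<close> identifies the two.\<close>

definition chart_laplacian ::
  "('a, 'm::finite) metric \<Rightarrow> ('a, 'm) chart \<Rightarrow> ('a \<Rightarrow> 'e::real_normed_vector) \<Rightarrow> 'a \<Rightarrow> 'e" where
  "chart_laplacian g c f p = (\<Sum>i\<in>UNIV. \<Sum>j\<in>UNIV. ginv g c p i j *\<^sub>R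
     (pd c i (pd c j f) p - (\<Sum>k\<in>UNIV. christoffel g c k i j p *\<^sub>R pd c k f p)))"

text \<open>The second-order part of the Laplacian. By itself it depends on the chart;
  \<open>trace_hess_overlap\<close> measures how.\<close>

definition trace_hess ::
  "('a, 'm::finite) metric \<Rightarrow> ('a, 'm) chart \<Rightarrow> ('a \<Rightarrow> 'e::real_normed_vector) \<Rightarrow> 'a \<Rightarrow> 'e" where
  "trace_hess g c f p = (\<Sum>i\<in>UNIV. \<Sum>j\<in>UNIV. ginv g c p i j *\<^sub>R pd c i (pd c j f) p)"

lemma pd_pd_bounded_linear:
  assumes "bounded_linear l" "chart_open c U" "smooth_in c U f" "p \<in> U"
  shows "pd c i (pd c j (\<lambda>q. l (f q))) p = l (pd c i (pd c j f) p)"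
proof -
  have "pd c i (pd c j (\<lambda>q. l (f q))) p = pd c i (\<lambda>q. l (pd c j f q)) p"
    by (rule pd_cong[OF assms(2) smooth_in_pd[OF assms(2) smooth_in_bounded_linear[OF assms(1-3)]]
          assms(4) pd_bounded_linear[OF assms(1,3)]])
  also have "\<dots> = l (pd c i (pd c j f) p)"
    by (rule pd_bounded_linear[OF assms(1) smooth_in_pd[OF assms(2,3)] assms(4)])
  finally show ?thesis .
qed

lemma chart_laplacian_bounded_linear:
  assumes "bounded_linear l" "chart_open c U" "smooth_in c U f" "p \<in> U"
  shows "chart_laplacian g c (\<lambda>q. l (f q)) p = l (chart_laplacian g c f p)"
proof -
  interpret l: bounded_linear l by fact
  show ?thesis
    unfolding chart_laplacian_def pd_pd_bounded_linear[OF assms] pd_bounded_linear[OF assms(1,3,4)]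
    by (simp add: l.sum l.scaleR l.diff)
qed

lemma pd_pd_add:
  assumes "chart_open c U" "smooth_in c U f" "smooth_in c U h" "p \<in> U"
  shows "pd c i (pd c j (\<lambda>q. f q + h q)) p = pd c i (pd c j f) p + pd c i (pd c j h) p"
proof -
  have "pd c i (pd c j (\<lambda>q. f q + h q)) p = pd c i (\<lambda>q. pd c j f q + pd c j h q) p"
    by (rule pd_cong[OF assms(1) smooth_in_pd[OF assms(1) smooth_in_add[OF assms(1-3)]]
          assms(4) pd_add[OF assms(2,3)]])
  also have "\<dots> = pd c i (pd c j f) p + pd c i (pd c j h) p"
    by (rule pd_add[OF smooth_in_pd[OF assms(1,2)] smooth_in_pd[OF assms(1,3)] assms(4)])
  finally show ?thesis .
qed

lemma chart_laplacian_add: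
  assumes "chart_open c U" "smooth_in c U f" "smooth_in c U h" "p \<in> U"
  shows "chart_laplacian g c (\<lambda>q. f q + h q) p = chart_laplacian g c f p + chart_laplacian g c h p"
  unfolding chart_laplacian_def pd_pd_add[OF assms] pd_add[OF assms(2-4)]
  by (simp add: algebra_simps sum.distrib sum_subtractf scaleR_sum_right)

section \<open>The metric in charts\<close>

text \<open>Join \<open>mat 1\<close> to \<open>G\<close> by a segment. The quadratic forms of all
  matrices on it are positive, so these matrices are invertible, and the determinant cannot change
  sign on the way.\<close>

lemma det_pos_of_pos_def:
  fixes G :: "real ^ 'm ^ 'm"
  assumes "\<And>v. v \<noteq> 0 \<Longrightarrow> v \<bullet> (G *v v) > 0"
  shows "det G > 0"
proof -
  let ?H = "\<lambda>t. (\<chi> i j. (1 - t) * mat 1 $ i $ j + t * G $ i $ j) :: real ^ 'm ^ 'm"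
  have nz: "det (?H t) \<noteq> 0" if t: "0 \<le> t" "t \<le> 1" for t
  proof
    assume "det (?H t) = 0"
    then have "\<not> invertible (?H t)" by (simp add: invertible_det_nz)
    then obtain v where v: "?H t *v v = 0" "v \<noteq> 0"
      unfolding invertible_left_inverse matrix_left_invertible_ker by blast
    have "?H t = (1 - t) *\<^sub>R mat 1 + t *\<^sub>R G" by (simp add: vec_eq_iff)
    then have "?H t *v v = (1 - t) *\<^sub>R v + t *\<^sub>R (G *v v)"
      by (simp add: matrix_vector_mult_add_rdistrib scaleR_matrix_vector_assoc flip: scaleR_matrix_vector_assoc)
    then have "v \<bullet> (?H t *v v) = (1 - t) * (v \<bullet> v) + t * (v \<bullet> (G *v v))"
      by (simp add: inner_add_right)
    moreover have "v \<bullet> v > 0" "v \<bullet> (G *v v) > 0" using v(2) assms by auto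
    moreover have "(1 - t) * (v \<bullet> v) \<ge> 0" "t * (v \<bullet> (G *v v)) \<ge> 0"
      using t \<open>v \<bullet> v > 0\<close> \<open>v \<bullet> (G *v v) > 0\<close> by auto
    ultimately show False
      using v(1) t by (cases "t = 0") (auto simp: add_nonneg_eq_0_iff)
  qed
  have "continuous_on {0..1} (\<lambda>t. det (?H t))"
    unfolding det_def by (auto intro!: continuous_intros)
  moreover have "?H 0 = mat 1" "?H 1 = G" by (simp_all add: vec_eq_iff)
  ultimately have "\<exists>t. 0 \<le> t \<and> t \<le> 1 \<and> det (?H t) = 0" if "det G \<le> 0"
    using that IVT2'[of "\<lambda>t. det (?H t)" 1 0 0] by simp
  then show ?thesis using nz by fastforce
qed

lemma sum_delta_mult:
  "(\<Sum>a\<in>UNIV. (if a = k then 1 else 0) * (f a :: real)) = f (k :: 'k::finite)"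
  "(\<Sum>a\<in>UNIV. (if k = a then 1 else 0) * (f a :: real)) = f k"
  "(\<Sum>a\<in>UNIV. f a * (if a = k then 1 else 0)) = f k"
  "(\<Sum>a\<in>UNIV. f a * (if k = a then 1 else 0)) = f k"
  by (simp_all add: if_distrib if_distribR cong: if_cong)

locale riemannian_manifold =
  fixes A :: "('a::{second_countable_topology, t2_space}, 'm::finite) chart set"
    and g :: "('a, 'm) metric"
  assumes atlas: "smooth_atlas A"
    and metric: "riemannian_metric A g"
begin

lemma chart_open_open: "c \<in> A \<Longrightarrow> open U \<Longrightarrow> U \<subseteq> dom_of c \<Longrightarrow> chart_open c U"
proof -
  assume c: "c \<in> A" and U: "open U" "U \<subseteq> dom_of c"
  have h: "homeomorphism (dom_of c) (img_of c) (coord c) (coord_inv c)" "open (img_of c)"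
    using atlas c by (auto simp: smooth_atlas_def)
  have "openin (top_of_set (img_of c)) (coord c ` U)"
    by (rule homeomorphism_imp_open_map[OF h(1)]) (use U in \<open>auto simp: openin_open\<close>)
  then have "open (coord c ` U)"
    using h(2) openin_open_trans by blast
  moreover have "inj_on (coord c) (dom_of c)"
    using h(1) by (auto simp: homeomorphism_def intro: inj_on_inverseI)
  ultimately show ?thesis using U by (simp add: chart_open_def)
qed

lemma open_dom: "c \<in> A \<Longrightarrow> open (dom_of c)"
  using atlas by (simp add: smooth_atlas_def)

lemma chart_dom: "c \<in> A \<Longrightarrow> chart_open c (dom_of c)"
  by (rule chart_open_open) (auto simp: open_dom)

lemma chart_overlap: "c \<in> A \<Longrightarrow> c' \<in> A \<Longrightarrow> chart_open c (dom_of c \<inter> dom_of c')"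
  by (rule chart_open_open) (auto simp: open_dom)

lemma smooth_transition:
  "c \<in> A \<Longrightarrow> c' \<in> A \<Longrightarrow> smooth_on (coord c ` (dom_of c \<inter> dom_of c')) (coord c' \<circ> coord_inv c)"
  using atlas by (simp add: smooth_atlas_def)

lemma continuous_coord: "c \<in> A \<Longrightarrow> continuous_on (dom_of c) (coord c)"
  using atlas by (auto simp: smooth_atlas_def homeomorphism_def)

lemma continuous_coord_inv: "c \<in> A \<Longrightarrow> continuous_on (img_of c) (coord_inv c)"
  using atlas by (auto simp: smooth_atlas_def homeomorphism_def)

lemma chart_at: "chart_at A p \<in> A" "p \<in> dom_of (chart_at A p)"
proof -
  have "p \<in> (\<Union>c\<in>A. dom_of c)" using atlas by (simp add: smooth_atlas_def)
  then have "\<exists>c. c \<in> A \<and> p \<in> dom_of c" by blast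
  from someI_ex[OF this] show "chart_at A p \<in> A" "p \<in> dom_of (chart_at A p)"
    by (auto simp: chart_at_def)
qed

lemma smooth_mapD: "smooth_map A f \<Longrightarrow> c \<in> A \<Longrightarrow> smooth_in c (dom_of c) f"
  by (simp add: smooth_map_def smooth_in_def)

lemma smooth_mapI: "(\<And>c. c \<in> A \<Longrightarrow> smooth_in c (dom_of c) f) \<Longrightarrow> smooth_map A f"
  by (simp add: smooth_map_def smooth_in_def)

lemma smooth_in_continuous_on:
  assumes c: "c \<in> A" and "smooth_in c (dom_of c) f"
  shows "continuous_on (dom_of c) f"
proof -
  have "continuous_on (dom_of c) (\<lambda>q. (f \<circ> coord_inv c) (coord c q))"
    using smooth_on_imp_continuous_on[OF assms(2)[unfolded smooth_in_def]]
    by (rule continuous_on_compose2[OF _ continuous_coord[OF c]]) auto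
  then show ?thesis
    by (rule continuous_on_cong[THEN iffD1, rotated 2])
      (auto simp: coord_inv_coord[OF chart_dom[OF c]])
qed

lemma smooth_in_continuous_on_cbox:
  assumes "c \<in> A" "cbox a b \<subseteq> img_of c" "smooth_in c (dom_of c) k"
  shows "continuous_on (cbox a b) (\<lambda>u. k (coord_inv c u))"
  using smooth_on_imp_continuous_on[OF assms(3)[unfolded smooth_in_def]] assms(2)
  by (auto simp: o_def intro: continuous_on_subset)

lemma smooth_map_continuous:
  assumes "smooth_map A f"
  shows "continuous_on UNIV f"
proof (rule continuous_on_subset)
  show "continuous_on (\<Union>c\<in>A. dom_of c) f"
    by (intro continuous_on_open_UN open_dom smooth_in_continuous_on smooth_mapD[OF assms])
  show "UNIV \<subseteq> (\<Union>c\<in>A. dom_of c)" using atlas by (simp add: smooth_atlas_def)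
qed

lemma metric_entry_smooth: "c \<in> A \<Longrightarrow> smooth_in c (dom_of c) (\<lambda>q. g c q $ i $ j)"
proof -
  assume c: "c \<in> A"
  have "smooth_in c (dom_of c) (g c)"
    using metric c by (simp add: riemannian_metric_def smooth_in_def)
  then show ?thesis
    by (rule smooth_in_bounded_linear[OF bounded_linear_compose[OF bounded_linear_vec_nth
            bounded_linear_vec_nth] chart_dom[OF c]])
qed

lemma metric_pos: "c \<in> A \<Longrightarrow> p \<in> dom_of c \<Longrightarrow> v \<noteq> 0 \<Longrightarrow> v \<bullet> (g c p *v v) > 0"
  using metric by (simp add: riemannian_metric_def)

lemma metric_sym: "c \<in> A \<Longrightarrow> p \<in> dom_of c \<Longrightarrow> g c p $ i $ j = g c p $ j $ i"
proof -
  assume "c \<in> A" "p \<in> dom_of c"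
  then have "transpose (g c p) = g c p"
    using metric by (simp add: riemannian_metric_def)
  then have "transpose (g c p) $ i $ j = g c p $ i $ j" by simp
  then show ?thesis by (simp add: transpose_def)
qed

lemma det_metric_pos: "c \<in> A \<Longrightarrow> p \<in> dom_of c \<Longrightarrow> det (g c p) > 0"
  by (rule det_pos_of_pos_def) (rule metric_pos)

lemma ginv_smooth: "c \<in> A \<Longrightarrow> smooth_in c (dom_of c) (\<lambda>q. ginv g c q i j)"
proof -
  assume c: "c \<in> A"
  have "smooth_on (img_of c) (\<lambda>u. matrix_inv (g c (coord_inv c u)) $ i $ j)"
  proof (rule smooth_on_matrix_inv[OF chart_openD[OF chart_dom[OF c]]])
    show "smooth_on (img_of c) (\<lambda>u. g c (coord_inv c u) $ i $ j)" for i j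
      using metric_entry_smooth[OF c] by (simp add: smooth_in_def o_def)
    show "det (g c (coord_inv c u)) \<noteq> 0" if "u \<in> img_of c" for u
      using det_metric_pos[OF c chart_open_coord_inv[OF chart_dom[OF c] that]] by simp
  qed
  then show ?thesis by (simp add: smooth_in_def o_def ginv_def)
qed

lemma ginv_metric:
  assumes "c \<in> A" "p \<in> dom_of c"
  shows "(\<Sum>k\<in>UNIV. ginv g c p i k * g c p $ k $ j) = (if i = j then 1 else 0)"
    "(\<Sum>k\<in>UNIV. g c p $ i $ k * ginv g c p k j) = (if i = j then 1 else 0)"
proof -
  have d: "det (g c p) \<noteq> 0" using det_metric_pos[OF assms] by simp
  have "(matrix_inv (g c p) ** g c p) $ i $ j = mat 1 $ i $ j"
    "(g c p ** matrix_inv (g c p)) $ i $ j = mat 1 $ i $ j"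
    by (simp_all add: matrix_inv_inverse[OF d])
  then show "(\<Sum>k\<in>UNIV. ginv g c p i k * g c p $ k $ j) = (if i = j then 1 else 0)"
    "(\<Sum>k\<in>UNIV. g c p $ i $ k * ginv g c p k j) = (if i = j then 1 else 0)"
    by (simp_all add: matrix_matrix_mult_def mat_def ginv_def)
qed

lemma ginv_unique:
  assumes "c \<in> A" "p \<in> dom_of c"
    and "\<And>i j. (\<Sum>k\<in>UNIV. h i k * g c p $ k $ j) = (if i = j then 1 else 0)"
  shows "ginv g c p i j = h i j"
proof -
  have "h i j = (\<Sum>l\<in>UNIV. h i l * (\<Sum>k\<in>UNIV. g c p $ l $ k * ginv g c p k j))"
    by (simp add: ginv_metric[OF assms(1,2)] sum_delta_mult)
  also have "\<dots> = (\<Sum>k\<in>UNIV. (\<Sum>l\<in>UNIV. h i l * g c p $ l $ k) * ginv g c p k j)"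
    unfolding sum_distrib_left sum_distrib_right by (subst sum.swap) (simp add: mult.assoc)
  also have "\<dots> = ginv g c p i j" by (simp add: assms(3) sum_delta_mult)
  finally show ?thesis ..
qed

lemma ginv_sym:
  assumes "c \<in> A" "p \<in> dom_of c"
  shows "ginv g c p i j = ginv g c p j i"
proof (rule ginv_unique[OF assms])
  show "(\<Sum>k\<in>UNIV. ginv g c p k i * g c p $ k $ j) = (if i = j then 1 else 0)" for i j
    using ginv_metric(2)[OF assms, of j i] metric_sym[OF assms, of j]
    by (simp add: mult.commute eq_commute[of i j])
qed

text \<open>\<open>y\<close> raises the index of x. The quadratic form of the inverse metric at x is
  the metric at \<open>y x\<close>, which is how positivity passes from \<open>g\<close> to
  \<open>ginv\<close>.\<close>

lemma ginv_quadratic: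
  assumes "c \<in> A" "p \<in> dom_of c"
  defines "y x \<equiv> (\<chi> i. \<Sum>j\<in>UNIV. ginv g c p i j * x j) :: real ^ 'm"
  shows "(\<Sum>i\<in>UNIV. \<Sum>j\<in>UNIV. ginv g c p i j * (x i * x j)) = y x \<bullet> (g c p *v y x)"
    and "g c p *v y x = (\<chi> i. x i)"
proof -
  show eq: "g c p *v y x = (\<chi> i. x i)" for x
  proof (rule vec_eq_iff[THEN iffD2], intro allI)
    fix i
    have "(g c p *v y x) $ i = (\<Sum>k\<in>UNIV. \<Sum>j\<in>UNIV. g c p $ i $ k * (ginv g c p k j * x j))"
      by (simp add: matrix_vector_mult_def y_def sum_distrib_left)
    also have "\<dots> = (\<Sum>j\<in>UNIV. (\<Sum>k\<in>UNIV. g c p $ i $ k * ginv g c p k j) * x j)"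
      by (subst sum.swap) (simp add: sum_distrib_right mult.assoc)
    also have "\<dots> = x i" by (simp add: ginv_metric[OF assms(1,2)] sum_delta_mult)
    finally show "(g c p *v y x) $ i = (\<chi> i. x i) $ i" by simp
  qed
  show "(\<Sum>i\<in>UNIV. \<Sum>j\<in>UNIV. ginv g c p i j * (x i * x j)) = y x \<bullet> (g c p *v y x)"
    unfolding eq unfolding y_def inner_vec_def
    by (simp add: sum_distrib_right sum_distrib_left mult_ac)
qed

lemma ginv_nonneg:
  assumes "c \<in> A" "p \<in> dom_of c"
  shows "(\<Sum>i\<in>UNIV. \<Sum>j\<in>UNIV. ginv g c p i j * (x i * x j)) \<ge> 0"
proof -
  let ?y = "(\<chi> i. \<Sum>j\<in>UNIV. ginv g c p i j * x j) :: real ^ 'm"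
  show ?thesis
    unfolding ginv_quadratic(1)[OF assms] using metric_pos[OF assms, of ?y] by (cases "?y = 0") auto
qed

lemma ginv_definite:
  assumes "c \<in> A" "p \<in> dom_of c"
    and "(\<Sum>i\<in>UNIV. \<Sum>j\<in>UNIV. ginv g c p i j * (x i * x j)) = 0"
  shows "x i = 0"
proof -
  let ?y = "(\<chi> i. \<Sum>j\<in>UNIV. ginv g c p i j * x j) :: real ^ 'm"
  have "?y = 0"
    using assms(3) metric_pos[OF assms(1,2), of ?y] unfolding ginv_quadratic(1)[OF assms(1,2)]
    by auto
  then have "(\<chi> i. x i) = (0 :: real ^ 'm)"
    using ginv_quadratic(2)[OF assms(1,2), of x] by simp
  then show ?thesis by (simp add: vec_eq_iff)
qed

section \<open>Change of chart\<close>

lemma smooth_in_overlap: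
  fixes f :: "'a \<Rightarrow> 'e::euclidean_space"
  assumes "c \<in> A" "c' \<in> A" "smooth_in c' (dom_of c') f"
  shows "smooth_in c (dom_of c \<inter> dom_of c') f"
  by (rule smooth_in_change_chart[OF chart_overlap[OF assms(1,2)] chart_dom[OF assms(2)] _
        smooth_transition[OF assms(1,2)] assms(3)]) auto

lemma pd_overlap:
  fixes f :: "'a \<Rightarrow> 'e::euclidean_space"
  assumes "c \<in> A" "c' \<in> A" "smooth_in c' (dom_of c') f" "p \<in> dom_of c \<inter> dom_of c'"
  shows "pd c i f p = (\<Sum>a\<in>UNIV. pd c i (\<lambda>q. coord c' q $ a) p *\<^sub>R pd c' a f p)"
  by (rule pd_change_chart[OF chart_overlap[OF assms(1,2)] chart_dom[OF assms(2)] _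
        smooth_transition[OF assms(1,2)] assms(3,4)]) auto

text \<open>With the Jacobian J of the transition map, the law for the metric reads G = J G' J^T. As
  det G is nonzero, J is invertible, and inverting the law expresses the inverse of G' as J^T H J
  with H the inverse of G.\<close>

lemma ginv_overlap:
  assumes "c \<in> A" "c' \<in> A" "p \<in> dom_of c" "p \<in> dom_of c'"
  shows "ginv g c' p a b = (\<Sum>i\<in>UNIV. \<Sum>j\<in>UNIV. ginv g c p i j *
    (pd c i (\<lambda>q. coord c' q $ a) p * pd c j (\<lambda>q. coord c' q $ b) p))"
proof -
  define J :: "real ^ 'm ^ 'm" where "J = (\<chi> i a. pd c i (\<lambda>q. coord c' q $ a) p)"
  let ?G = "g c p" and ?G' = "g c' p"
  have "?G $ i $ j = (J ** ?G' ** transpose J) $ i $ j" for i j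
  proof -
    have "?G $ i $ j = (\<Sum>k\<in>UNIV. \<Sum>l\<in>UNIV. J $ i $ k * J $ j $ l * ?G' $ k $ l)"
      using metric assms unfolding riemannian_metric_def J_def vec_lambda_beta by blast
    also have "\<dots> = (J ** ?G' ** transpose J) $ i $ j"
      unfolding matrix_matrix_mult_def transpose_def vec_lambda_beta sum_distrib_right
      by (subst sum.swap) (simp add: mult_ac)
    finally show ?thesis .
  qed
  then have G: "?G = J ** ?G' ** transpose J" by (simp add: vec_eq_iff)
  have dG: "det ?G \<noteq> 0" "det ?G' \<noteq> 0"
    using det_metric_pos[of c p] det_metric_pos[of c' p] assms by simp_all
  have dJ: "det (transpose J) \<noteq> 0" "det J \<noteq> 0"
    using dG(1) unfolding G det_mul by auto
  have "transpose J ** matrix_inv ?G ** J ** ?G' ** transpose J = transpose J ** (matrix_inv ?G ** ?G)"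
    unfolding G by (simp add: matrix_mul_assoc)
  also have "\<dots> = transpose J" by (simp add: matrix_inv_inverse[OF dG(1)])
  finally have "transpose J ** matrix_inv ?G ** J ** ?G' ** (transpose J ** matrix_inv (transpose J)) =
      transpose J ** matrix_inv (transpose J)"
    by (simp add: matrix_mul_assoc)
  then have *: "transpose J ** matrix_inv ?G ** J ** ?G' = mat 1"
    by (simp add: matrix_inv_inverse[OF dJ(1)])
  have "ginv g c' p a b = (transpose J ** matrix_inv ?G ** J) $ a $ b"
  proof (rule ginv_unique[OF assms(2,4)])
    show "(\<Sum>k\<in>UNIV. (transpose J ** matrix_inv ?G ** J) $ i $ k * ?G' $ k $ j) = (if i = j then 1 else 0)"
      for i j
      using arg_cong[OF *, of "\<lambda>M. M $ i $ j"]
      by (simp add: matrix_matrix_mult_def[of _ ?G'] mat_def)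
  qed
  also have "\<dots> = (\<Sum>j\<in>UNIV. \<Sum>i\<in>UNIV. J $ i $ a * ginv g c p i j * J $ j $ b)"
    by (simp add: matrix_matrix_mult_def transpose_def ginv_def sum_distrib_right)
  also have "\<dots> = (\<Sum>i\<in>UNIV. \<Sum>j\<in>UNIV. ginv g c p i j * (J $ i $ a * J $ j $ b))"
    by (subst sum.swap) (simp add: mult_ac)
  finally show ?thesis by (simp add: J_def)
qed

end

section \<open>The Laplace operator of an immersed manifold\<close>

lemma sum_swap22:
  "(\<Sum>i\<in>I. \<Sum>j\<in>J. \<Sum>a\<in>K. \<Sum>b\<in>L. F i j a b) = (\<Sum>a\<in>K. \<Sum>b\<in>L. \<Sum>i\<in>I. \<Sum>j\<in>J. F i j a b)"
proof -
  have "(\<Sum>x\<in>I \<times> J. \<Sum>y\<in>K \<times> L. F (fst x) (snd x) (fst y) (snd y)) =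
      (\<Sum>y\<in>K \<times> L. \<Sum>x\<in>I \<times> J. F (fst x) (snd x) (fst y) (snd y))"
    by (rule sum.swap)
  then show ?thesis by (simp only: sum.cartesian_product' fst_conv snd_conv)
qed

lemma sum_swap21:
  "(\<Sum>i\<in>I. \<Sum>j\<in>J. \<Sum>a\<in>K. F i j a) = (\<Sum>a\<in>K. \<Sum>i\<in>I. \<Sum>j\<in>J. F i j a)"
proof -
  have "(\<Sum>x\<in>I \<times> J. \<Sum>a\<in>K. F (fst x) (snd x) a) = (\<Sum>a\<in>K. \<Sum>x\<in>I \<times> J. F (fst x) (snd x) a)"
    by (rule sum.swap)
  then show ?thesis by (simp only: sum.cartesian_product' fst_conv snd_conv)
qed

text \<open>The target is any Euclidean space and not yet a sphere: the locale is entered for \<phi>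
  and again for the minimal immersion into the smaller space. The metric is the Gram matrix of the
  vectors \<open>pd c i \<phi>\<close>, which turns intrinsic identities into identities between
  scalar products.\<close>

locale isometrically_immersed = riemannian_manifold A g
  for A :: "('a::{second_countable_topology, t2_space}, 'm::finite) chart set"
    and g :: "('a, 'm) metric" +
  fixes \<phi> :: "'a \<Rightarrow> 'e::euclidean_space"
  assumes immersion: "isometric_immersion A g \<phi>"
begin

lemma smooth_immersion: "c \<in> A \<Longrightarrow> smooth_in c (dom_of c) \<phi>"
  using immersion smooth_mapD[of \<phi> c] by (simp add: isometric_immersion_def)

lemma gram: "c \<in> A \<Longrightarrow> p \<in> dom_of c \<Longrightarrow> pd c i \<phi> p \<bullet> pd c j \<phi> p = g c p $ i $ j"
  using immersion by (simp add: isometric_immersion_def)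

lemma pd_metric:
  assumes "c \<in> A" "p \<in> dom_of c"
  shows "pd c k (\<lambda>q. g c q $ i $ j) p =
    pd c k (pd c i \<phi>) p \<bullet> pd c j \<phi> p + pd c k (pd c j \<phi>) p \<bullet> pd c i \<phi> p"
proof -
  note ch = chart_dom[OF assms(1)] and sm = smooth_in_pd[OF chart_dom smooth_immersion, OF assms(1) assms(1)]
  have "pd c k (\<lambda>q. g c q $ i $ j) p = pd c k (\<lambda>q. pd c i \<phi> q \<bullet> pd c j \<phi> q) p"
    by (rule pd_cong[OF ch metric_entry_smooth[OF assms(1)] assms(2)]) (simp add: gram assms(1))
  also have "\<dots> = pd c i \<phi> p \<bullet> pd c k (pd c j \<phi>) p + pd c k (pd c i \<phi>) p \<bullet> pd c j \<phi> p"
    by (rule pd_inner[OF ch sm sm assms(2)])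
  finally show ?thesis by (simp add: inner_commute)
qed

text \<open>By \<open>pd_metric\<close> the three derivatives of the metric are six scalar products.
  Symmetry of second derivatives cancels four of them and makes the other two equal.\<close>

lemma christoffel_immersion:
  assumes "c \<in> A" "p \<in> dom_of c"
  shows "christoffel g c k i j p = (\<Sum>l\<in>UNIV. ginv g c p k l * (pd c i (pd c j \<phi>) p \<bullet> pd c l \<phi> p))"
proof -
  have sym: "pd c i (pd c j \<phi>) p = pd c j (pd c i \<phi>) p" for i j
    by (rule pd_commute[OF chart_dom[OF assms(1)] smooth_immersion[OF assms(1)] assms(2)])
  have "pd c i (\<lambda>q. g c q $ j $ l) p + pd c j (\<lambda>q. g c q $ i $ l) p - pd c l (\<lambda>q. g c q $ i $ j) p =
      2 * (pd c i (pd c j \<phi>) p \<bullet> pd c l \<phi> p)" for l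
    unfolding pd_metric[OF assms] using sym[of j i] sym[of l i] sym[of l j] by simp
  then show ?thesis by (simp add: christoffel_def sum_distrib_left)
qed

lemma trace_christoffel:
  assumes "c \<in> A" "p \<in> dom_of c"
  shows "(\<Sum>i\<in>UNIV. \<Sum>j\<in>UNIV. ginv g c p i j * christoffel g c k i j p) =
    (\<Sum>l\<in>UNIV. ginv g c p k l * (trace_hess g c \<phi> p \<bullet> pd c l \<phi> p))"
  unfolding christoffel_immersion[OF assms] trace_hess_def inner_sum_left sum_distrib_left
  by (subst sum_swap21) (simp add: mult_ac)

text \<open>The traced Christoffel symbols are the components of the tangential part of
  \<open>trace_hess g c \<phi> p\<close>. The first-order term is therefore the derivative of f
  along that tangent vector.\<close>

lemma chart_laplacian_eq:
  assumes "c \<in> A" "p \<in> dom_of c"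
  shows "chart_laplacian g c f p = trace_hess g c f p -
    (\<Sum>k\<in>UNIV. \<Sum>l\<in>UNIV. (ginv g c p k l * (trace_hess g c \<phi> p \<bullet> pd c l \<phi> p)) *\<^sub>R pd c k f p)"
proof -
  have "chart_laplacian g c f p = trace_hess g c f p -
      (\<Sum>i\<in>UNIV. \<Sum>j\<in>UNIV. \<Sum>k\<in>UNIV. (ginv g c p i j * christoffel g c k i j p) *\<^sub>R pd c k f p)"
    by (simp add: chart_laplacian_def trace_hess_def scaleR_diff_right sum_subtractf scaleR_sum_right)
  also have "(\<Sum>i\<in>UNIV. \<Sum>j\<in>UNIV. \<Sum>k\<in>UNIV. (ginv g c p i j * christoffel g c k i j p) *\<^sub>R pd c k f p) =
      (\<Sum>k\<in>UNIV. (\<Sum>i\<in>UNIV. \<Sum>j\<in>UNIV. ginv g c p i j * christoffel g c k i j p) *\<^sub>R pd c k f p)"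
    by (subst sum_swap21) (simp add: scaleR_sum_left)
  finally show ?thesis
    unfolding trace_christoffel[OF assms] by (simp add: scaleR_sum_left)
qed

text \<open>For f = \<phi>, the formula \<open>chart_laplacian_eq\<close> subtracts from
  \<open>trace_hess\<close> exactly its tangential part.\<close>

lemma chart_laplacian_orthogonal:
  assumes "c \<in> A" "p \<in> dom_of c"
  shows "chart_laplacian g c \<phi> p \<bullet> pd c a \<phi> p = 0"
proof -
  let ?X = "\<lambda>l. trace_hess g c \<phi> p \<bullet> pd c l \<phi> p"
  have "(\<Sum>k\<in>UNIV. \<Sum>l\<in>UNIV. (ginv g c p k l * ?X l) *\<^sub>R pd c k \<phi> p) \<bullet> pd c a \<phi> p =
      (\<Sum>l\<in>UNIV. (\<Sum>k\<in>UNIV. g c p $ a $ k * ginv g c p k l) * ?X l)"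
    unfolding inner_sum_left inner_scaleR_left gram[OF assms] sum_distrib_right
    by (subst sum.swap) (simp add: mult_ac metric_sym[OF assms, of _ a])
  also have "\<dots> = ?X a" by (simp add: ginv_metric(2)[OF assms] sum_delta_mult)
  finally show ?thesis by (simp add: chart_laplacian_eq[OF assms] inner_diff_left)
qed

section \<open>Independence of the Laplacian from the chart\<close>

lemma pd_pd_overlap:
  fixes f :: "'a \<Rightarrow> 'f::euclidean_space"
  assumes "c \<in> A" "c' \<in> A" "smooth_in c' (dom_of c') f" "p \<in> dom_of c" "p \<in> dom_of c'"
  defines "J \<equiv> \<lambda>i a. pd c i (\<lambda>q. coord c' q $ a)"
  shows "pd c i (pd c j f) p = (\<Sum>a\<in>UNIV. pd c i (J j a) p *\<^sub>R pd c' a f p) +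
    (\<Sum>a\<in>UNIV. \<Sum>b\<in>UNIV. (J j a p * J i b p) *\<^sub>R pd c' b (pd c' a f) p)"
proof -
  let ?U = "dom_of c \<inter> dom_of c'"
  note ch = chart_overlap[OF assms(1,2)] and ch' = chart_dom[OF assms(2)]
  have p: "p \<in> ?U" using assms by simp
  have sJ: "smooth_in c ?U (J i a)" for i a
  proof -
    have "smooth_in c ?U (coord c')"
      using smooth_transition[OF assms(1,2)] by (simp add: smooth_in_def)
    from smooth_in_bounded_linear[OF bounded_linear_vec_nth ch this]
    show ?thesis unfolding J_def by (rule smooth_in_pd[OF ch])
  qed
  have sf: "smooth_in c' (dom_of c') (pd c' a f)" for a
    by (rule smooth_in_pd[OF ch' assms(3)])
  have sf': "smooth_in c ?U (pd c' a f)" for a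
    by (rule smooth_in_overlap[OF assms(1,2) sf])
  have "pd c i (pd c j f) p = pd c i (\<lambda>q. \<Sum>a\<in>UNIV. J j a q *\<^sub>R pd c' a f q) p"
    unfolding J_def
    by (rule pd_cong[OF ch _ p pd_overlap[OF assms(1-3)]])
      (rule smooth_in_pd[OF ch smooth_in_overlap[OF assms(1-3)]])
  also have "\<dots> = (\<Sum>a\<in>UNIV. pd c i (\<lambda>q. J j a q *\<^sub>R pd c' a f q) p)"
    by (rule pd_sum[OF smooth_in_scaleR[OF ch sJ sf'] p])
  also have "\<dots> = (\<Sum>a\<in>UNIV. J j a p *\<^sub>R pd c i (pd c' a f) p + pd c i (J j a) p *\<^sub>R pd c' a f p)"
    by (intro sum.cong refl pd_scaleR[OF ch sJ sf' p])
  also have "\<dots> = (\<Sum>a\<in>UNIV. J j a p *\<^sub>R (\<Sum>b\<in>UNIV. J i b p *\<^sub>R pd c' b (pd c' a f) p) +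
      pd c i (J j a) p *\<^sub>R pd c' a f p)"
    unfolding J_def by (simp only: pd_overlap[OF assms(1,2) sf p])
  finally show ?thesis by (simp add: sum.distrib scaleR_sum_right add.commute)
qed

text \<open>The products of first derivatives of the transition map turn \<open>ginv g c\<close>
  into \<open>ginv g c'\<close>. Its second derivatives leave a first-order term, a derivative of f
  along a vector that does not depend on f.\<close>

lemma trace_hess_overlap:
  fixes f :: "'a \<Rightarrow> 'f::euclidean_space"
  assumes "c \<in> A" "c' \<in> A" "smooth_in c' (dom_of c') f" "p \<in> dom_of c" "p \<in> dom_of c'"
  shows "trace_hess g c f p = trace_hess g c' f p +
    (\<Sum>a\<in>UNIV. trace_hess g c (\<lambda>q. coord c' q $ a) p *\<^sub>R pd c' a f p)"
proof -
  let ?J = "\<lambda>i a. pd c i (\<lambda>q. coord c' q $ a)"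
  have 1: "(\<Sum>i\<in>UNIV. \<Sum>j\<in>UNIV. ginv g c p i j *\<^sub>R (\<Sum>a\<in>UNIV. pd c i (?J j a) p *\<^sub>R pd c' a f p)) =
      (\<Sum>a\<in>UNIV. trace_hess g c (\<lambda>q. coord c' q $ a) p *\<^sub>R pd c' a f p)"
    unfolding trace_hess_def scaleR_sum_left scaleR_sum_right
    by (subst sum_swap21) simp
  have 2: "(\<Sum>i\<in>UNIV. \<Sum>j\<in>UNIV. ginv g c p i j *\<^sub>R
        (\<Sum>a\<in>UNIV. \<Sum>b\<in>UNIV. (?J j a p * ?J i b p) *\<^sub>R pd c' b (pd c' a f) p)) =
      (\<Sum>a\<in>UNIV. \<Sum>b\<in>UNIV. ginv g c' p b a *\<^sub>R pd c' b (pd c' a f) p)"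
    unfolding ginv_overlap[OF assms(1,2,4,5)] scaleR_sum_left scaleR_sum_right
    by (subst sum_swap22) (simp add: mult_ac)
  have "trace_hess g c f p =
      (\<Sum>i\<in>UNIV. \<Sum>j\<in>UNIV. ginv g c p i j *\<^sub>R (\<Sum>a\<in>UNIV. pd c i (?J j a) p *\<^sub>R pd c' a f p)) +
      (\<Sum>i\<in>UNIV. \<Sum>j\<in>UNIV. ginv g c p i j *\<^sub>R
        (\<Sum>a\<in>UNIV. \<Sum>b\<in>UNIV. (?J j a p * ?J i b p) *\<^sub>R pd c' b (pd c' a f) p))"
    unfolding trace_hess_def pd_pd_overlap[OF assms]
    by (simp only: scaleR_add_right sum.distrib)
  moreover have "(\<Sum>a\<in>UNIV. \<Sum>b\<in>UNIV. ginv g c' p b a *\<^sub>R pd c' b (pd c' a f) p) = trace_hess g c' f p"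
    unfolding trace_hess_def by (rule sum.swap)
  ultimately show ?thesis unfolding 1 2 by simp
qed

lemma gradient_pairing_overlap:
  fixes f :: "'a \<Rightarrow> 'f::euclidean_space"
  assumes "c \<in> A" "c' \<in> A" "smooth_in c' (dom_of c') f" "p \<in> dom_of c" "p \<in> dom_of c'"
  shows "(\<Sum>k\<in>UNIV. \<Sum>l\<in>UNIV. (ginv g c p k l * (X \<bullet> pd c l \<phi> p)) *\<^sub>R pd c k f p) =
    (\<Sum>a\<in>UNIV. \<Sum>b\<in>UNIV. (ginv g c' p a b * (X \<bullet> pd c' b \<phi> p)) *\<^sub>R pd c' a f p)"
proof -
  let ?J = "\<lambda>i a. pd c i (\<lambda>q. coord c' q $ a) p"
  have p: "p \<in> dom_of c \<inter> dom_of c'" using assms by simp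
  have "(ginv g c p k l * (X \<bullet> pd c l \<phi> p)) *\<^sub>R pd c k f p = (\<Sum>a\<in>UNIV. \<Sum>b\<in>UNIV.
      (ginv g c p k l * (?J k a * ?J l b) * (X \<bullet> pd c' b \<phi> p)) *\<^sub>R pd c' a f p)" for k l
    unfolding pd_overlap[OF assms(1,2,3) p] pd_overlap[OF assms(1,2) smooth_immersion[OF assms(2)] p, of l]
      scaleR_sum_right
    by (simp add: inner_sum_right sum_distrib_left sum_distrib_right scaleR_sum_left mult_ac)
  then have "(\<Sum>k\<in>UNIV. \<Sum>l\<in>UNIV. (ginv g c p k l * (X \<bullet> pd c l \<phi> p)) *\<^sub>R pd c k f p) =
      (\<Sum>a\<in>UNIV. \<Sum>b\<in>UNIV. \<Sum>k\<in>UNIV. \<Sum>l\<in>UNIV.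
        (ginv g c p k l * (?J k a * ?J l b) * (X \<bullet> pd c' b \<phi> p)) *\<^sub>R pd c' a f p)"
    by (simp only:) (rule sum_swap22)
  then show ?thesis
    unfolding ginv_overlap[OF assms(1,2,4,5)] sum_distrib_right scaleR_sum_left .
qed

text \<open>The defect of \<open>trace_hess\<close> is a derivative along one vector \<kappa>, the
  same for f and for \<phi>. Through \<open>trace_hess\<close> of \<phi>, the first-order term of
  \<open>chart_laplacian_eq\<close> changes by the tangent vector d\<phi>(\<kappa>), hence by the
  same derivative of f, and the two changes cancel. This replaces the transformation law of the
  Christoffel symbols.\<close>

lemma chart_laplacian_overlap:
  fixes f :: "'a \<Rightarrow> 'f::euclidean_space"
  assumes "c \<in> A" "c' \<in> A" "smooth_in c' (dom_of c') f" "p \<in> dom_of c" "p \<in> dom_of c'"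
  shows "chart_laplacian g c f p = chart_laplacian g c' f p"
proof -
  let ?\<kappa> = "\<lambda>a. trace_hess g c (\<lambda>q. coord c' q $ a) p"
  let ?T = "trace_hess g c' \<phi> p"
  \<comment> \<open>Recovers \<kappa> from d\<phi>(\<kappa>): scalar products with the coordinate
    vectors lower the index by the metric, and \<open>ginv\<close> raises it again.\<close>
  have 1: "(\<Sum>b\<in>UNIV. ginv g c' p a b * ((\<Sum>d\<in>UNIV. ?\<kappa> d *\<^sub>R pd c' d \<phi> p) \<bullet> pd c' b \<phi> p)) = ?\<kappa> a" for a
  proof -
    have "(\<Sum>b\<in>UNIV. ginv g c' p a b * ((\<Sum>d\<in>UNIV. ?\<kappa> d *\<^sub>R pd c' d \<phi> p) \<bullet> pd c' b \<phi> p)) =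
        (\<Sum>d\<in>UNIV. (\<Sum>b\<in>UNIV. ginv g c' p a b * g c' p $ b $ d) * ?\<kappa> d)"
      unfolding inner_sum_left inner_scaleR_left gram[OF assms(2,5)] sum_distrib_left sum_distrib_right
      by (subst sum.swap) (simp add: mult_ac metric_sym[OF assms(2,5)])
    then show ?thesis by (simp add: ginv_metric(1)[OF assms(2,5)] sum_delta_mult)
  qed
  have "(\<Sum>k\<in>UNIV. \<Sum>l\<in>UNIV. (ginv g c p k l * (trace_hess g c \<phi> p \<bullet> pd c l \<phi> p)) *\<^sub>R pd c k f p) =
      (\<Sum>a\<in>UNIV. (\<Sum>b\<in>UNIV. ginv g c' p a b *
        ((?T + (\<Sum>d\<in>UNIV. ?\<kappa> d *\<^sub>R pd c' d \<phi> p)) \<bullet> pd c' b \<phi> p)) *\<^sub>R pd c' a f p)"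
    unfolding gradient_pairing_overlap[OF assms]
      trace_hess_overlap[OF assms(1,2) smooth_immersion[OF assms(2)] assms(4,5)] scaleR_sum_left ..
  also have "\<dots> = (\<Sum>a\<in>UNIV. (\<Sum>b\<in>UNIV. ginv g c' p a b * (?T \<bullet> pd c' b \<phi> p)) *\<^sub>R pd c' a f p) +
      (\<Sum>a\<in>UNIV. ?\<kappa> a *\<^sub>R pd c' a f p)"
    by (simp only: inner_add_left distrib_left sum.distrib 1 scaleR_add_left)
  finally show ?thesis
    unfolding chart_laplacian_eq[OF assms(1,4)] chart_laplacian_eq[OF assms(2,5)]
      trace_hess_overlap[OF assms] scaleR_sum_left by simp
qed

section \<open>The Laplacian as the divergence of the gradient\<close>

lemma pd_ginv:
  assumes "c \<in> A" "p \<in> dom_of c"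
  shows "pd c i (\<lambda>q. ginv g c q j l) p =
    - (\<Sum>a\<in>UNIV. \<Sum>b\<in>UNIV. ginv g c p j a * pd c i (\<lambda>q. g c q $ a $ b) p * ginv g c p b l)"
proof -
  note ch = chart_dom[OF assms(1)] and sg = metric_entry_smooth[OF assms(1)] and si = ginv_smooth[OF assms(1)]
  have 0: "(\<Sum>k\<in>UNIV. pd c i (\<lambda>q. ginv g c q j k) p * g c p $ k $ b) =
      - (\<Sum>k\<in>UNIV. ginv g c p j k * pd c i (\<lambda>q. g c q $ k $ b) p)" for b
  proof -
    \<comment> \<open>The product of the inverse metric with the metric is constant. Its vanishing
      derivative is solved for the derivative of \<open>ginv\<close> by multiplying with
      \<open>ginv\<close> from the right.\<close>
    have "0 = pd c i (\<lambda>q. if j = b then 1 else 0 :: real) p" by (simp add: pd_const)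
    also have "\<dots> = pd c i (\<lambda>q. \<Sum>k\<in>UNIV. ginv g c q j k * g c q $ k $ b) p"
      by (rule pd_cong[OF ch smooth_in_const assms(2)]) (simp add: ginv_metric(1)[OF assms(1)])
    also have "\<dots> = (\<Sum>k\<in>UNIV. pd c i (\<lambda>q. ginv g c q j k * g c q $ k $ b) p)"
      by (rule pd_sum[OF smooth_in_mult[OF ch si sg] assms(2)])
    also have "\<dots> = (\<Sum>k\<in>UNIV. ginv g c p j k * pd c i (\<lambda>q. g c q $ k $ b) p +
        pd c i (\<lambda>q. ginv g c q j k) p * g c p $ k $ b)"
      by (intro sum.cong refl pd_mult[OF ch si sg assms(2)])
    finally show ?thesis by (simp add: sum.distrib)
  qed
  have "pd c i (\<lambda>q. ginv g c q j l) p =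
      (\<Sum>k\<in>UNIV. pd c i (\<lambda>q. ginv g c q j k) p * (\<Sum>b\<in>UNIV. g c p $ k $ b * ginv g c p b l))"
    by (simp add: ginv_metric(2)[OF assms] sum_delta_mult)
  also have "\<dots> = (\<Sum>b\<in>UNIV. (\<Sum>k\<in>UNIV. pd c i (\<lambda>q. ginv g c q j k) p * g c p $ k $ b) * ginv g c p b l)"
    unfolding sum_distrib_left sum_distrib_right by (subst sum.swap) (simp add: mult_ac)
  also have "\<dots> = - (\<Sum>b\<in>UNIV. \<Sum>a\<in>UNIV. ginv g c p j a * pd c i (\<lambda>q. g c q $ a $ b) p * ginv g c p b l)"
    by (simp add: 0 sum_distrib_right sum_negf)
  finally show ?thesis by (subst sum.swap)
qed

text \<open>\<open>pd_ginv\<close> and \<open>pd_metric\<close> write the derivatives of the inverse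
  metric as two sums. One is the traced Christoffel symbol with upper index k, the other is
  cancelled by the contraction on the left.\<close>

lemma divergence_ginv:
  assumes "c \<in> A" "p \<in> dom_of c"
  shows "(\<Sum>i\<in>UNIV. pd c i (\<lambda>q. ginv g c q i k) p) +
      (\<Sum>i\<in>UNIV. \<Sum>j\<in>UNIV. christoffel g c i i j p * ginv g c p j k) =
    - (\<Sum>i\<in>UNIV. \<Sum>j\<in>UNIV. ginv g c p i j * christoffel g c k i j p)"
proof -
  let ?h = "\<lambda>i a b. pd c i (pd c a \<phi>) p \<bullet> pd c b \<phi> p"
  have "(\<Sum>i\<in>UNIV. pd c i (\<lambda>q. ginv g c q i k) p) =
      - (\<Sum>i\<in>UNIV. \<Sum>a\<in>UNIV. \<Sum>b\<in>UNIV. ginv g c p i a * ?h i a b * ginv g c p b k) -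
      (\<Sum>i\<in>UNIV. \<Sum>a\<in>UNIV. \<Sum>b\<in>UNIV. ginv g c p i a * ?h i b a * ginv g c p b k)"
    unfolding pd_ginv[OF assms] pd_metric[OF assms]
    by (simp add: sum_negf distrib_left distrib_right sum.distrib sum_subtractf)
  moreover have "(\<Sum>i\<in>UNIV. \<Sum>j\<in>UNIV. ginv g c p i j * christoffel g c k i j p) =
      (\<Sum>i\<in>UNIV. \<Sum>a\<in>UNIV. \<Sum>b\<in>UNIV. ginv g c p i a * ?h i a b * ginv g c p b k)"
    unfolding christoffel_immersion[OF assms] sum_distrib_left
    by (simp add: mult_ac ginv_sym[OF assms, of k])
  moreover have "(\<Sum>j\<in>UNIV. christoffel g c i i j p * ginv g c p j k) =
      (\<Sum>a\<in>UNIV. \<Sum>b\<in>UNIV. ginv g c p i a * ?h i b a * ginv g c p b k)" for i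
    unfolding christoffel_immersion[OF assms] sum_distrib_right by (rule sum.swap)
  ultimately show ?thesis by simp
qed

lemma divergence_gradient:
  fixes f :: "'a \<Rightarrow> real"
  assumes "c \<in> A" "p \<in> dom_of c" "smooth_in c (dom_of c) f"
  shows "divergence g c (gradient g c f) p = chart_laplacian g c f p"
proof -
  note ch = chart_dom[OF assms(1)] and si = ginv_smooth[OF assms(1)]
    and sf = smooth_in_pd[OF chart_dom[OF assms(1)] assms(3)]
  have 1: "pd c i (\<lambda>q. \<Sum>j\<in>UNIV. ginv g c q i j * pd c j f q) p =
      (\<Sum>j\<in>UNIV. ginv g c p i j * pd c i (pd c j f) p) +
      (\<Sum>j\<in>UNIV. pd c i (\<lambda>q. ginv g c q i j) p * pd c j f p)" for i
    unfolding pd_sum[OF smooth_in_mult[OF ch si sf] assms(2)] pd_mult[OF ch si sf assms(2)]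
    by (simp add: sum.distrib)
  have 2: "(\<Sum>i\<in>UNIV. \<Sum>j\<in>UNIV. christoffel g c i i j p * (\<Sum>k\<in>UNIV. ginv g c p j k * pd c k f p)) =
      (\<Sum>k\<in>UNIV. (\<Sum>i\<in>UNIV. \<Sum>j\<in>UNIV. christoffel g c i i j p * ginv g c p j k) * pd c k f p)"
    unfolding sum_distrib_left by (subst sum_swap21) (simp add: sum_distrib_right sum_distrib_left mult_ac)
  have 3: "(\<Sum>i\<in>UNIV. \<Sum>j\<in>UNIV. pd c i (\<lambda>q. ginv g c q i j) p * pd c j f p) =
      (\<Sum>k\<in>UNIV. (\<Sum>i\<in>UNIV. pd c i (\<lambda>q. ginv g c q i k) p) * pd c k f p)"
    by (subst sum.swap) (simp add: sum_distrib_right)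
  have "divergence g c (gradient g c f) p = trace_hess g c f p +
      (\<Sum>k\<in>UNIV. ((\<Sum>i\<in>UNIV. pd c i (\<lambda>q. ginv g c q i k) p) +
        (\<Sum>i\<in>UNIV. \<Sum>j\<in>UNIV. christoffel g c i i j p * ginv g c p j k)) * pd c k f p)"
    unfolding divergence_def gradient_def vec_lambda_beta 1 sum.distrib 2 3 distrib_right
    by (simp add: trace_hess_def)
  also have "\<dots> = chart_laplacian g c f p"
    unfolding divergence_ginv[OF assms(1,2)] trace_christoffel[OF assms(1,2)]
      chart_laplacian_eq[OF assms(1,2)]
    by (simp add: sum_negf sum_distrib_right)
  finally show ?thesis .
qed

text \<open>\<open>laplacian\<close> uses the chart chosen by \<open>chart_at\<close>, which may
  change from point to point. From here on, one chart serves on its whole domain, as differentiating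
  the Laplacian requires.\<close>

lemma laplacian_vec_eq:
  fixes f :: "'a \<Rightarrow> 'f::euclidean_space"
  assumes "smooth_map A f" "c \<in> A" "p \<in> dom_of c"
  shows "laplacian_vec A g f p = chart_laplacian g c f p"
proof -
  let ?c = "chart_at A p"
  note sf = smooth_mapD[OF assms(1) chart_at(1)] and ch = chart_dom[OF chart_at(1)]
  have "laplacian A g (\<lambda>q. f q \<bullet> b) p = chart_laplacian g ?c f p \<bullet> b" for b
    unfolding laplacian_def Let_def
      divergence_gradient[OF chart_at smooth_in_bounded_linear[OF bounded_linear_inner_left ch sf]]
    by (rule chart_laplacian_bounded_linear[OF bounded_linear_inner_left ch sf chart_at(2)])
  then have "laplacian_vec A g f p = chart_laplacian g ?c f p"
    by (simp add: laplacian_vec_def euclidean_representation)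
  also have "\<dots> = chart_laplacian g c f p"
    by (rule chart_laplacian_overlap[OF chart_at(1) assms(2) smooth_mapD[OF assms(1,2)] chart_at(2) assms(3)])
  finally show ?thesis .
qed

lemma smooth_in_chart_laplacian:
  assumes "c \<in> A" "smooth_in c (dom_of c) f"
  shows "smooth_in c (dom_of c) (chart_laplacian g c f)"
proof (rule smooth_in_cong[OF chart_dom[OF assms(1)]])
  note ch = chart_dom[OF assms(1)] and si = ginv_smooth[OF assms(1)]
  let ?T = "\<lambda>q. (\<Sum>i\<in>UNIV. \<Sum>j\<in>UNIV. ginv g c q i j *\<^sub>R pd c i (pd c j \<phi>) q)"
  show "(\<Sum>i\<in>UNIV. \<Sum>j\<in>UNIV. ginv g c q i j *\<^sub>R pd c i (pd c j f) q) -
     (\<Sum>k\<in>UNIV. \<Sum>l\<in>UNIV. (ginv g c q k l * (?T q \<bullet> pd c l \<phi> q)) *\<^sub>R pd c k f q) =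
     chart_laplacian g c f q" if "q \<in> dom_of c" for q
    by (simp add: chart_laplacian_eq[OF assms(1) that] trace_hess_def)
  show "smooth_in c (dom_of c) (\<lambda>q. (\<Sum>i\<in>UNIV. \<Sum>j\<in>UNIV. ginv g c q i j *\<^sub>R pd c i (pd c j f) q) -
     (\<Sum>k\<in>UNIV. \<Sum>l\<in>UNIV. (ginv g c q k l * (?T q \<bullet> pd c l \<phi> q)) *\<^sub>R pd c k f q))"
    by (intro smooth_in_intros ch si assms smooth_immersion)
qed

lemma smooth_map_laplacian_vec:
  fixes f :: "'a \<Rightarrow> 'f::euclidean_space"
  assumes "smooth_map A f"
  shows "smooth_map A (laplacian_vec A g f)"
proof (rule smooth_mapI)
  fix c assume c: "c \<in> A"
  show "smooth_in c (dom_of c) (laplacian_vec A g f)"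
    by (rule smooth_in_cong[OF chart_dom[OF c] _ smooth_in_chart_laplacian[OF c smooth_mapD[OF assms c]]])
      (simp add: laplacian_vec_eq[OF assms c])
qed

end

section \<open>Tension field and volume\<close>

lemma linear_sphere_tan: "linear (sphere_tan y)"
  by (rule linearI) (simp_all add: sphere_tan_def algebra_simps add_divide_distrib)

lemma linear_normal_part: "linear (normal_part g c f p)"
  by (rule linearI)
    (simp_all add: normal_part_def algebra_simps sum.distrib scaleR_sum_right)

lemma sphere_tan_orthogonal: "v \<bullet> y = 0 \<Longrightarrow> sphere_tan y v = v"
  by (simp add: sphere_tan_def)

context riemannian_manifold
begin

lemma pd_orthogonal_sphere:
  fixes F :: "'a \<Rightarrow> 'f::euclidean_space"
  assumes "smooth_map A F" "range F \<subseteq> sphere 0 r" "c \<in> A" "p \<in> dom_of c"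
  shows "pd c k F p \<bullet> F p = 0"
proof -
  note ch = chart_dom[OF assms(3)] and sF = smooth_mapD[OF assms(1,3)]
  have "0 = pd c k (\<lambda>q. r\<^sup>2) p" by (simp add: pd_const)
  also have "\<dots> = pd c k (\<lambda>q. F q \<bullet> F q) p"
    by (rule pd_cong[OF ch smooth_in_const assms(4)])
      (use assms(2) in \<open>auto simp: image_subset_iff simp flip: power2_norm_eq_inner\<close>)
  also have "\<dots> = 2 * (pd c k F p \<bullet> F p)"
    using pd_inner[OF ch sF sF assms(4)] by (simp add: inner_commute)
  finally show ?thesis by simp
qed

text \<open>The projection is linear and fixes every first derivative of \<open>F\<close>, which is
  tangent to the sphere. It can thus be pulled out of the whole trace.\<close>

lemma tension_eq:
  fixes F :: "'a \<Rightarrow> 'f::euclidean_space"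
  assumes "smooth_map A F" "range F \<subseteq> sphere 0 r"
  shows "tension A g F p = sphere_tan (F p) (chart_laplacian g (chart_at A p) F p)"
proof -
  let ?c = "chart_at A p"
  have "sphere_tan (F p) (pd ?c k F p) = pd ?c k F p" for k
    by (rule sphere_tan_orthogonal[OF pd_orthogonal_sphere[OF assms chart_at]])
  then show ?thesis
    by (simp add: tension_def Let_def chart_laplacian_def nabla_d_def linear_sum[OF linear_sphere_tan]
        linear_scale[OF linear_sphere_tan] linear_diff[OF linear_sphere_tan])
qed

text \<open>Pythagoras, with the component along the unit vector \<open>F p\<close> removed. The
  result is polynomial in the Laplacian and \<open>F\<close>, hence easy to differentiate along a
  family of maps.\<close>

lemma norm_tension:
  fixes F :: "'a \<Rightarrow> 'f::euclidean_space"
  assumes "smooth_map A F" "range F \<subseteq> sphere 0 1"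
    and L: "L = chart_laplacian g (chart_at A p) F p"
  shows "(norm (tension A g F p))\<^sup>2 = L \<bullet> L - (L \<bullet> F p)\<^sup>2"
proof -
  have "F p \<bullet> F p = 1"
    using assms(2) by (auto simp: image_subset_iff simp flip: power2_norm_eq_inner)
  then show ?thesis
    unfolding tension_eq[OF assms(1,2)] L[symmetric] power2_norm_eq_inner
    by (simp add: sphere_tan_def inner_diff_left inner_diff_right inner_commute power2_eq_square)
qed

section \<open>The Riemannian volume in a chart\<close>

definition volume_density :: "('a, 'm) chart \<Rightarrow> 'a \<Rightarrow> real" where
  "volume_density c p = sqrt (det (g c p))"

lemma volume_density_pos: "c \<in> A \<Longrightarrow> p \<in> dom_of c \<Longrightarrow> volume_density c p > 0"
  by (simp add: volume_density_def det_metric_pos)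

lemma smooth_volume_density:
  assumes "c \<in> A"
  shows "smooth_in c (dom_of c) (volume_density c)"
  unfolding smooth_in_def volume_density_def o_def
proof (intro smooth_on_sqrt smooth_on_det chart_openD[OF chart_dom[OF assms]])
  show "smooth_on (img_of c) (\<lambda>u. g c (coord_inv c u) $ i $ j)" for i j
    using metric_entry_smooth[OF assms] by (simp add: smooth_in_def o_def)
  show "det (g c (coord_inv c u)) > 0" if "u \<in> img_of c" for u
    by (rule det_metric_pos[OF assms chart_open_coord_inv[OF chart_dom[OF assms] that]])
qed

text \<open>Jacobi's formula for the determinant combined with the chain rule; the factor 1/2 comes
  from the square root.\<close>

lemma pd_volume_density:
  assumes "c \<in> A" "p \<in> dom_of c"
  shows "pd c i (volume_density c) p = volume_density c p *
    (1 / 2 * (\<Sum>k\<in>UNIV. \<Sum>l\<in>UNIV. ginv g c p k l * pd c i (\<lambda>q. g c q $ l $ k) p))"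
proof -
  let ?D = "\<lambda>l k. frechet_derivative ((\<lambda>q. g c q $ l $ k) \<circ> coord_inv c) (at (coord c p))"
  have inv: "coord_inv c (coord c p) = p"
    by (rule coord_inv_coord[OF chart_dom[OF assms(1)] assms(2)])
  note d = det_metric_pos[OF assms]
  let ?S = "\<lambda>v. \<Sum>k\<in>UNIV. \<Sum>l\<in>UNIV. ginv g c p k l * ?D l k v"
  have "((\<lambda>u. det (g c (coord_inv c u))) has_derivative
      (\<lambda>v. det (g c (coord_inv c (coord c p))) *
        (\<Sum>k\<in>UNIV. \<Sum>l\<in>UNIV. matrix_inv (g c (coord_inv c (coord c p))) $ k $ l * ?D l k v)))
      (at (coord c p))"
    by (rule has_derivative_det[OF smooth_in_has_derivative[OF metric_entry_smooth[OF assms(1)] assms(2)]])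
      (use d in \<open>simp add: inv\<close>)
  then have 1: "((\<lambda>u. det (g c (coord_inv c u))) has_derivative (\<lambda>v. det (g c p) * ?S v)) (at (coord c p))"
    by (simp add: inv ginv_def)
  have 2: "(sqrt has_derivative (*) (inverse (sqrt (det (g c p))) / 2)) (at (det (g c (coord_inv c (coord c p)))))"
    using DERIV_real_sqrt[OF d] by (simp add: has_field_derivative_def inv)
  from has_derivative_compose[OF 1 2]
  have "((\<lambda>u. sqrt (det (g c (coord_inv c u)))) has_derivative
      (\<lambda>v. inverse (sqrt (det (g c p))) / 2 * (det (g c p) * ?S v))) (at (coord c p))" .
  then have "pd c i (volume_density c) p =
      inverse (sqrt (det (g c p))) / 2 * (det (g c p) * ?S (axis i 1))"
    by (intro pd_eqI) (simp add: o_def volume_density_def)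
  also have "\<dots> = (inverse (sqrt (det (g c p))) * det (g c p)) * (1 / 2 * ?S (axis i 1))" by simp
  also have "inverse (sqrt (det (g c p))) * det (g c p) = sqrt (det (g c p))"
    using d by (simp add: real_div_sqrt divide_inverse[symmetric] mult.commute)
  finally show ?thesis by (simp only: volume_density_def[of c p] pd_def)
qed

text \<open>In coordinates, \<omega> is extended by zero to all of R^m. Its support in the box makes
  the extension differentiable everywhere, and \<open>integral_directional_derivative_eq_0\<close>
  applies.\<close>

lemma integral_pd_eq_0:
  fixes \<omega> :: "'a \<Rightarrow> real"
  assumes "c \<in> A" "smooth_in c (dom_of c) \<omega>" "cbox a b \<subseteq> img_of c"
    and zero: "\<And>u. u \<in> img_of c \<Longrightarrow> u \<notin> cbox a b \<Longrightarrow> \<omega> (coord_inv c u) = 0"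
  shows "integral (cbox a b) (\<lambda>u. pd c i \<omega> (coord_inv c u)) = 0"
proof -
  note ch = chart_dom[OF assms(1)]
  define h where "h u = (if u \<in> img_of c then \<omega> (coord_inv c u) else 0)" for u
  define h' where "h' u = (if u \<in> img_of c then frechet_derivative (\<omega> \<circ> coord_inv c) (at u) else (\<lambda>_. 0))" for u
  have h: "(h has_derivative h' u) (at u)" for u
  proof (cases "u \<in> img_of c")
    case True
    have "(\<omega> \<circ> coord_inv c has_derivative h' u) (at u)"
      using smooth_on_imp_has_derivative[OF assms(2)[unfolded smooth_in_def] True] True
      by (simp add: h'_def)
    then show ?thesis
      by (rule has_derivative_transform_within_open[OF _ chart_openD[OF ch] True]) (simp add: h_def)
  next
    case False
    have "((\<lambda>_. 0) has_derivative h' u) (at u)" using False by (simp add: h'_def)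
    then show ?thesis
      by (rule has_derivative_transform_within_open[where s = "- cbox a b"])
        (use False assms(3) zero in \<open>auto simp: h_def open_Compl closed_cbox\<close>)
  qed
  have supp: "h u = 0" if "u \<notin> cbox a b" for u
    using that zero by (simp add: h_def)
  have "h' u v = 0" if "u \<notin> cbox a b" for u v
  proof -
    have "((\<lambda>_. 0) has_derivative (\<lambda>_. 0)) (at u)" by simp
    then have "(h has_derivative (\<lambda>_. 0)) (at u)"
      by (rule has_derivative_transform_within_open[where s = "- cbox a b"])
        (use that supp in \<open>auto simp: open_Compl closed_cbox\<close>)
    with h have "h' u = (\<lambda>_. 0)" by (rule has_derivative_unique)
    then show ?thesis by simp
  qed
  then have "continuous_on (- cbox a b) (\<lambda>u. h' u (axis i 1))"
    by (intro continuous_on_cong[THEN iffD1, OF refl _ continuous_on_const[of _ 0]]) simp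
  moreover have "continuous_on (img_of c) (\<lambda>u. h' u (axis i 1))"
    by (rule continuous_on_cong[THEN iffD1, OF refl _
          smooth_on_imp_continuous_on[OF smooth_on_frechet_derivative[OF assms(2)[unfolded smooth_in_def],
            where v = "axis i 1"]]])
      (simp add: h'_def)
  \<comment> \<open>Two open sets cover R^m: on the chart image the extended derivative is that of a
    smooth function, off the box it is zero.\<close>
  ultimately have "continuous_on (img_of c \<union> - cbox a b) (\<lambda>u. h' u (axis i 1))"
    by (intro continuous_on_open_Un chart_openD[OF ch]) (auto simp: open_Compl closed_cbox)
  moreover have "img_of c \<union> - cbox a b = UNIV" using assms(3) by auto
  ultimately have "integral (cbox a b) (\<lambda>u. h' u (axis i 1)) = 0"
    by (intro integral_directional_derivative_eq_0[where h = h] h supp) simp_all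
  moreover have "integral (cbox a b) (\<lambda>u. h' u (axis i 1)) = integral (cbox a b) (\<lambda>u. pd c i \<omega> (coord_inv c u))"
    using assms(3) by (intro integral_cong) (auto simp: h'_def pd_coord_inv[OF ch])
  ultimately show ?thesis by simp
qed

text \<open>\<open>riemannian_volume\<close> prescribes only measures of Borel sets in chart
  domains. The proof identifies \<open>dv\<close>, restricted to the image of the box, with the
  push-forward under \<open>coord_inv c\<close> of the weighted Lebesgue measure on the box, and
  then changes variables.\<close>

lemma volume_integral_chart:
  fixes G :: "'a \<Rightarrow> real"
  assumes "c \<in> A" "cbox a b \<subseteq> img_of c" "riemannian_volume A g dv" "continuous_on (dom_of c) G"
  shows "(LINT p:coord_inv c ` cbox a b|dv. G p) =
    integral (cbox a b) (\<lambda>u. volume_density c (coord_inv c u) * G (coord_inv c u))"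
proof -
  let ?K = "coord_inv c ` cbox a b"
  note ch = chart_dom[OF assms(1)]
  have sets: "sets dv = sets borel" using assms(3) by (simp add: riemannian_volume_def)
  have cinv: "continuous_on (cbox a b) (coord_inv c)"
    using continuous_coord_inv[OF assms(1)] assms(2) by (rule continuous_on_subset)
  have Kd: "?K \<subseteq> dom_of c" using assms(2) chart_open_coord_inv[OF ch] by blast
  have [measurable]: "?K \<in> sets borel"
    by (intro borel_closed compact_imp_closed compact_continuous_image cinv compact_cbox)
  \<comment> \<open>\<open>coord_inv c\<close> made total by a constant off the box, which keeps it
    Borel measurable on R^m. The weight \<open>d\<close> vanishes there, so the constant does not
    show.\<close>
  define T where "T u = (if u \<in> cbox a b then coord_inv c u else undefined)" for u
  have [measurable]: "T \<in> borel_measurable borel"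
    unfolding T_def by (intro borel_measurable_continuous_on_if cinv) (auto simp: continuous_on_const)
  define d where "d u = indicator (cbox a b) u *\<^sub>R volume_density c (coord_inv c u)" for u
  have cvol: "continuous_on (cbox a b) (\<lambda>u. volume_density c (coord_inv c u))"
    using smooth_on_imp_continuous_on[OF smooth_volume_density[OF assms(1), unfolded smooth_in_def]] assms(2)
    by (auto simp: o_def intro: continuous_on_subset)
  have [measurable]: "d \<in> borel_measurable borel"
    unfolding d_def by (rule borel_measurable_continuous_on_indicator[OF _ cvol]) simp
  have d0: "d u \<ge> 0" for u
    by (simp add: d_def volume_density_def indicator_def) (use assms(2) chart_open_coord_inv[OF ch] det_metric_pos[OF assms(1)] in \<open>auto intro: less_imp_le\<close>)
  define G' where "G' p = indicator ?K p *\<^sub>R G p" for p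
  have G': "G' \<in> borel_measurable borel"
    unfolding G'_def
    by (rule borel_measurable_continuous_on_indicator) (use continuous_on_subset[OF assms(4) Kd] in auto)
  have eq: "density dv (\<lambda>p. ennreal (indicator ?K p)) = distr (density lborel (\<lambda>u. ennreal (d u))) borel T"
  proof (rule measure_eqI)
    show "sets (density dv (\<lambda>p. ennreal (indicator ?K p))) = sets (distr (density lborel (\<lambda>u. ennreal (d u))) borel T)"
      by (simp add: sets)
    fix B assume "B \<in> sets (density dv (\<lambda>p. ennreal (indicator ?K p)))"
    then have B[measurable]: "B \<in> sets borel" by (simp add: sets)
    have [measurable]: "?K \<in> sets dv" "B \<in> sets dv" by (simp_all add: sets)
    have "emeasure (density dv (\<lambda>p. ennreal (indicator ?K p))) B =
        (\<integral>\<^sup>+p. ennreal (indicator ?K p) * indicator B p \<partial>dv)"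
      by (rule emeasure_density) measurable
    also have "\<dots> = (\<integral>\<^sup>+p. indicator (?K \<inter> B) p \<partial>dv)"
      by (intro nn_integral_cong) (simp add: indicator_def)
    also have "\<dots> = emeasure dv (?K \<inter> B)" by (intro nn_integral_indicator) measurable
    also have "\<dots> = (\<integral>\<^sup>+u. ennreal (sqrt (det (g c (coord_inv c u)))) * indicator (coord c ` (?K \<inter> B)) u \<partial>lborel)"
    proof -
      have "?K \<inter> B \<in> sets borel" "?K \<inter> B \<subseteq> dom_of c" using Kd by auto
      then show ?thesis using assms(1,3) unfolding riemannian_volume_def by blast
    qed
    also have "\<dots> = (\<integral>\<^sup>+u. ennreal (d u) * indicator (T -` B) u \<partial>lborel)"
    proof (intro nn_integral_cong)
      fix u
      have "u \<in> coord c ` (?K \<inter> B) \<longleftrightarrow> u \<in> cbox a b \<and> T u \<in> B"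
      proof
        assume "u \<in> coord c ` (?K \<inter> B)"
        then obtain v where "v \<in> cbox a b" "coord_inv c v \<in> B" "u = coord c (coord_inv c v)" by auto
        then show "u \<in> cbox a b \<and> T u \<in> B"
          using coord_coord_inv[OF ch, of v] assms(2) by (auto simp: T_def)
      next
        assume *: "u \<in> cbox a b \<and> T u \<in> B"
        then have "coord c (coord_inv c u) = u" using coord_coord_inv[OF ch, of u] assms(2) by auto
        then show "u \<in> coord c ` (?K \<inter> B)"
          using * by (intro image_eqI[of _ _ "coord_inv c u"]) (auto simp: T_def)
      qed
      then show "ennreal (sqrt (det (g c (coord_inv c u)))) * indicator (coord c ` (?K \<inter> B)) u =
          ennreal (d u) * indicator (T -` B) u"
        by (auto simp: d_def indicator_def volume_density_def)
    qed
    also have "\<dots> = emeasure (density lborel (\<lambda>u. ennreal (d u))) (T -` B)"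
      using measurable_sets[OF \<open>T \<in> borel_measurable borel\<close> B] by (intro emeasure_density[symmetric]) auto
    also have "\<dots> = emeasure (distr (density lborel (\<lambda>u. ennreal (d u))) borel T) B"
      by (subst emeasure_distr) auto
    finally show "emeasure (density dv (\<lambda>p. ennreal (indicator ?K p))) B =
        emeasure (distr (density lborel (\<lambda>u. ennreal (d u))) borel T) B" .
  qed
  have Kdv: "?K \<in> sets dv" by (simp add: sets)
  have "(LINT p:?K|dv. G p) = (\<integral>p. indicator ?K p *\<^sub>R G' p \<partial>dv)"
    unfolding set_lebesgue_integral_def G'_def by (intro Bochner_Integration.integral_cong) (auto simp: indicator_def)
  also have "\<dots> = integral\<^sup>L (density dv (\<lambda>p. ennreal (indicator ?K p))) G'"
    by (intro integral_density[symmetric] borel_measurable_indicator Kdv)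
      (use G' measurable_cong_sets[OF sets refl] in auto)
  also have "\<dots> = (\<integral>u. G' (T u) \<partial>density lborel (\<lambda>u. ennreal (d u)))"
    unfolding eq by (rule integral_distr) (use G' in auto)
  also have "\<dots> = (\<integral>u. d u *\<^sub>R G' (T u) \<partial>lborel)"
    by (intro integral_density) (use G' d0 in \<open>auto intro: measurable_compose\<close>)
  also have "\<dots> = (LINT u:cbox a b|lborel. volume_density c (coord_inv c u) * G (coord_inv c u))"
    unfolding set_lebesgue_integral_def
    by (intro Bochner_Integration.integral_cong refl) (auto simp: d_def indicator_def G'_def T_def)
  also have "\<dots> = integral (cbox a b) (\<lambda>u. volume_density c (coord_inv c u) * G (coord_inv c u))"
  proof (rule set_borel_integral_eq_integral(2))
    have "continuous_on (cbox a b) (\<lambda>u. volume_density c (coord_inv c u) * G (coord_inv c u))"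
      by (intro continuous_on_mult cvol continuous_on_compose2[OF assms(4) cinv]) (use Kd in auto)
    then show "set_integrable lborel (cbox a b) (\<lambda>u. volume_density c (coord_inv c u) * G (coord_inv c u))"
      unfolding set_integrable_def by (rule borel_integrable_compact[OF compact_cbox])
  qed
  finally show ?thesis .
qed

end

section \<open>Green's formula\<close>

lemma smooth_on_Pair:
  fixes k :: "'b::euclidean_space"
  shows "smooth_on UNIV (\<lambda>u::'c::euclidean_space. (k, u))"
proof -
  have "smooth_on UNIV (\<lambda>u::'c. (k, 0) + (0, u))"
    by (intro smooth_on_add smooth_on_const open_UNIV
        smooth_on_bounded_linear[OF bounded_linear_Pair[OF bounded_linear_zero bounded_linear_ident]]
        smooth_on_ident)
  then show ?thesis by simp
qed

lemma smooth_on_snd: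
  assumes "open I" "open S" "smooth_on S f"
  shows "smooth_on (I \<times> S) (\<lambda>z. f (snd z))"
  by (rule smooth_on_compose[OF open_Times[OF assms(1,2)] assms(2) _
        smooth_on_bounded_linear[OF bounded_linear_snd open_Times[OF assms(1,2)] smooth_on_ident] assms(3)])
    auto

lemma smooth_on_fst_ident: "open S \<Longrightarrow> smooth_on S fst"
  by (rule smooth_on_bounded_linear[OF bounded_linear_fst _ smooth_on_ident])

lemma smooth_family_slice:
  assumes "open (img_of c)" "open I" "smooth_on (I \<times> img_of c) (\<lambda>z. G (fst z) (coord_inv c (snd z)))" "t \<in> I"
  shows "smooth_in c (dom_of c) (G t)"
  unfolding smooth_in_def
  using smooth_on_compose[OF assms(1) open_Times[OF assms(2,1)] _
      smooth_on_subset[OF smooth_on_Pair[of t] subset_UNIV] assms(3)] assms(4)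
  by (auto simp: o_def)

text \<open>For fixed t the derivative in the chart is the derivative of the joint map in the
  direction (0, axis i 1). Joint smoothness in t and the coordinates is what later permits
  differentiation under the integral sign.\<close>

lemma smooth_family_pd:
  assumes "chart_open c (dom_of c)" "open I"
    "smooth_on (I \<times> img_of c) (\<lambda>z. G (fst z) (coord_inv c (snd z)))"
  shows "smooth_on (I \<times> img_of c) (\<lambda>z. pd c i (G (fst z)) (coord_inv c (snd z)))"
proof (rule smooth_on_cong[OF open_Times[OF assms(2) chart_openD[OF assms(1)]] _
      smooth_on_frechet_derivative[OF assms(3), where v = "(0, axis i 1)"]])
  let ?G = "\<lambda>z. G (fst z) (coord_inv c (snd z))"
  fix z assume z: "z \<in> I \<times> img_of c"
  obtain t u where tu: "z = (t, u)" by (cases z)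
  have "((\<lambda>u. (t, u)) has_derivative (\<lambda>v. (0, v))) (at u)"
    by (auto intro!: derivative_eq_intros)
  moreover have "(?G has_derivative frechet_derivative ?G (at (t, u))) (at (t, u))"
    using smooth_on_imp_has_derivative[OF assms(3) z] tu by simp
  ultimately have "((G t \<circ> coord_inv c) has_derivative (\<lambda>v. frechet_derivative ?G (at (t, u)) (0, v))) (at u)"
    using diff_chain_at[of "\<lambda>u. (t, u)" "\<lambda>v. (0, v)" u ?G "frechet_derivative ?G (at (t, u))"]
    by (simp add: o_def)
  then have "frechet_derivative (G t \<circ> coord_inv c) (at u) = (\<lambda>v. frechet_derivative ?G (at (t, u)) (0, v))"
    by (rule frechet_derivative_at[symmetric])
  moreover have "pd c i (G t) (coord_inv c u) = frechet_derivative (G t \<circ> coord_inv c) (at u) (axis i 1)"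
    by (rule pd_coord_inv[OF assms(1)]) (use z tu in auto)
  ultimately show "frechet_derivative ?G (at z) (0, axis i 1) = pd c i (G (fst z)) (coord_inv c (snd z))"
    by (simp add: tu)
qed

context isometrically_immersed
begin

lemma smooth_family_chart_laplacian:
  assumes "c \<in> A" "open I" "smooth_on (I \<times> img_of c) (\<lambda>z. G (fst z) (coord_inv c (snd z)))"
  shows "smooth_on (I \<times> img_of c) (\<lambda>z. chart_laplacian g c (G (fst z)) (coord_inv c (snd z)))"
proof -
  note ch = chart_dom[OF assms(1)]
  note o = open_Times[OF assms(2) chart_openD[OF ch]]
  have lift: "smooth_on (I \<times> img_of c) (\<lambda>z. f (coord_inv c (snd z)))" if "smooth_in c (dom_of c) f" for f :: "'a \<Rightarrow> real"
    using smooth_on_snd[OF assms(2) chart_openD[OF ch] that[unfolded smooth_in_def]] by (simp add: o_def)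
  have "smooth_in c (dom_of c) (\<lambda>q. \<Sum>l\<in>UNIV. ginv g c q k l * (pd c i (pd c j \<phi>) q \<bullet> pd c l \<phi> q))" for k i j
    by (intro smooth_in_intros ch ginv_smooth smooth_immersion assms(1))
  then have chr: "smooth_in c (dom_of c) (christoffel g c k i j)" for k i j
    by (rule smooth_in_cong[OF ch, rotated]) (simp add: christoffel_immersion[OF assms(1)])
  show ?thesis
    unfolding chart_laplacian_def
    by (intro smooth_on_sum smooth_on_scaleR smooth_on_diff o lift chr ginv_smooth assms(1)
        smooth_family_pd[OF ch assms(2)] assms(3))
qed

text \<open>By \<open>pd_volume_density\<close> the left-hand side is the logarithmic derivative of
  the volume density. Symmetry of \<open>ginv\<close> merges the two halves of the derivative of the
  metric.\<close>

lemma sum_christoffel: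
  assumes "c \<in> A" "p \<in> dom_of c"
  shows "1 / 2 * (\<Sum>k\<in>UNIV. \<Sum>l\<in>UNIV. ginv g c p k l * pd c j (\<lambda>q. g c q $ l $ k) p) =
    (\<Sum>i\<in>UNIV. christoffel g c i i j p)"
proof -
  let ?h = "\<lambda>i a b. pd c i (pd c a \<phi>) p \<bullet> pd c b \<phi> p"
  have "(\<Sum>k\<in>UNIV. \<Sum>l\<in>UNIV. ginv g c p k l * ?h j l k) = (\<Sum>k\<in>UNIV. \<Sum>l\<in>UNIV. ginv g c p k l * ?h j k l)"
    by (subst sum.swap) (simp add: ginv_sym[OF assms])
  moreover have "pd c i (pd c j \<phi>) p = pd c j (pd c i \<phi>) p" for i
    by (rule pd_commute[OF chart_dom[OF assms(1)] smooth_immersion[OF assms(1)] assms(2)])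
  ultimately show ?thesis
    unfolding christoffel_immersion[OF assms] pd_metric[OF assms]
    by (simp add: distrib_left sum.distrib)
qed

text \<open>Differentiating the density produces exactly the Christoffel term of the divergence, so
  a weighted divergence is a sum of plain partial derivatives and integrates to zero.\<close>

lemma divergence_density:
  assumes "c \<in> A" "p \<in> dom_of c" "\<And>i. smooth_in c (dom_of c) (\<lambda>q. X q $ i)"
  shows "(\<Sum>i\<in>UNIV. pd c i (\<lambda>q. volume_density c q * X q $ i) p) = volume_density c p * divergence g c X p"
proof -
  have "(\<Sum>i\<in>UNIV. pd c i (\<lambda>q. volume_density c q * X q $ i) p) =
      volume_density c p * ((\<Sum>i\<in>UNIV. pd c i (\<lambda>q. X q $ i) p) +
        (\<Sum>j\<in>UNIV. (\<Sum>i\<in>UNIV. christoffel g c i i j p) * X p $ j))"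
    unfolding pd_mult[OF chart_dom[OF assms(1)] smooth_volume_density[OF assms(1)] assms(3,2)]
      pd_volume_density[OF assms(1,2)] sum_christoffel[OF assms(1,2)] sum.distrib[symmetric]
      sum_distrib_left[of "volume_density c p"]
    by (rule sum.cong[OF refl]) (simp add: sum_distrib_left sum_distrib_right distrib_left mult.assoc)
  also have "(\<Sum>j\<in>UNIV. (\<Sum>i\<in>UNIV. christoffel g c i i j p) * X p $ j) =
      (\<Sum>i\<in>UNIV. \<Sum>j\<in>UNIV. christoffel g c i i j p * X p $ j)"
    unfolding sum_distrib_right by (rule sum.swap)
  finally show ?thesis by (simp add: divergence_def sum.distrib)
qed

lemma integral_divergence_eq_0:
  assumes "c \<in> A" "cbox a b \<subseteq> img_of c" "\<And>i. smooth_in c (dom_of c) (\<lambda>q. X q $ i)"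
    and zero: "\<And>u. u \<in> img_of c \<Longrightarrow> u \<notin> cbox a b \<Longrightarrow> X (coord_inv c u) = 0"
  shows "integral (cbox a b) (\<lambda>u. volume_density c (coord_inv c u) * divergence g c X (coord_inv c u)) = 0"
proof -
  note ch = chart_dom[OF assms(1)]
  let ?w = "\<lambda>i q. volume_density c q * X q $ i"
  have sw: "smooth_in c (dom_of c) (?w i)" for i
    by (intro smooth_in_mult ch smooth_volume_density assms)
  have "integral (cbox a b) (\<lambda>u. volume_density c (coord_inv c u) * divergence g c X (coord_inv c u)) =
      integral (cbox a b) (\<lambda>u. \<Sum>i\<in>UNIV. pd c i (?w i) (coord_inv c u))"
    using assms(2) by (intro integral_cong divergence_density[symmetric] assms chart_open_coord_inv[OF ch]) auto
  also have "\<dots> = (\<Sum>i\<in>UNIV. integral (cbox a b) (\<lambda>u. pd c i (?w i) (coord_inv c u)))"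
  proof (intro integral_sum integrable_continuous)
    show "continuous_on (cbox a b) (\<lambda>u. pd c i (?w i) (coord_inv c u))" for i
      by (rule smooth_in_continuous_on_cbox[OF assms(1,2) smooth_in_pd[OF ch sw]])
  qed simp
  also have "\<dots> = 0"
    by (intro sum.neutral ballI integral_pd_eq_0[OF assms(1) sw assms(2)]) (simp add: zero)
  finally show ?thesis .
qed

text \<open>The integrand is the weighted divergence of f grad h - h grad f; the two products of
  gradients cancel by symmetry of \<open>ginv\<close>.\<close>

lemma green_scalar:
  fixes f h :: "'a \<Rightarrow> real"
  assumes "c \<in> A" "cbox a b \<subseteq> img_of c" "smooth_in c (dom_of c) f" "smooth_in c (dom_of c) h"
    and zero: "\<And>u. u \<in> img_of c \<Longrightarrow> u \<notin> cbox a b \<Longrightarrow> h (coord_inv c u) = 0"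
  shows "integral (cbox a b) (\<lambda>u. volume_density c (coord_inv c u) *
    (f (coord_inv c u) * chart_laplacian g c h (coord_inv c u) -
     h (coord_inv c u) * chart_laplacian g c f (coord_inv c u))) = 0"
proof -
  note ch = chart_dom[OF assms(1)]
  let ?X = "\<lambda>q. \<chi> i. f q * gradient g c h q $ i - h q * gradient g c f q $ i"
  have sg: "smooth_in c (dom_of c) (\<lambda>q. gradient g c k q $ i)" if "smooth_in c (dom_of c) k" for k i
    unfolding gradient_def vec_lambda_beta
    by (intro smooth_in_intros ch ginv_smooth assms(1) that)
  have "divergence g c ?X q = f q * chart_laplacian g c h q - h q * chart_laplacian g c f q"
    if q: "q \<in> dom_of c" for q
  proof -
    have 1: "pd c i (\<lambda>q. f q * gradient g c h q $ i - h q * gradient g c f q $ i) q =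
        f q * pd c i (\<lambda>q. gradient g c h q $ i) q + pd c i f q * gradient g c h q $ i -
        (h q * pd c i (\<lambda>q. gradient g c f q $ i) q + pd c i h q * gradient g c f q $ i)" for i
      unfolding pd_diff[OF smooth_in_mult[OF ch assms(3) sg[OF assms(4)]]
          smooth_in_mult[OF ch assms(4) sg[OF assms(3)]] q]
        pd_mult[OF ch assms(3) sg[OF assms(4)] q] pd_mult[OF ch assms(4) sg[OF assms(3)] q] ..
    have 2: "(\<Sum>i\<in>UNIV. pd c i f q * gradient g c h q $ i) = (\<Sum>i\<in>UNIV. pd c i h q * gradient g c f q $ i)"
      unfolding gradient_def vec_lambda_beta sum_distrib_left
      by (subst sum.swap) (simp add: ginv_sym[OF assms(1) q] mult_ac)
    have 3: "(\<Sum>j\<in>UNIV. christoffel g c i i j q * (f q * gradient g c h q $ j - h q * gradient g c f q $ j)) =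
        f q * (\<Sum>j\<in>UNIV. christoffel g c i i j q * gradient g c h q $ j) -
        h q * (\<Sum>j\<in>UNIV. christoffel g c i i j q * gradient g c f q $ j)" for i
      unfolding sum_distrib_left sum_subtractf[symmetric]
      by (rule sum.cong[OF refl]) (simp add: algebra_simps)
    have "divergence g c ?X q = f q * divergence g c (gradient g c h) q - h q * divergence g c (gradient g c f) q +
        ((\<Sum>i\<in>UNIV. pd c i f q * gradient g c h q $ i) - (\<Sum>i\<in>UNIV. pd c i h q * gradient g c f q $ i))"
      unfolding divergence_def vec_lambda_beta 1 3 sum_distrib_left sum_subtractf[symmetric] sum.distrib[symmetric]
      by (rule sum.cong[OF refl]) (simp add: sum.distrib sum_subtractf sum_distrib_left algebra_simps)
    then show ?thesis
      unfolding 2 divergence_gradient[OF assms(1) q assms(3)] divergence_gradient[OF assms(1) q assms(4)] by simp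
  qed
  then have "integral (cbox a b) (\<lambda>u. volume_density c (coord_inv c u) *
      (f (coord_inv c u) * chart_laplacian g c h (coord_inv c u) -
       h (coord_inv c u) * chart_laplacian g c f (coord_inv c u))) =
    integral (cbox a b) (\<lambda>u. volume_density c (coord_inv c u) * divergence g c ?X (coord_inv c u))"
    by (intro integral_cong) (use assms(2) chart_open_coord_inv[OF ch] in \<open>simp add: subset_iff\<close>)
  also have "\<dots> = 0"
  proof (rule integral_divergence_eq_0[OF assms(1,2)])
    show "smooth_in c (dom_of c) (\<lambda>q. ?X q $ i)" for i
      unfolding vec_lambda_beta by (intro smooth_in_diff smooth_in_mult ch sg assms)
    fix u assume u: "u \<in> img_of c" "u \<notin> cbox a b"
    \<comment> \<open>The vanishing of \<open>h\<close> at one point says nothing about its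
      gradient. On this open set \<open>h\<close> is identically zero, so the gradient vanishes at
      \<open>coord_inv c u\<close> as well.\<close>
    let ?V = "{q \<in> dom_of c. coord c q \<notin> cbox a b}"
    have "coord c ` ?V = img_of c - cbox a b" by auto
    then have chV: "chart_open c ?V"
      using ch by (auto simp: chart_open_def intro!: open_Diff closed_cbox)
    have uV: "coord_inv c u \<in> ?V"
      using u coord_coord_inv[OF ch u(1)] chart_open_coord_inv[OF ch u(1)] by simp
    have "h q = 0" if "q \<in> ?V" for q
      using zero[of "coord c q"] that coord_inv_coord[OF ch] by auto
    then have "pd c j h (coord_inv c u) = pd c j (\<lambda>q. 0) (coord_inv c u)" for j
      by (intro pd_cong[OF chV smooth_in_subset[OF assms(4)] uV]) auto
    then show "?X (coord_inv c u) = 0"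
      using zero[OF u] by (simp add: vec_eq_iff gradient_def pd_const)
  qed
  finally show ?thesis .
qed

lemma green:
  fixes f h :: "'a \<Rightarrow> 'f::euclidean_space"
  assumes "c \<in> A" "cbox a b \<subseteq> img_of c" "smooth_in c (dom_of c) f" "smooth_in c (dom_of c) h"
    and zero: "\<And>u. u \<in> img_of c \<Longrightarrow> u \<notin> cbox a b \<Longrightarrow> h (coord_inv c u) = 0"
  shows "integral (cbox a b) (\<lambda>u. volume_density c (coord_inv c u) *
    (f (coord_inv c u) \<bullet> chart_laplacian g c h (coord_inv c u) -
     h (coord_inv c u) \<bullet> chart_laplacian g c f (coord_inv c u))) = 0"
proof -
  note ch = chart_dom[OF assms(1)]
  let ?f = "\<lambda>b q. f q \<bullet> b" and ?h = "\<lambda>b q. h q \<bullet> b"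
  have sb: "smooth_in c (dom_of c) (\<lambda>q. k q \<bullet> b)" if "smooth_in c (dom_of c) k" for k :: "'a \<Rightarrow> 'f" and b
    by (rule smooth_in_bounded_linear[OF bounded_linear_inner_left ch that])
  let ?I = "\<lambda>b u. volume_density c (coord_inv c u) *
      (?f b (coord_inv c u) * chart_laplacian g c (?h b) (coord_inv c u) -
       ?h b (coord_inv c u) * chart_laplacian g c (?f b) (coord_inv c u))"
  have "integral (cbox a b) (\<lambda>u. volume_density c (coord_inv c u) *
      (f (coord_inv c u) \<bullet> chart_laplacian g c h (coord_inv c u) -
       h (coord_inv c u) \<bullet> chart_laplacian g c f (coord_inv c u))) =
    integral (cbox a b) (\<lambda>u. \<Sum>b\<in>Basis. ?I b u)"
  proof (rule integral_cong)
    fix u assume "u \<in> cbox a b"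
    then have q: "coord_inv c u \<in> dom_of c" using assms(2) chart_open_coord_inv[OF ch] by blast
    let ?q = "coord_inv c u"
    have 1: "f ?q \<bullet> chart_laplacian g c h ?q = (\<Sum>b\<in>Basis. (f ?q \<bullet> b) * (chart_laplacian g c h ?q \<bullet> b))"
      and 2: "h ?q \<bullet> chart_laplacian g c f ?q = (\<Sum>b\<in>Basis. (h ?q \<bullet> b) * (chart_laplacian g c f ?q \<bullet> b))"
      by (rule euclidean_inner)+
    show "volume_density c ?q * (f ?q \<bullet> chart_laplacian g c h ?q - h ?q \<bullet> chart_laplacian g c f ?q) =
        (\<Sum>b\<in>Basis. ?I b u)"
      unfolding chart_laplacian_bounded_linear[OF bounded_linear_inner_left ch assms(3) q]
        chart_laplacian_bounded_linear[OF bounded_linear_inner_left ch assms(4) q] 1 2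
      by (simp only: sum_distrib_left sum_subtractf[symmetric])
  qed
  also have "\<dots> = (\<Sum>d\<in>Basis. integral (cbox a b) (?I d))"
  proof (intro integral_sum finite_Basis integrable_continuous)
    fix d :: 'f
    show "continuous_on (cbox a b) (?I d)"
      by (rule smooth_in_continuous_on_cbox[OF assms(1,2), where
            k = "\<lambda>q. volume_density c q * (?f d q * chart_laplacian g c (?h d) q - ?h d q * chart_laplacian g c (?f d) q)"])
        (intro smooth_in_mult smooth_in_diff ch smooth_volume_density smooth_in_chart_laplacian sb assms)
  qed
  also have "\<dots> = 0"
    by (intro sum.neutral ballI green_scalar[OF assms(1,2) sb[OF assms(3)] sb[OF assms(4)]]) (simp add: zero)
  finally show ?thesis .
qed

end

section \<open>First variation of the bienergy\<close>

context riemannian_manifold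
begin

section \<open>The Laplacian of a scalar product\<close>

lemma chart_laplacian_inner:
  fixes f h :: "'a \<Rightarrow> 'f::euclidean_space"
  assumes "c \<in> A" "p \<in> dom_of c" "smooth_in c (dom_of c) f" "smooth_in c (dom_of c) h"
  shows "chart_laplacian g c (\<lambda>q. f q \<bullet> h q) p = chart_laplacian g c f p \<bullet> h p + f p \<bullet> chart_laplacian g c h p +
    2 * (\<Sum>i\<in>UNIV. \<Sum>j\<in>UNIV. ginv g c p i j * (pd c i f p \<bullet> pd c j h p))"
proof -
  note ch = chart_dom[OF assms(1)] and p = assms(2) and sf = assms(3) and sh = assms(4)
  have 1: "pd c j (\<lambda>q. f q \<bullet> h q) q = f q \<bullet> pd c j h q + pd c j f q \<bullet> h q" if "q \<in> dom_of c" for j q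
    by (rule pd_inner[OF ch sf sh that])
  have 2: "pd c i (pd c j (\<lambda>q. f q \<bullet> h q)) p = f p \<bullet> pd c i (pd c j h) p + pd c i f p \<bullet> pd c j h p +
      (pd c j f p \<bullet> pd c i h p + pd c i (pd c j f) p \<bullet> h p)" for i j
  proof -
    have "pd c i (pd c j (\<lambda>q. f q \<bullet> h q)) p = pd c i (\<lambda>q. f q \<bullet> pd c j h q + pd c j f q \<bullet> h q) p"
      by (rule pd_cong[OF ch smooth_in_pd[OF ch smooth_in_inner[OF ch sf sh]] p 1])
    also have "\<dots> = pd c i (\<lambda>q. f q \<bullet> pd c j h q) p + pd c i (\<lambda>q. pd c j f q \<bullet> h q) p"
      by (rule pd_add[OF smooth_in_inner[OF ch sf smooth_in_pd[OF ch sh]]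
            smooth_in_inner[OF ch smooth_in_pd[OF ch sf] sh] p])
    finally show ?thesis
      unfolding pd_inner[OF ch sf smooth_in_pd[OF ch sh] p] pd_inner[OF ch smooth_in_pd[OF ch sf] sh p] .
  qed
  have 3: "(\<Sum>i\<in>UNIV. \<Sum>j\<in>UNIV. ginv g c p i j * (pd c j f p \<bullet> pd c i h p)) =
      (\<Sum>i\<in>UNIV. \<Sum>j\<in>UNIV. ginv g c p i j * (pd c i f p \<bullet> pd c j h p))"
    by (subst sum.swap) (simp add: ginv_sym[OF assms(1) p])
  have "chart_laplacian g c (\<lambda>q. f q \<bullet> h q) p = (\<Sum>i\<in>UNIV. \<Sum>j\<in>UNIV.
      ginv g c p i j * ((pd c i (pd c j f) p - (\<Sum>k\<in>UNIV. christoffel g c k i j p *\<^sub>R pd c k f p)) \<bullet> h p) +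
      ginv g c p i j * (f p \<bullet> (pd c i (pd c j h) p - (\<Sum>k\<in>UNIV. christoffel g c k i j p *\<^sub>R pd c k h p))) +
      (ginv g c p i j * (pd c i f p \<bullet> pd c j h p) + ginv g c p i j * (pd c j f p \<bullet> pd c i h p)))"
    unfolding chart_laplacian_def 2 1[OF p]
    by (intro sum.cong refl)
      (simp add: inner_diff_left inner_diff_right inner_sum_left inner_sum_right sum.distrib algebra_simps)
  also have "\<dots> = chart_laplacian g c f p \<bullet> h p + f p \<bullet> chart_laplacian g c h p +
      ((\<Sum>i\<in>UNIV. \<Sum>j\<in>UNIV. ginv g c p i j * (pd c i f p \<bullet> pd c j h p)) +
       (\<Sum>i\<in>UNIV. \<Sum>j\<in>UNIV. ginv g c p i j * (pd c j f p \<bullet> pd c i h p)))"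
    unfolding chart_laplacian_def inner_sum_left inner_sum_right inner_scaleR_left inner_scaleR_right
    by (simp only: sum.distrib)
  finally show ?thesis unfolding 3 by simp
qed

lemma chart_laplacian_const:
  assumes "c \<in> A" "p \<in> dom_of c"
  shows "chart_laplacian g c (\<lambda>q. k) p = 0"
proof -
  have "pd c i (pd c j (\<lambda>q. k)) p = 0" for i j
    using pd_cong[OF chart_dom[OF assms(1)] smooth_in_const[of c _ 0] assms(2), of "pd c j (\<lambda>q. k)" i]
    by (simp add: pd_const)
  then show ?thesis by (simp add: chart_laplacian_def pd_const)
qed

text \<open>Serves for |\<phi>|^2 = 1, \<langle>\<tau>, \<phi>\<rangle> = 0 and |a|^2 = 2: each
  constant scalar product trades Laplacians for a trace of first derivatives.\<close>

lemma chart_laplacian_inner_const: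
  fixes f h :: "'a \<Rightarrow> 'f::euclidean_space"
  assumes "c \<in> A" "p \<in> dom_of c" "smooth_in c (dom_of c) f" "smooth_in c (dom_of c) h"
    and "\<And>q. f q \<bullet> h q = k"
  shows "chart_laplacian g c f p \<bullet> h p + f p \<bullet> chart_laplacian g c h p =
    - 2 * (\<Sum>i\<in>UNIV. \<Sum>j\<in>UNIV. ginv g c p i j * (pd c i f p \<bullet> pd c j h p))"
proof -
  have "chart_laplacian g c (\<lambda>q. f q \<bullet> h q) p = 0"
    unfolding assms(5) by (rule chart_laplacian_const[OF assms(1,2)])
  then show ?thesis using chart_laplacian_inner[OF assms(1-4)] by linarith
qed

end

context isometrically_immersed
begin

section \<open>Mean curvature of an immersion into a sphere\<close>

lemma normal_part_pd:
  assumes "c \<in> A" "p \<in> dom_of c"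
  shows "normal_part g c \<phi> p (pd c a \<phi> p) = 0"
proof -
  have "(\<Sum>k\<in>UNIV. \<Sum>l\<in>UNIV. (ginv g c p k l * (pd c a \<phi> p \<bullet> pd c l \<phi> p)) *\<^sub>R pd c k \<phi> p) =
      (\<Sum>k\<in>UNIV. (\<Sum>l\<in>UNIV. ginv g c p k l * g c p $ l $ a) *\<^sub>R pd c k \<phi> p)"
    by (simp add: gram[OF assms] scaleR_sum_left metric_sym[OF assms, of a])
  also have "\<dots> = pd c a \<phi> p"
    by (simp add: ginv_metric(1)[OF assms] if_distrib if_distribR cong: if_cong)
  finally show ?thesis by (simp add: normal_part_def)
qed

text \<open>The trace of the second fundamental form is \<open>trace_hess\<close> under both
  projections. It differs from the Laplacian by vectors tangent to the image, which
  \<open>normal_part\<close> kills, while the Laplacian itself is orthogonal to the image.\<close>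

lemma mean_curvature_eq:
  assumes "range \<phi> \<subseteq> sphere 0 r"
  shows "mean_curvature A g \<phi> p = (1 / real CARD('m)) *\<^sub>R sphere_tan (\<phi> p) (laplacian_vec A g \<phi> p)"
proof -
  let ?c = "chart_at A p"
  note c = chart_at(1)[of p] chart_at(2)[of p]
  let ?L = "chart_laplacian g ?c \<phi> p"
  let ?S = "sphere_tan (\<phi> p)" and ?N = "normal_part g ?c \<phi> p"
  let ?\<gamma> = "\<lambda>k. \<Sum>l\<in>UNIV. ginv g ?c p k l * (trace_hess g ?c \<phi> p \<bullet> pd ?c l \<phi> p)"
  have sm: "smooth_map A \<phi>" using immersion by (simp add: isometric_immersion_def)
  have orth: "pd ?c k \<phi> p \<bullet> \<phi> p = 0" for k by (rule pd_orthogonal_sphere[OF sm assms c])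
  have "?N (?S (pd ?c k \<phi> p)) = 0" for k
    by (simp add: sphere_tan_orthogonal[OF orth] normal_part_pd[OF c])
  moreover have "?N (?S ?L) = ?S ?L"
  proof -
    have "?S ?L \<bullet> pd ?c l \<phi> p = 0" for l
      using chart_laplacian_orthogonal[OF c, of l] orth[of l]
      by (simp add: sphere_tan_def inner_diff_left inner_commute[of "\<phi> p" "pd ?c l \<phi> p"])
    then show ?thesis by (simp add: normal_part_def)
  qed
  moreover obtain \<gamma> where "trace_hess g ?c \<phi> p = ?L + (\<Sum>k\<in>UNIV. \<gamma> k *\<^sub>R pd ?c k \<phi> p)"
  proof
    show "trace_hess g ?c \<phi> p = ?L + (\<Sum>k\<in>UNIV. ?\<gamma> k *\<^sub>R pd ?c k \<phi> p)"
      by (simp add: chart_laplacian_eq[OF c] scaleR_sum_left)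
  qed
  ultimately have "?N (?S (trace_hess g ?c \<phi> p)) = ?S ?L"
    by (simp add: linear_add[OF linear_sphere_tan] linear_add[OF linear_normal_part]
        linear_sum[OF linear_sphere_tan] linear_sum[OF linear_normal_part]
        linear_scale[OF linear_sphere_tan] linear_scale[OF linear_normal_part])
  moreover have "(\<Sum>i\<in>UNIV. \<Sum>j\<in>UNIV. ginv g ?c p i j *\<^sub>R second_fundamental_form g ?c \<phi> i j p) =
      ?N (?S (trace_hess g ?c \<phi> p))"
    by (simp add: second_fundamental_form_def trace_hess_def
        linear_sum[OF linear_sphere_tan] linear_sum[OF linear_normal_part]
        linear_scale[OF linear_sphere_tan] linear_scale[OF linear_normal_part])
  ultimately show ?thesis
    by (simp add: mean_curvature_def Let_def laplacian_vec_eq[OF sm c])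
qed

text \<open>The Euler-Lagrange equation in weak form, tested with the cutoff \<beta> times a field W
  tangent to the sphere. The explicit family \<open>F\<close> below has initial velocity 2 \<beta>
  W, and Green's formula moves the Laplacian from the variation field to \<tau>.\<close>

lemma first_variation:
  assumes sph: "range \<phi> \<subseteq> sphere 0 1" and bih: "biharmonic A g 1 \<phi>"
    and W: "smooth_map A W" "\<And>q. W q \<bullet> \<phi> q = 0"
    and c: "c \<in> A" and cb: "cbox a b \<subseteq> img_of c"
    and \<beta>: "smooth_on UNIV \<beta>" "\<And>u. u \<notin> cbox a b \<Longrightarrow> \<beta> u = 0"
    and \<tau>: "\<And>q. \<tau> q = laplacian_vec A g \<phi> q + real CARD('m) *\<^sub>R \<phi> q"
    and \<tau>_normal: "\<And>q. \<tau> q \<bullet> \<phi> q = 0"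
  shows "integral (cbox a b) (\<lambda>u. volume_density c (coord_inv c u) * (\<beta> u *
    ((chart_laplacian g c \<tau> (coord_inv c u) + real CARD('m) *\<^sub>R \<tau> (coord_inv c u)) \<bullet> W (coord_inv c u)))) = 0"
proof -
  let ?m = "real CARD('m)"
  let ?K = "coord_inv c ` cbox a b"
  let ?I = "{-1<..<1::real}"
  let ?vol = "volume_density c"
  note ch = chart_dom[OF c]
  have sm\<phi>: "smooth_map A \<phi>" using immersion by (simp add: isometric_immersion_def)
  have \<phi>1: "\<phi> q \<bullet> \<phi> q = 1" for q
    using sph by (auto simp: image_subset_iff simp flip: power2_norm_eq_inner)
  have compK: "compact ?K"
    by (intro compact_continuous_image compact_cbox continuous_on_subset[OF continuous_coord_inv[OF c] cb])
  have K: "?K \<subseteq> dom_of c" using cb chart_open_coord_inv[OF ch] by blast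
  \<comment> \<open>Extended by zero outside the chart. Each chart domain is covered by its part
    inside \<open>dom_of c\<close> and its part off the compact set \<open>?K\<close>, both open,
    and \<open>V\<close> is smooth on either.\<close>
  define V where "V q = (if q \<in> dom_of c then \<beta> (coord c q) *\<^sub>R W q else 0)" for q
  have V0: "V q = 0" if "q \<notin> ?K" for q
  proof (cases "q \<in> dom_of c")
    case True
    then have "coord c q \<notin> cbox a b"
      using that coord_inv_coord[OF ch True] by (metis image_eqI)
    then show ?thesis by (simp add: V_def \<beta>(2))
  qed (simp add: V_def)
  have smV: "smooth_map A V"
  proof (rule smooth_mapI)
    fix d assume d: "d \<in> A"
    let ?U = "dom_of d \<inter> dom_of c" and ?U' = "dom_of d - ?K"
    note chU = chart_overlap[OF d c]
    have chU': "chart_open d ?U'"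
      by (rule chart_open_open[OF d]) (auto intro!: open_Diff open_dom[OF d] compact_imp_closed compK)
    have "smooth_in d ?U (\<lambda>q. \<beta> (coord c q))"
      unfolding smooth_in_def
      using smooth_on_compose[OF chart_openD[OF chU] open_UNIV subset_UNIV smooth_transition[OF d c] \<beta>(1)]
      by (simp add: o_def)
    then have "smooth_in d ?U (\<lambda>q. \<beta> (coord c q) *\<^sub>R W q)"
      by (rule smooth_in_scaleR[OF chU _ smooth_in_subset[OF smooth_mapD[OF W(1) d]]]) auto
    then have 1: "smooth_in d ?U V"
      by (rule smooth_in_cong[OF chU, rotated]) (simp add: V_def)
    have 2: "smooth_in d ?U' V"
      by (rule smooth_in_cong[OF chU' _ smooth_in_const[of d _ 0]]) (simp add: V0)
    have "dom_of d = ?U \<union> ?U'" using K by blast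
    then have "img_of d = coord d ` ?U \<union> coord d ` ?U'" by blast
    then show "smooth_in d (dom_of d) V"
      using smooth_on_Un[OF chart_openD[OF chU] chart_openD[OF chU'] 1[unfolded smooth_in_def] 2[unfolded smooth_in_def]]
      by (simp add: smooth_in_def)
  qed
  have V\<phi>: "V q \<bullet> \<phi> q = 0" for q by (simp add: V_def W(2))
  define w where "w q = V q \<bullet> V q" for q
  have w0: "1 + t\<^sup>2 * w q > 0" for t q by (simp add: w_def add_pos_nonneg)
  \<comment> \<open>Chosen so that F t = \<phi> + 2 t V + t^2 R t is the point of the sphere with
    stereographic parameter t V, see \<open>F_alt\<close>. With t^2 split off, the derivative of the
    Laplacian of F t at t = 0 is 2 \<Delta>V by linearity, without exchanging \<Delta> and the
    derivative in t.\<close>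
  define R where "R t q = (- 2 * w q / (1 + t\<^sup>2 * w q)) *\<^sub>R (\<phi> q + t *\<^sub>R V q)" for t q
  define F where "F t q = \<phi> q + ((2 * t) *\<^sub>R V q + t\<^sup>2 *\<^sub>R R t q)" for t q
  have F_alt: "F t q = (1 / (1 + t\<^sup>2 * w q)) *\<^sub>R ((1 - t\<^sup>2 * w q) *\<^sub>R \<phi> q + (2 * t) *\<^sub>R V q)" for t q
  proof -
    let ?D = "1 + t\<^sup>2 * w q"
    have "?D *\<^sub>R F t q = ?D *\<^sub>R \<phi> q + (?D * (2 * t)) *\<^sub>R V q + (t\<^sup>2 * (- 2 * w q)) *\<^sub>R (\<phi> q + t *\<^sub>R V q)"
    proof -
      have "?D * (t\<^sup>2 * (- 2 * w q / ?D)) = t\<^sup>2 * (- 2 * w q)"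
        using w0[of t q] by (simp add: divide_simps)
      then show ?thesis
        by (simp only: F_def R_def scaleR_add_right[of ?D] scaleR_scaleR add.assoc)
    qed
    also have "\<dots> = (1 - t\<^sup>2 * w q) *\<^sub>R \<phi> q + (2 * t) *\<^sub>R V q"
    proof -
      have lin: "x *\<^sub>R v + y *\<^sub>R v' + z *\<^sub>R (v + t *\<^sub>R v') = (x + z) *\<^sub>R v + (y + z * t) *\<^sub>R v'"
        for x y z and v v' :: 'e
        by (simp add: scaleR_add_left scaleR_add_right)
      have "?D *\<^sub>R \<phi> q + (?D * (2 * t)) *\<^sub>R V q + (t\<^sup>2 * (- 2 * w q)) *\<^sub>R (\<phi> q + t *\<^sub>R V q) =
          (?D + t\<^sup>2 * (- 2 * w q)) *\<^sub>R \<phi> q + (?D * (2 * t) + t\<^sup>2 * (- 2 * w q) * t) *\<^sub>R V q"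
        by (rule lin)
      also have "?D + t\<^sup>2 * (- 2 * w q) = 1 - t\<^sup>2 * w q" by simp
      also have "?D * (2 * t) + t\<^sup>2 * (- 2 * w q) * t = 2 * t" by (simp add: algebra_simps)
      finally show ?thesis .
    qed
    finally have "(1 / ?D) *\<^sub>R (?D *\<^sub>R F t q) = (1 / ?D) *\<^sub>R ((1 - t\<^sup>2 * w q) *\<^sub>R \<phi> q + (2 * t) *\<^sub>R V q)" by simp
    then show ?thesis using w0[of t q] by simp
  qed
  have F1: "F t q \<in> sphere 0 1" for t q
  proof -
    let ?D = "1 + t\<^sup>2 * w q"
    \<comment> \<open>By orthogonality of \<open>\<phi> q\<close> and \<open>V q\<close> the square
      is (1 - t^2 w)^2 + 4 t^2 w.\<close>
    have "((1 - t\<^sup>2 * w q) *\<^sub>R \<phi> q + (2 * t) *\<^sub>R V q) \<bullet> ((1 - t\<^sup>2 * w q) *\<^sub>R \<phi> q + (2 * t) *\<^sub>R V q) = ?D\<^sup>2"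
      by (simp add: inner_add_left inner_add_right \<phi>1 V\<phi> inner_commute[of "\<phi> q" "V q"] flip: w_def)
        (simp add: power2_eq_square algebra_simps)
    then have "F t q \<bullet> F t q = 1"
      using w0[of t q] by (simp add: F_alt power2_eq_square)
    then show ?thesis by (simp add: norm_eq_sqrt_inner)
  qed
  have lift: "smooth_on (?I \<times> img_of d) (\<lambda>z. f (coord_inv d (snd z)))"
    if "d \<in> A" "smooth_in d (dom_of d) f" for d and f :: "'a \<Rightarrow> 'f::real_normed_vector"
    using smooth_on_snd[of ?I, OF _ chart_openD[OF chart_dom[OF that(1)]] that(2)[unfolded smooth_in_def]]
    by (simp add: o_def)
  have smw: "smooth_in d (dom_of d) w" if "d \<in> A" for d
    unfolding w_def[abs_def] by (intro smooth_in_inner chart_dom that smooth_mapD[OF smV])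
  have jR: "smooth_on (?I \<times> img_of d) (\<lambda>z. R (fst z) (coord_inv d (snd z)))" if d: "d \<in> A" for d
  proof -
    have o: "open (?I \<times> img_of d)" by (intro open_Times chart_openD[OF chart_dom[OF d]]) auto
    show ?thesis
      unfolding R_def power2_eq_square
      by (intro smooth_on_scaleR smooth_on_divide smooth_on_mult smooth_on_add smooth_on_const o
          lift d smw smooth_mapD[OF smV d] smooth_mapD[OF sm\<phi> d] smooth_on_fst_ident)
        (use w0 in \<open>auto simp: power2_eq_square less_imp_neq[symmetric]\<close>)
  qed
  have jF: "smooth_on (?I \<times> img_of d) (\<lambda>z. F (fst z) (coord_inv d (snd z)))" if d: "d \<in> A" for d
  proof -
    have o: "open (?I \<times> img_of d)" by (intro open_Times chart_openD[OF chart_dom[OF d]]) auto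
    show ?thesis
      unfolding F_def power2_eq_square
      by (intro smooth_on_scaleR smooth_on_mult smooth_on_add smooth_on_const o
          lift d smw smooth_mapD[OF smV d] smooth_mapD[OF sm\<phi> d] smooth_on_fst_ident jR)
  qed
  have smF: "smooth_map A (F t)" if "t \<in> ?I" for t
    by (rule smooth_mapI, rule smooth_family_slice[OF chart_openD[OF chart_dom] _ jF that]) auto
  have var: "variation A 1 \<phi> ?K 1 F"
    unfolding variation_def case_prod_beta
  proof (intro conjI ballI allI impI)
    show "F 0 = \<phi>" by (rule ext) (simp add: F_def)
    show "F t q = \<phi> q" if "q \<notin> ?K" for t q
      using V0[OF that] by (simp add: F_def R_def w_def)
  qed (use compK jF F1 in simp_all)
  obtain dv where dv: "riemannian_volume A g dv"
    and crit: "((\<lambda>t. bienergy A g dv ?K (F t)) has_real_derivative 0) (at 0)"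
    using bih var unfolding biharmonic_def by blast
  let ?L = "\<lambda>t u. chart_laplacian g c (F t) (coord_inv c u)"
  define Q where "Q t u = ?L t u \<bullet> ?L t u - (?L t u \<bullet> F t (coord_inv c u))\<^sup>2" for t u
  let ?f = "\<lambda>z. ?vol (coord_inv c (snd z)) * Q (fst z) (snd z)"
  have oI: "open (?I \<times> img_of c)" by (intro open_Times chart_openD[OF ch]) auto
  have jL: "smooth_on (?I \<times> img_of c) (\<lambda>z. ?L (fst z) (snd z))"
    by (rule smooth_family_chart_laplacian[OF c _ jF[OF c]]) simp
  have jf: "smooth_on (?I \<times> img_of c) ?f"
    unfolding Q_def power2_eq_square
    by (intro smooth_on_mult smooth_on_diff smooth_on_inner oI jL jF c lift smooth_volume_density)
  \<comment> \<open>Here the measure is eliminated: over \<open>?K\<close> the bienergy is an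
    integral over a box with a jointly smooth integrand, so it can be differentiated under the
    integral sign.\<close>
  have energy: "bienergy A g dv ?K (F t) = 1 / 2 * integral (cbox a b) (\<lambda>u. ?f (t, u))" if t: "t \<in> ?I" for t
  proof -
    note sF = smooth_mapD[OF smF[OF t] c]
    have n: "(norm (tension A g (F t) q))\<^sup>2 = chart_laplacian g c (F t) q \<bullet> chart_laplacian g c (F t) q -
        (chart_laplacian g c (F t) q \<bullet> F t q)\<^sup>2" if q: "q \<in> dom_of c" for q
    proof -
      have "chart_laplacian g (chart_at A q) (F t) q = chart_laplacian g c (F t) q"
        by (rule chart_laplacian_overlap[OF chart_at(1) c sF chart_at(2) q])
      moreover have "range (F t) \<subseteq> sphere 0 1" using F1 by blast
      ultimately show ?thesis
        using norm_tension[OF smF[OF t] _ refl, of q] by simp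
    qed
    have "smooth_in c (dom_of c) (\<lambda>q. chart_laplacian g c (F t) q \<bullet> chart_laplacian g c (F t) q -
        (chart_laplacian g c (F t) q \<bullet> F t q)\<^sup>2)"
      unfolding power2_eq_square
      by (intro smooth_in_diff smooth_in_mult smooth_in_inner smooth_in_chart_laplacian ch c sF)
    then have "smooth_in c (dom_of c) (\<lambda>q. (norm (tension A g (F t) q))\<^sup>2)"
      by (rule smooth_in_cong[OF ch, rotated]) (simp add: n)
    then have "continuous_on (dom_of c) (\<lambda>q. (norm (tension A g (F t) q))\<^sup>2)"
      by (rule smooth_in_continuous_on[OF c])
    from volume_integral_chart[OF c cb dv this]
    have "bienergy A g dv ?K (F t) =
        1 / 2 * integral (cbox a b) (\<lambda>u. ?vol (coord_inv c u) * (norm (tension A g (F t) (coord_inv c u)))\<^sup>2)"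
      by (simp add: bienergy_def)
    also have "integral (cbox a b) (\<lambda>u. ?vol (coord_inv c u) * (norm (tension A g (F t) (coord_inv c u)))\<^sup>2) =
        integral (cbox a b) (\<lambda>u. ?f (t, u))"
      using cb chart_open_coord_inv[OF ch] by (intro integral_cong) (simp add: n Q_def subset_iff)
    finally show ?thesis .
  qed
  let ?f' = "\<lambda>t u. frechet_derivative ?f (at (t, u)) (1, 0)"
  have der: "((\<lambda>t. ?f (t, u)) has_real_derivative ?f' t u) (at t)" if "t \<in> ?I" "u \<in> cbox a b" for t u
  proof -
    have "(?f has_derivative frechet_derivative ?f (at (t, u))) (at (t, u))"
      by (rule smooth_on_imp_has_derivative[OF jf]) (use that cb in auto)
    then show ?thesis
      using has_real_derivative_along_line[of ?f _ "(0, u)" t "(1, 0)"] by simp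
  qed
  have "((\<lambda>t. integral (cbox a b) (\<lambda>u. ?f (t, u))) has_field_derivative integral (cbox a b) (?f' 0)) (at 0 within ?I)"
  proof (rule leibniz_rule_field_derivative)
    show "((\<lambda>t. ?f (t, u)) has_field_derivative ?f' t u) (at t within ?I)" if "t \<in> ?I" "u \<in> cbox a b" for t u
      by (rule has_field_derivative_at_within[OF der[OF that]])
    show "(\<lambda>u. ?f (t, u)) integrable_on cbox a b" if t: "t \<in> ?I" for t
    proof (rule integrable_continuous)
      show "continuous_on (cbox a b) (\<lambda>u. ?f (t, u))"
        by (rule continuous_on_compose2[OF smooth_on_imp_continuous_on[OF jf], where f = "\<lambda>u. (t, u)"])
          (use t cb in \<open>auto intro!: continuous_intros\<close>)
    qed
    have "continuous_on (?I \<times> img_of c) (\<lambda>z. frechet_derivative ?f (at z) (1, 0))"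
      by (rule smooth_on_imp_continuous_on[OF smooth_on_frechet_derivative[OF jf]])
    then show "continuous_on (?I \<times> cbox a b) (\<lambda>(t, u). ?f' t u)"
      using cb by (auto simp: case_prod_beta intro: continuous_on_subset)
  qed auto
  then have "((\<lambda>t. integral (cbox a b) (\<lambda>u. ?f (t, u))) has_field_derivative integral (cbox a b) (?f' 0)) (at 0)"
    using at_within_open[of 0 ?I] by simp
  from DERIV_cmult[OF this, of "1/2"]
  have "((\<lambda>t. bienergy A g dv ?K (F t)) has_real_derivative 1 / 2 * integral (cbox a b) (?f' 0)) (at 0)"
    by (rule has_field_derivative_transform_within_open[where S = ?I]) (auto simp: energy)
  with crit have int0: "integral (cbox a b) (?f' 0) = 0"
    using DERIV_unique by fastforce
  let ?LV = "chart_laplacian g c V" and ?L\<tau> = "chart_laplacian g c \<tau>"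
  have f'0: "?f' 0 u = ?vol (coord_inv c u) * (4 * (\<tau> (coord_inv c u) \<bullet> ?LV (coord_inv c u)) +
      4 * ?m * (\<tau> (coord_inv c u) \<bullet> V (coord_inv c u)))" if u: "u \<in> cbox a b" for u
  proof -
    let ?q = "coord_inv c u"
    have ui: "u \<in> img_of c" using u cb by blast
    have q: "?q \<in> dom_of c" by (rule chart_open_coord_inv[OF ch ui])
    let ?C = "\<lambda>t. chart_laplacian g c (R t) ?q"
    \<comment> \<open>For \<open>R t\<close> and its Laplacian the mere existence of a derivative in
      t suffices: both carry the factor t^2, so that derivative does not enter the result at t =
      0.\<close>
    have along: "\<exists>D. ((\<lambda>t. G (t, u)) has_vector_derivative D) (at 0)"
      if "smooth_on (?I \<times> img_of c) G" for G :: "real \<times> (real ^ 'm) \<Rightarrow> 'e"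
    proof -
      have 1: "(G has_derivative frechet_derivative G (at (0, u))) (at (0, u))"
        by (rule smooth_on_imp_has_derivative[OF that]) (use ui in auto)
      have 2: "((\<lambda>t. (t, u)) has_derivative (\<lambda>h. (h, 0))) (at (0::real))"
        by (auto intro!: derivative_eq_intros)
      from has_derivative_compose[OF 2 1]
      have "((\<lambda>t. G (t, u)) has_derivative (\<lambda>h. frechet_derivative G (at (0, u)) (h, 0))) (at 0)" .
      then have "(\<lambda>t. G (t, u)) differentiable (at 0)" by (rule differentiableI)
      then show ?thesis
        using vector_derivative_works by blast
    qed
    obtain C' where C': "(?C has_vector_derivative C') (at 0)"
      using along[OF smooth_family_chart_laplacian[OF c _ jR[OF c]]] by auto
    obtain R' where R': "((\<lambda>t. R t ?q) has_vector_derivative R') (at 0)"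
      using along[OF jR[OF c]] by auto
    have Lt: "?L t u = chart_laplacian g c \<phi> ?q + ((2 * t) *\<^sub>R ?LV ?q + t\<^sup>2 *\<^sub>R ?C t)" if t: "t \<in> ?I" for t
    proof -
      note sV = smooth_mapD[OF smV c] and sP = smooth_mapD[OF sm\<phi> c]
      have sR: "smooth_in c (dom_of c) (R t)"
        by (rule smooth_family_slice[OF chart_openD[OF ch] _ jR[OF c] t]) simp
      have bl: "bounded_linear (\<lambda>x::'e. k *\<^sub>R x)" for k by (rule bounded_linear_scaleR_right)
      have s1: "smooth_in c (dom_of c) (\<lambda>q. (2 * t) *\<^sub>R V q)" "smooth_in c (dom_of c) (\<lambda>q. t\<^sup>2 *\<^sub>R R t q)"
        by (rule smooth_in_bounded_linear[OF bl ch sV] smooth_in_bounded_linear[OF bl ch sR])+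
      show ?thesis
        unfolding F_def[abs_def] chart_laplacian_add[OF ch sP smooth_in_add[OF ch s1] q]
          chart_laplacian_add[OF ch s1 q]
          chart_laplacian_bounded_linear[OF bl ch sV q] chart_laplacian_bounded_linear[OF bl ch sR q] ..
    qed
    let ?\<Lambda> = "\<lambda>t. chart_laplacian g c \<phi> ?q + ((2 * t) *\<^sub>R ?LV ?q + t\<^sup>2 *\<^sub>R ?C t)"
    have d\<Lambda>: "(?\<Lambda> has_vector_derivative 2 *\<^sub>R ?LV ?q) (at 0)"
      using C' by (auto intro!: derivative_eq_intros)
    have dF: "((\<lambda>t. F t ?q) has_vector_derivative 2 *\<^sub>R V ?q) (at 0)"
      unfolding F_def using R' by (auto intro!: derivative_eq_intros)
    note in1 = bounded_bilinear.has_vector_derivative[OF bounded_bilinear_inner d\<Lambda> d\<Lambda>]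
    note in2 = bounded_bilinear.has_vector_derivative[OF bounded_bilinear_inner d\<Lambda> dF]
    let ?P = "chart_laplacian g c \<phi> ?q"
    have P: "?P = \<tau> ?q - ?m *\<^sub>R \<phi> ?q"
      by (simp add: \<tau> laplacian_vec_eq[OF sm\<phi> c q])
    have F0: "F 0 ?q = \<phi> ?q" by (simp add: F_def)
    have dQ: "((\<lambda>t. ?\<Lambda> t \<bullet> ?\<Lambda> t - (?\<Lambda> t \<bullet> F t ?q)\<^sup>2) has_real_derivative
        (?P \<bullet> (2 *\<^sub>R ?LV ?q) + (2 *\<^sub>R ?LV ?q) \<bullet> ?P) -
        2 * (?P \<bullet> \<phi> ?q) * (?P \<bullet> (2 *\<^sub>R V ?q) + (2 *\<^sub>R ?LV ?q) \<bullet> \<phi> ?q)) (at 0)"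
      using in1 in2 F0
      by (auto intro!: derivative_eq_intros simp flip: has_real_derivative_iff_has_vector_derivative)
    have "((\<lambda>t. ?vol ?q * (?\<Lambda> t \<bullet> ?\<Lambda> t - (?\<Lambda> t \<bullet> F t ?q)\<^sup>2)) has_real_derivative
        ?vol ?q * ((?P \<bullet> (2 *\<^sub>R ?LV ?q) + (2 *\<^sub>R ?LV ?q) \<bullet> ?P) -
        2 * (?P \<bullet> \<phi> ?q) * (?P \<bullet> (2 *\<^sub>R V ?q) + (2 *\<^sub>R ?LV ?q) \<bullet> \<phi> ?q))) (at 0)"
      by (rule DERIV_cmult[OF dQ])
    then have D: "((\<lambda>t. ?f (t, u)) has_real_derivative
        ?vol ?q * ((?P \<bullet> (2 *\<^sub>R ?LV ?q) + (2 *\<^sub>R ?LV ?q) \<bullet> ?P) -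
        2 * (?P \<bullet> \<phi> ?q) * (?P \<bullet> (2 *\<^sub>R V ?q) + (2 *\<^sub>R ?LV ?q) \<bullet> \<phi> ?q))) (at 0)"
      by (rule has_field_derivative_transform_within_open[where S = ?I]) (auto simp: Q_def Lt)
    have "?f' 0 u = ?vol ?q * ((?P \<bullet> (2 *\<^sub>R ?LV ?q) + (2 *\<^sub>R ?LV ?q) \<bullet> ?P) -
        2 * (?P \<bullet> \<phi> ?q) * (?P \<bullet> (2 *\<^sub>R V ?q) + (2 *\<^sub>R ?LV ?q) \<bullet> \<phi> ?q))"
      by (rule DERIV_unique[OF der[OF _ u] D]) simp
    \<comment> \<open>With ?P = \<tau> - m \<phi> one has ?P \<bullet> \<phi> = -m, and the terms
      that contain \<phi> \<bullet> \<Delta>V cancel.\<close>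
    also have "\<dots> = ?vol ?q * (4 * (\<tau> ?q \<bullet> ?LV ?q) + 4 * ?m * (\<tau> ?q \<bullet> V ?q))"
    proof -
      have "\<phi> ?q \<bullet> \<tau> ?q = 0" "\<phi> ?q \<bullet> V ?q = 0" using \<tau>_normal V\<phi> by (simp_all add: inner_commute)
      then show ?thesis
        unfolding P inner_commute[of "2 *\<^sub>R ?LV ?q"]
        by (simp add: inner_diff_left inner_diff_right \<tau>_normal \<phi>1 algebra_simps)
    qed
    finally show ?thesis .
  qed
  have sm\<tau>: "smooth_in c (dom_of c) \<tau>"
  proof -
    have "smooth_in c (dom_of c) (\<lambda>q. laplacian_vec A g \<phi> q + ?m *\<^sub>R \<phi> q)"
      by (rule smooth_in_add[OF ch smooth_mapD[OF smooth_map_laplacian_vec[OF sm\<phi>] c]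
            smooth_in_bounded_linear[OF bounded_linear_scaleR_right ch smooth_mapD[OF sm\<phi> c]]])
    then show ?thesis by (simp add: \<tau>[abs_def])
  qed
  note sV = smooth_mapD[OF smV c]
  have zero: "V (coord_inv c u) = 0" if "u \<in> img_of c" "u \<notin> cbox a b" for u
    using that coord_coord_inv[OF ch that(1)] chart_open_coord_inv[OF ch that(1)] by (simp add: V_def \<beta>(2))
  \<comment> \<open>The derivative of the energy integrand is 4 (\<open>?g1\<close> +
    \<open>?g2\<close>): \<open>?g1\<close> integrates to zero by Green's formula, and in
    \<open>?g2\<close> the Laplacian falls on \<tau>.\<close>
  let ?g1 = "\<lambda>u. ?vol (coord_inv c u) * (\<tau> (coord_inv c u) \<bullet> ?LV (coord_inv c u) - V (coord_inv c u) \<bullet> ?L\<tau> (coord_inv c u))"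
  let ?g2 = "\<lambda>u. ?vol (coord_inv c u) * ((?L\<tau> (coord_inv c u) + ?m *\<^sub>R \<tau> (coord_inv c u)) \<bullet> V (coord_inv c u))"
  have i1: "?g1 integrable_on cbox a b"
    by (intro integrable_continuous smooth_in_continuous_on_cbox[OF c cb, where
          k = "\<lambda>q. ?vol q * (\<tau> q \<bullet> ?LV q - V q \<bullet> ?L\<tau> q)"]
        smooth_in_mult smooth_in_diff smooth_in_inner smooth_in_chart_laplacian smooth_volume_density ch c sm\<tau> sV)
  have i2: "?g2 integrable_on cbox a b"
    by (intro integrable_continuous smooth_in_continuous_on_cbox[OF c cb, where
          k = "\<lambda>q. ?vol q * ((?L\<tau> q + ?m *\<^sub>R \<tau> q) \<bullet> V q)"]
        smooth_in_mult smooth_in_add smooth_in_scaleR smooth_in_const smooth_in_inner smooth_in_chart_laplacian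
        smooth_volume_density ch c sm\<tau> sV)
  have "integral (cbox a b) (?f' 0) = integral (cbox a b) (\<lambda>u. 4 * (?g1 u + ?g2 u))"
    by (rule integral_cong, subst f'0) (simp_all add: inner_add_left inner_commute algebra_simps)
  also have "\<dots> = 4 * (integral (cbox a b) ?g1 + integral (cbox a b) ?g2)"
    by (simp only: integral_mult_right integral_add[OF i1 i2])
  also have "integral (cbox a b) ?g1 = 0"
    by (rule green[OF c cb sm\<tau> sV zero])
  finally have "integral (cbox a b) ?g2 = 0" using int0 by simp
  moreover have "integral (cbox a b) ?g2 = integral (cbox a b) (\<lambda>u. ?vol (coord_inv c u) * (\<beta> u *
    ((?L\<tau> (coord_inv c u) + ?m *\<^sub>R \<tau> (coord_inv c u)) \<bullet> W (coord_inv c u))))"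
  proof (rule integral_cong)
    fix u assume "u \<in> cbox a b"
    then have ui: "u \<in> img_of c" using cb by blast
    then show "?g2 u = ?vol (coord_inv c u) * (\<beta> u *
      ((?L\<tau> (coord_inv c u) + ?m *\<^sub>R \<tau> (coord_inv c u)) \<bullet> W (coord_inv c u)))"
      using coord_coord_inv[OF ch ui] chart_open_coord_inv[OF ch ui] by (simp add: V_def)
  qed
  ultimately show ?thesis by simp
qed

end

section \<open>Immersions into the unit sphere\<close>

text \<open>The reflection in the hyperplane orthogonal to e - v. It is an involution, so it is its
  own inverse and exchanges the two vectors.\<close>

lemma exists_reflection:
  fixes e v :: "'e::euclidean_space"
  assumes "norm e = 1" "norm v = 1"
  obtains T where "orthogonal_transformation T" "T e = v" "T v = e" "\<And>x. T (T x) = x"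
proof -
  define n where "n = e - v"
  \<comment> \<open>For e = v the normal \<open>n\<close> is zero and the formula gives the
    identity, hence the case distinctions below.\<close>
  let ?T = "\<lambda>x. x - (2 * (x \<bullet> n) / (n \<bullet> n)) *\<^sub>R n"
  have u: "e \<bullet> e = 1" "v \<bullet> v = 1" using assms by (simp_all add: norm_eq_1)
  have n: "n \<bullet> n = 2 * (e \<bullet> n)" "n \<bullet> n = - 2 * (v \<bullet> n)"
    by (simp_all add: n_def inner_diff_left inner_diff_right u inner_commute[of v e])
  have 1: "?T e = v"
  proof (cases "n = 0")
    case False
    then have "2 * (e \<bullet> n) / (n \<bullet> n) = 1" unfolding n(1)[symmetric] by simp
    then show ?thesis by (simp only: scaleR_one) (simp add: n_def)
  qed (simp add: n_def)
  have 2: "?T v = e"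
  proof (cases "n = 0")
    case False
    have "2 * (v \<bullet> n) = - (n \<bullet> n)" using n(2) by simp
    then have "2 * (v \<bullet> n) / (n \<bullet> n) = - 1" using False by (simp only:) simp
    then show ?thesis by (simp only: scaleR_minus_left scaleR_one) (simp add: n_def)
  qed (simp add: n_def)
  have 3: "?T (?T x) = x" for x
  proof (cases "n = 0")
    case False
    then have "?T x \<bullet> n = - (x \<bullet> n)" by (simp add: inner_diff_left)
    then show ?thesis by simp
  qed simp
  have "linear ?T"
    by (rule linearI) (simp_all add: inner_add_left algebra_simps add_divide_distrib)
  moreover have "?T x \<bullet> ?T y = x \<bullet> y" for x y
  proof (cases "n = 0")
    case False
    have "(x - k *\<^sub>R n) \<bullet> (y - l *\<^sub>R n) = x \<bullet> y - l * (x \<bullet> n) - k * (y \<bullet> n) + k * l * (n \<bullet> n)" for k l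
      by (simp add: inner_diff_left inner_diff_right inner_commute[of n y] algebra_simps)
    then show ?thesis using False by (simp add: algebra_simps)
  qed simp
  ultimately have "orthogonal_transformation ?T" by (simp add: orthogonal_transformation_def)
  then show thesis using 1 2 3 by (rule that)
qed

context riemannian_manifold
begin

lemma smooth_map_bounded_linear:
  "bounded_linear l \<Longrightarrow> smooth_map A f \<Longrightarrow> smooth_map A (\<lambda>q. l (f q))"
  by (rule smooth_mapI, rule smooth_in_bounded_linear[OF _ chart_dom smooth_mapD])

lemma smooth_map_add:
  "smooth_map A f \<Longrightarrow> smooth_map A h \<Longrightarrow> smooth_map A (\<lambda>q. f q + h q)"
  by (rule smooth_mapI, rule smooth_in_add[OF chart_dom smooth_mapD smooth_mapD])

text \<open>In a chart the differential vanishes on a ball, which makes f locally constant;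
  connectedness does the rest.\<close>

lemma constant_if_pd_eq_0:
  fixes f :: "'a \<Rightarrow> 'f::euclidean_space"
  assumes "connected (UNIV :: 'a set)" "smooth_map A f"
    and "\<And>c p i. c \<in> A \<Longrightarrow> p \<in> dom_of c \<Longrightarrow> pd c i f p = 0"
  obtains k where "\<And>q. f q = k"
proof -
  have "f constant_on UNIV"
  proof (rule locally_constant_imp_constant[OF assms(1)])
    fix p :: 'a
    let ?c = "chart_at A p"
    note c = chart_at(1)[of p] chart_at(2)[of p] and ch = chart_dom[OF chart_at(1)[of p]]
    obtain r where r: "r > 0" "ball (coord ?c p) r \<subseteq> img_of ?c"
      using chart_openD[OF ch] c(2) by (meson imageI open_contains_ball)
    have zero: "((f \<circ> coord_inv ?c) has_derivative (\<lambda>h. 0)) (at u)" if u: "u \<in> img_of ?c" for u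
    proof -
      let ?D = "frechet_derivative (f \<circ> coord_inv ?c) (at u)"
      have D: "((f \<circ> coord_inv ?c) has_derivative ?D) (at u)"
        using smooth_on_imp_has_derivative[OF smooth_mapD[OF assms(2) c(1), unfolded smooth_in_def] u] .
      have "?D (axis i 1) = 0" for i
        using assms(3)[OF c(1) chart_open_coord_inv[OF ch u], of i] by (simp only: pd_coord_inv[OF ch u])
      then have "?D (\<Sum>i\<in>UNIV. v $ i *\<^sub>R axis i 1) = 0" for v
        using has_derivative_linear[OF D] by (simp add: linear_sum linear_scale)
      moreover have "(\<Sum>i\<in>UNIV. v $ i *\<^sub>R axis i 1) = v" for v :: "real ^ 'm"
        using basis_expansion[of v] by (simp add: scalar_mult_eq_scaleR)
      ultimately have "?D = (\<lambda>h. 0)" by (simp add: fun_eq_iff)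
      with D show ?thesis by simp
    qed
    have "\<exists>k. \<forall>u\<in>ball (coord ?c p) r. (f \<circ> coord_inv ?c) u = k"
      by (rule has_derivative_zero_constant[OF convex_ball has_derivative_at_withinI[OF zero]])
        (use r(2) in blast)
    then obtain k where k: "\<And>u. u \<in> ball (coord ?c p) r \<Longrightarrow> f (coord_inv ?c u) = k" by auto
    let ?T = "dom_of ?c \<inter> coord ?c -` ball (coord ?c p) r"
    have "open ?T"
      by (rule continuous_open_preimage[OF continuous_coord[OF c(1)] open_dom[OF c(1)] open_ball])
    moreover have "f q = k" if "q \<in> ?T" for q
      using k[of "coord ?c q"] that coord_inv_coord[OF ch, of q] by simp
    ultimately show "\<exists>T. openin (top_of_set UNIV) T \<and> p \<in> T \<and> (\<forall>x\<in>T. f x = f p)"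
      using c(2) r(1) by (intro exI[of _ ?T]) (simp add: open_openin[symmetric])
  qed
  then show thesis using that by (auto simp: constant_on_def)
qed

text \<open>Apply \<open>\<Delta>\<close> to \<open>\<langle>f, f\<rangle>\<close>, which is constant.\<close>

lemma pd_eq_0_if_harmonic_const_norm:
  fixes f :: "'a \<Rightarrow> 'f::euclidean_space"
  assumes "c \<in> A" "p \<in> dom_of c" "smooth_in c (dom_of c) f" "\<And>q. f q \<bullet> f q = k"
    and "chart_laplacian g c f p = 0"
  shows "pd c i f p = 0"
proof (rule euclidean_eqI)
  fix b :: 'f assume b: "b \<in> Basis"
  \<comment> \<open>One summand for each coordinate of the target: the form of the inverse metric at
    the derivatives of that coordinate. All are nonnegative and their sum vanishes, so each is zero,
    and definiteness applies.\<close>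
  let ?s = "\<lambda>b. \<Sum>i\<in>UNIV. \<Sum>j\<in>UNIV. ginv g c p i j * ((pd c i f p \<bullet> b) * (pd c j f p \<bullet> b))"
  have "(\<Sum>b\<in>Basis. ?s b) = (\<Sum>i\<in>UNIV. \<Sum>j\<in>UNIV. ginv g c p i j * (pd c i f p \<bullet> pd c j f p))"
  proof -
    have "(\<Sum>b\<in>Basis. ?s b) = (\<Sum>i\<in>UNIV. \<Sum>j\<in>UNIV. \<Sum>b\<in>Basis. ginv g c p i j * ((pd c i f p \<bullet> b) * (pd c j f p \<bullet> b)))"
      by (rule sum_swap21[symmetric])
    then show ?thesis
      by (simp only: sum_distrib_left[symmetric] euclidean_inner[symmetric])
  qed
  also have "\<dots> = 0"
    using chart_laplacian_inner_const[OF assms(1-3) assms(3,4)] assms(5) by simp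
  finally have "?s b = 0"
    using b ginv_nonneg[OF assms(1,2)] by (subst (asm) sum_nonneg_eq_0_iff) auto
  then show "pd c i f p \<bullet> b = 0 \<bullet> b"
    using ginv_definite[OF assms(1,2)] by simp
qed

end

locale spherical_immersion = isometrically_immersed A g \<phi>
  for A :: "('a::{second_countable_topology, t2_space}, 'm::finite) chart set"
    and g :: "('a, 'm) metric"
    and \<phi> :: "'a \<Rightarrow> 'e::euclidean_space" +
  assumes sphere: "range \<phi> \<subseteq> sphere 0 1"
begin

definition \<tau> :: "'a \<Rightarrow> 'e" where
  "\<tau> q = laplacian_vec A g \<phi> q + real CARD('m) *\<^sub>R \<phi> q"

lemma smooth_map_immersion: "smooth_map A \<phi>"
  using immersion by (simp add: isometric_immersion_def)

lemma inner_immersion: "\<phi> q \<bullet> \<phi> q = 1"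
  using sphere by (auto simp: image_subset_iff simp flip: power2_norm_eq_inner)

lemma smooth_map_tension: "smooth_map A \<tau>"
  unfolding \<tau>_def[abs_def]
  by (intro smooth_map_add smooth_map_laplacian_vec smooth_map_immersion
      smooth_map_bounded_linear[OF bounded_linear_scaleR_right])

lemma laplacian_immersion: "laplacian_vec A g \<phi> q = \<tau> q - real CARD('m) *\<^sub>R \<phi> q"
  by (simp add: \<tau>_def)

text \<open>\<langle>\<phi>, \<phi>\<rangle> is constant, and the trace of the first derivatives is
  the inverse metric contracted with the metric, which is m.\<close>

lemma laplacian_inner_immersion: "laplacian_vec A g \<phi> q \<bullet> \<phi> q = - real CARD('m)"
proof -
  let ?c = "chart_at A q"
  note c = chart_at(1)[of q] chart_at(2)[of q]
  note s = smooth_immersion[OF c(1)]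
  have "(\<Sum>i\<in>UNIV. \<Sum>j\<in>UNIV. ginv g ?c q i j * (pd ?c i \<phi> q \<bullet> pd ?c j \<phi> q)) =
      (\<Sum>i\<in>UNIV. \<Sum>j\<in>UNIV. ginv g ?c q i j * g ?c q $ j $ i)"
    by (simp add: gram[OF c] metric_sym[OF c])
  then show ?thesis
    using chart_laplacian_inner_const[OF c s s inner_immersion]
    by (simp add: ginv_metric(1)[OF c] laplacian_vec_eq[OF smooth_map_immersion c] inner_commute)
qed

lemma tension_normal: "\<tau> q \<bullet> \<phi> q = 0"
  by (simp add: \<tau>_def inner_add_left laplacian_inner_immersion inner_immersion)

lemma mean_curvature_tension: "mean_curvature A g \<phi> q = (1 / real CARD('m)) *\<^sub>R \<tau> q"
  by (simp add: mean_curvature_eq[OF sphere] sphere_tan_def laplacian_inner_immersion inner_immersion \<tau>_def)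

text \<open>Constancy of \<langle>\<tau>, \<phi>\<rangle> gives \<langle>\<Delta>\<tau>,
  \<phi>\<rangle> + \<langle>\<tau>, \<Delta>\<phi>\<rangle> = -2 tr \<langle>d\<tau>,
  d\<phi>\<rangle>. Differentiating the orthogonality of \<tau> to the coordinate vectors shows that
  this trace is -\<langle>\<tau>, \<Delta>\<phi>\<rangle>, and \<langle>\<tau>,
  \<Delta>\<phi>\<rangle> = |\<tau>|^2.\<close>

lemma laplacian_tension_inner: "laplacian_vec A g \<tau> q \<bullet> \<phi> q = \<tau> q \<bullet> \<tau> q"
proof -
  let ?c = "chart_at A q"
  note c = chart_at(1)[of q] chart_at(2)[of q]
  note ch = chart_dom[OF c(1)] and s = smooth_immersion[OF c(1)] and st = smooth_mapD[OF smooth_map_tension c(1)]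
  have orth: "\<tau> p \<bullet> pd ?c j \<phi> p = 0" if p: "p \<in> dom_of ?c" for p j
  proof -
    have "pd ?c j \<phi> p \<bullet> \<phi> p = 0" by (rule pd_orthogonal_sphere[OF smooth_map_immersion sphere c(1) p])
    then show ?thesis
      using chart_laplacian_orthogonal[OF c(1) p, of j]
      by (simp add: \<tau>_def laplacian_vec_eq[OF smooth_map_immersion c(1) p] inner_add_left
          inner_commute[of "\<phi> p"])
  qed
  have "pd ?c i \<tau> q \<bullet> pd ?c j \<phi> q = - (\<tau> q \<bullet> pd ?c i (pd ?c j \<phi>) q)" for i j
  proof -
    have "0 = pd ?c i (\<lambda>q. 0 :: real) q" by (simp add: pd_const)
    also have "\<dots> = pd ?c i (\<lambda>q. \<tau> q \<bullet> pd ?c j \<phi> q) q"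
      by (rule pd_cong[OF ch smooth_in_const c(2)]) (simp add: orth)
    also have "\<dots> = \<tau> q \<bullet> pd ?c i (pd ?c j \<phi>) q + pd ?c i \<tau> q \<bullet> pd ?c j \<phi> q"
      by (rule pd_inner[OF ch st smooth_in_pd[OF ch s] c(2)])
    finally show ?thesis by simp
  qed
  then have "(\<Sum>i\<in>UNIV. \<Sum>j\<in>UNIV. ginv g ?c q i j * (pd ?c i \<tau> q \<bullet> pd ?c j \<phi> q)) = - (\<tau> q \<bullet> trace_hess g ?c \<phi> q)"
    by (simp add: trace_hess_def inner_sum_right sum_negf)
  also have "\<tau> q \<bullet> trace_hess g ?c \<phi> q = \<tau> q \<bullet> chart_laplacian g ?c \<phi> q"
    by (simp add: chart_laplacian_eq[OF c] inner_diff_right inner_sum_right orth[OF c(2)])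
  also have "chart_laplacian g ?c \<phi> q = \<tau> q - real CARD('m) *\<^sub>R \<phi> q"
    by (simp add: laplacian_immersion flip: laplacian_vec_eq[OF smooth_map_immersion c])
  finally have "(\<Sum>i\<in>UNIV. \<Sum>j\<in>UNIV. ginv g ?c q i j * (pd ?c i \<tau> q \<bullet> pd ?c j \<phi> q)) = - (\<tau> q \<bullet> \<tau> q)"
    by (simp add: inner_diff_right tension_normal)
  moreover have "\<tau> q \<bullet> chart_laplacian g ?c \<phi> q = \<tau> q \<bullet> \<tau> q"
    by (simp add: laplacian_immersion inner_diff_right tension_normal
        flip: laplacian_vec_eq[OF smooth_map_immersion c])
  ultimately show ?thesis
    using chart_laplacian_inner_const[OF c st s tension_normal]
    by (simp add: laplacian_vec_eq[OF smooth_map_tension c])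
qed

section \<open>Consequences of the equation for the bilaplacian\<close>

context
  fixes \<mu> :: "'a \<Rightarrow> real"
  assumes bilaplacian: "\<And>p. laplacian_vec A g (laplacian_vec A g \<phi>) p = - \<mu> p *\<^sub>R laplacian_vec A g \<phi> p"
begin

lemma laplacian_tension:
  "laplacian_vec A g \<tau> q = (real CARD('m) - \<mu> q) *\<^sub>R (\<tau> q - real CARD('m) *\<^sub>R \<phi> q)"
proof -
  let ?c = "chart_at A q" and ?m = "real CARD('m)"
  note c = chart_at(1)[of q] chart_at(2)[of q]
  note ch = chart_dom[OF c(1)] and s = smooth_immersion[OF c(1)]
  note sl = smooth_map_laplacian_vec[OF smooth_map_immersion]
  have "laplacian_vec A g \<tau> q = chart_laplacian g ?c (\<lambda>q. laplacian_vec A g \<phi> q + ?m *\<^sub>R \<phi> q) q"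
    unfolding laplacian_vec_eq[OF smooth_map_tension c] by (simp add: \<tau>_def[abs_def])
  also have "\<dots> = chart_laplacian g ?c (laplacian_vec A g \<phi>) q + ?m *\<^sub>R chart_laplacian g ?c \<phi> q"
    unfolding chart_laplacian_add[OF ch smooth_mapD[OF sl c(1)]
        smooth_in_bounded_linear[OF bounded_linear_scaleR_right ch s] c(2)]
      chart_laplacian_bounded_linear[OF bounded_linear_scaleR_right ch s c(2)] ..
  also have "\<dots> = laplacian_vec A g (laplacian_vec A g \<phi>) q + ?m *\<^sub>R laplacian_vec A g \<phi> q"
    by (simp only: laplacian_vec_eq[OF sl c] laplacian_vec_eq[OF smooth_map_immersion c])
  also have "\<dots> = (?m - \<mu> q) *\<^sub>R laplacian_vec A g \<phi> q"
    by (simp add: bilaplacian scaleR_diff_left)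
  finally show ?thesis by (simp only: laplacian_immersion)
qed

text \<open>Compares the components along \<phi> in \<open>laplacian_tension\<close> and
  \<open>laplacian_tension_inner\<close>. The function \<mu> comes without any regularity; this
  expresses it through the smooth function |\<tau>|^2.\<close>

lemma norm_tension_squared: "\<tau> q \<bullet> \<tau> q = real CARD('m) * (\<mu> q - real CARD('m))"
  using laplacian_tension_inner[of q]
  by (simp add: laplacian_tension inner_diff_left tension_normal inner_immersion algebra_simps)

text \<open>By the equation for \<open>\<Delta>\<^sup>2 \<phi>\<close> the bitension field is pointwise proportional to \<open>\<tau>\<close>,
  so variations in the direction of \<open>\<tau>\<close> suffice.\<close>

lemma tension_dichotomy:
  assumes "biharmonic A g 1 \<phi>"
  shows "\<tau> q \<bullet> \<tau> q \<in> {0, (real CARD('m))\<^sup>2}"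
proof -
  let ?c = "chart_at A q" and ?m = "real CARD('m)"
  note c = chart_at(1)[of q] chart_at(2)[of q]
  note ch = chart_dom[OF c(1)]
  let ?u = "coord ?c q"
  have q: "coord_inv ?c ?u = q" by (rule coord_inv_coord[OF ch c(2)])
  have u: "?u \<in> img_of ?c" using c(2) by blast
  obtain a b where ab: "cbox a b \<subseteq> img_of ?c" "?u \<in> box a b" "\<forall>i\<in>Basis. a \<bullet> i < b \<bullet> i"
    by (rule open_contains_cbox[OF chart_openD[OF ch] u])
  obtain r where r: "r > 0" "ball ?u r \<subseteq> box a b"
    using open_box[of a b] ab(2) unfolding open_contains_ball by blast
  obtain \<beta> :: "real ^ 'm \<Rightarrow> real" where \<beta>: "smooth_on UNIV \<beta>" "\<forall>u. \<beta> u \<ge> 0" "\<forall>u. u \<notin> ball ?u r \<longrightarrow> \<beta> u = 0" "\<beta> ?u > 0"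
    using bump_function[OF r(1), of ?u] by blast
  have \<beta>0: "\<beta> u = 0" if "u \<notin> cbox a b" for u
    by (rule \<beta>(3)[rule_format]) (use that r(2) box_subset_cbox[of a b] in blast)
  \<comment> \<open>Equal to m (2 m - \<mu>), but written through |\<tau>|^2 and thus visibly
    smooth. As a weight on \<tau> it supplies the second factor of the square that makes the
    integrand nonnegative.\<close>
  let ?s = "\<lambda>q. ?m\<^sup>2 - \<tau> q \<bullet> \<tau> q"
  let ?W = "\<lambda>q. ?s q *\<^sub>R \<tau> q"
  have ss: "smooth_in d (dom_of d) ?s" if "d \<in> A" for d
    by (intro smooth_in_diff smooth_in_const smooth_in_inner chart_dom smooth_mapD[OF smooth_map_tension] that)
  have sW: "smooth_map A ?W"
    by (rule smooth_mapI, intro smooth_in_scaleR ss chart_dom smooth_mapD[OF smooth_map_tension])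
  let ?vol = "volume_density ?c"
  let ?h = "\<lambda>p. ?vol p * ((?s p)\<^sup>2 * (\<tau> p \<bullet> \<tau> p) / ?m)"
  have *: "integral (cbox a b) (\<lambda>u. ?vol (coord_inv ?c u) * (\<beta> u *
    ((chart_laplacian g ?c \<tau> (coord_inv ?c u) + ?m *\<^sub>R \<tau> (coord_inv ?c u)) \<bullet> ?W (coord_inv ?c u)))) = 0"
    by (rule first_variation[OF sphere assms sW _ c(1) ab(1) \<beta>(1) \<beta>0 \<tau>_def tension_normal])
      (simp add: tension_normal)
  have dom: "coord_inv ?c u \<in> dom_of ?c" if "u \<in> cbox a b" for u
    using that ab(1) chart_open_coord_inv[OF ch] by blast
  have eq: "(chart_laplacian g ?c \<tau> p + ?m *\<^sub>R \<tau> p) \<bullet> ?W p = (?s p)\<^sup>2 * (\<tau> p \<bullet> \<tau> p) / ?m"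
    if p: "p \<in> dom_of ?c" for p
  proof -
    have "\<phi> p \<bullet> \<tau> p = 0" using tension_normal by (simp add: inner_commute)
    then have "(chart_laplacian g ?c \<tau> p + ?m *\<^sub>R \<tau> p) \<bullet> ?W p = ?s p * ((2 * ?m - \<mu> p) * (\<tau> p \<bullet> \<tau> p))"
      unfolding laplacian_vec_eq[OF smooth_map_tension c(1) p, symmetric] laplacian_tension
      by (simp add: inner_add_left inner_diff_left) (simp add: algebra_simps)
    moreover have "2 * ?m - \<mu> p = ?s p / ?m"
      by (simp add: norm_tension_squared field_simps power2_eq_square)
    ultimately show ?thesis by (simp add: power2_eq_square)
  qed
  have "integral (cbox a b) (\<lambda>u. \<beta> u * ?h (coord_inv ?c u)) = 0"
    using * dom by (subst integral_cong[where g = "\<lambda>u. ?vol (coord_inv ?c u) * (\<beta> u *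
      ((chart_laplacian g ?c \<tau> (coord_inv ?c u) + ?m *\<^sub>R \<tau> (coord_inv ?c u)) \<bullet> ?W (coord_inv ?c u)))"])
      (simp_all only: eq mult_ac)
  moreover have "continuous_on (cbox a b) (\<lambda>u. \<beta> u * ?h (coord_inv ?c u))"
  proof (rule continuous_on_mult)
    show "continuous_on (cbox a b) \<beta>"
      using smooth_on_imp_continuous_on[OF \<beta>(1)] continuous_on_subset by blast
    have "smooth_in ?c (dom_of ?c) ?h"
      unfolding power2_eq_square divide_inverse
      by (intro smooth_in_mult smooth_in_diff smooth_in_const smooth_in_inner smooth_volume_density ch c(1)
          smooth_mapD[OF smooth_map_tension])
    then show "continuous_on (cbox a b) (\<lambda>u. ?h (coord_inv ?c u))"
      by (rule smooth_in_continuous_on_cbox[OF c(1) ab(1)])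
  qed
  moreover have "\<beta> u * ?h (coord_inv ?c u) \<ge> 0" if "u \<in> cbox a b" for u
    using \<beta>(2)[rule_format, of u] volume_density_pos[OF c(1) dom[OF that]] by simp
  moreover have "box a b \<noteq> {}" using ab(2) by blast
  \<comment> \<open>A continuous nonnegative function with zero integral over a box vanishes on it.
    At \<open>?u\<close> both \<beta> and the volume density are positive, which leaves the
    claim.\<close>
  ultimately have "\<forall>u\<in>cbox a b. \<beta> u * ?h (coord_inv ?c u) = 0"
    using integral_cbox_eq_0_iff by blast
  then have "\<beta> ?u * ?h q = 0" using ab(2) box_subset_cbox[of a b] q by force
  then show ?thesis using \<beta>(4) volume_density_pos[OF c] by auto
qed

end

end

text \<open>\<open>T\<close> occurs because the normal direction of the small sphere depends on
  \<phi>, while \<open>standard_immersion\<close> singles out the last coordinate. Non-minimality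
  excludes minimal immersions into the unit sphere, for which the bilaplacian equation holds with
  \<mu> = m.\<close>

theorem theorem2p4:
  fixes A :: "('a::{second_countable_topology, t2_space}, 'm::finite) chart set"
    and g :: "('a, 'm) metric"
    and \<phi> :: "'a \<Rightarrow> (real ^ 'n::finite) \<times> real"
    and \<mu> :: "'a \<Rightarrow> real"
  assumes "smooth_atlas A"
    and "connected (UNIV :: 'a set)"
    and "riemannian_metric A g"
    and "isometric_immersion A g \<phi>"
    and "\<forall>p. laplacian_vec A g (laplacian_vec A g \<phi>) p = - \<mu> p *\<^sub>R laplacian_vec A g \<phi> p"
    and "range \<phi> \<subseteq> sphere 0 1"
    and "biharmonic A g 1 \<phi>"
    and "\<not> minimal A g \<phi>"
  shows "(\<forall>p. \<mu> p = 2 * real CARD('m)) \<and>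
    (\<forall>p. norm (mean_curvature A g \<phi> p) = 1) \<and>
    (\<exists>(T :: (real ^ 'n) \<times> real \<Rightarrow> (real ^ 'n) \<times> real) (\<psi> :: 'a \<Rightarrow> real ^ 'n).
       orthogonal_transformation T \<and>
       isometric_immersion A g \<psi> \<and> range \<psi> \<subseteq> sphere 0 (1 / sqrt 2) \<and> minimal A g \<psi> \<and>
       \<phi> = T \<circ> standard_immersion \<circ> \<psi>)"
proof -
  let ?m = "real CARD('m)"
  interpret spherical_immersion A g \<phi>
    by unfold_locales (fact assms)+
  have m: "?m > 0" by simp
  have bilap: "laplacian_vec A g (laplacian_vec A g \<phi>) p = - \<mu> p *\<^sub>R laplacian_vec A g \<phi> p" for p
    using assms(5) by blast
  have conn: "connected (range (\<lambda>q. \<tau> q \<bullet> \<tau> q))"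
    by (intro connected_continuous_image continuous_on_inner smooth_map_continuous smooth_map_tension assms(2))
  have range: "range (\<lambda>q. \<tau> q \<bullet> \<tau> q) \<subseteq> {0, ?m\<^sup>2}"
    using tension_dichotomy[OF bilap assms(7)] by blast
  have "finite (range (\<lambda>q. \<tau> q \<bullet> \<tau> q))"
    by (rule finite_subset[OF range]) simp
  then obtain k where k: "range (\<lambda>q. \<tau> q \<bullet> \<tau> q) = {k}"
    unfolding connected_finite_iff_sing[OF conn] by auto
  obtain p\<^sub>0 where "mean_curvature A g \<phi> p\<^sub>0 \<noteq> 0"
    using assms(8) by (auto simp: minimal_def)
  then have nz: "\<tau> p\<^sub>0 \<bullet> \<tau> p\<^sub>0 \<noteq> 0" by (auto simp: mean_curvature_tension)
  have \<tau>k: "\<tau> q \<bullet> \<tau> q = k" for q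
    using rangeI[of "\<lambda>q. \<tau> q \<bullet> \<tau> q" q] unfolding k by simp
  have \<tau>\<tau>: "\<tau> q \<bullet> \<tau> q = ?m\<^sup>2" for q
    using tension_dichotomy[OF bilap assms(7), of p\<^sub>0] nz unfolding \<tau>k by simp
  have \<mu>: "\<mu> q = 2 * ?m" for q
    using norm_tension_squared[OF bilap, of q] m by (simp add: \<tau>\<tau> power2_eq_square)
  have mean: "norm (mean_curvature A g \<phi> q) = 1" for q
    by (simp add: mean_curvature_tension norm_eq_sqrt_inner \<tau>\<tau> power2_eq_square)

  define a where "a q = (1 / ?m) *\<^sub>R \<tau> q + \<phi> q" for q
  have sma: "smooth_map A a"
    unfolding a_def[abs_def]
    by (intro smooth_map_add smooth_map_immersion smooth_map_tension
        smooth_map_bounded_linear[OF bounded_linear_scaleR_right])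
  have \<phi>\<tau>: "\<phi> q \<bullet> \<tau> q = 0" for q using tension_normal by (simp add: inner_commute)
  have aa: "a q \<bullet> a q = 2" and a\<phi>: "\<phi> q \<bullet> a q = 1" for q
    by (simp_all add: a_def inner_add_left inner_add_right tension_normal \<phi>\<tau> inner_immersion \<tau>\<tau> power2_eq_square)
  have "chart_laplacian g c a p = 0" if c: "c \<in> A" and p: "p \<in> dom_of c" for c p
  proof -
    note ch = chart_dom[OF c] and st = smooth_mapD[OF smooth_map_tension c]
    have "chart_laplacian g c a p = (1 / ?m) *\<^sub>R laplacian_vec A g \<tau> p + laplacian_vec A g \<phi> p"
      unfolding a_def[abs_def]
        chart_laplacian_add[OF ch smooth_in_bounded_linear[OF bounded_linear_scaleR_right ch st] smooth_immersion[OF c] p]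
        chart_laplacian_bounded_linear[OF bounded_linear_scaleR_right ch st p]
        laplacian_vec_eq[OF smooth_map_tension c p] laplacian_vec_eq[OF smooth_map_immersion c p] ..
    \<comment> \<open>With \<mu> = 2 m, \<open>laplacian_tension\<close> says \<Delta>\<tau> = -m
      \<Delta>\<phi>, so the two terms cancel.\<close>
    also have "\<dots> = 0"
      by (simp add: laplacian_tension[OF bilap] \<mu> laplacian_immersion)
    finally show ?thesis .
  qed
  then have "pd c i a p = 0" if "c \<in> A" "p \<in> dom_of c" for c p i
    using that by (intro pd_eq_0_if_harmonic_const_norm[OF that smooth_mapD[OF sma that(1)] aa])
  then obtain a\<^sub>0 where a\<^sub>0: "\<And>q. a q = a\<^sub>0"
    using constant_if_pd_eq_0[OF assms(2) sma] by metis

  \<comment> \<open>\<open>?e\<close> is the normal direction of the standard small sphere,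
    \<open>?v\<close> that of the small sphere which contains the image of \<phi>.\<close>
  let ?e = "(0, 1) :: (real ^ 'n) \<times> real" and ?v = "(1 / sqrt 2) *\<^sub>R a\<^sub>0"
  have "norm a\<^sub>0 = sqrt 2" using aa by (simp add: a\<^sub>0 norm_eq_sqrt_inner)
  then have v: "norm ?v = 1" by simp
  obtain T where T: "orthogonal_transformation T" "T ?e = ?v" "T ?v = ?e" "\<And>x. T (T x) = x"
    using exists_reflection[OF _ v, of ?e] by auto
  have linT: "linear T" and innerT: "T x \<bullet> T y = x \<bullet> y" for x y
    using T(1) unfolding orthogonal_transformation_def by blast+
  define \<psi> where "\<psi> q = fst (T (\<phi> q))" for q
  have snd: "snd (T x) = x \<bullet> ?v" for x
  proof -
    have "snd (T x) = T x \<bullet> T ?v" by (simp only: T(3)) (simp add: inner_prod_def)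
    then show ?thesis by (simp only: innerT)
  qed
  \<comment> \<open>From \<langle>\<phi>, a\<rangle> = 1 and |a| = sqrt 2; this is the height in
    \<open>standard_immersion\<close>.\<close>
  have snd\<phi>: "snd (T (\<phi> q)) = 1 / sqrt 2" for q
    using a\<phi>[of q] by (simp add: snd a\<^sub>0)
  have T\<phi>: "T (\<phi> q) = (\<psi> q, 1 / sqrt 2)" for q
    using snd\<phi>[of q] by (simp add: \<psi>_def prod_eq_iff)
  have lin: "bounded_linear (\<lambda>x. fst (T x))"
    by (rule bounded_linear_compose[OF bounded_linear_fst linear_conv_bounded_linear[THEN iffD1, OF linT]])
  have sm\<psi>: "smooth_map A \<psi>"
    unfolding \<psi>_def[abs_def] by (rule smooth_map_bounded_linear[OF lin smooth_map_immersion])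
  have iso: "isometric_immersion A g \<psi>"
    unfolding isometric_immersion_def
  proof (intro conjI ballI allI sm\<psi>)
    fix c p i j assume c: "c \<in> A" "p \<in> dom_of c"
    have fst: "pd c i \<psi> p = fst (T (pd c i \<phi> p))" for i
      unfolding \<psi>_def[abs_def] by (rule pd_bounded_linear[OF lin smooth_immersion[OF c(1)] c(2)])
    \<comment> \<open>The last coordinate of T \<phi> is constant, so its derivatives have no last
      component, and dropping that coordinate preserves their scalar products.\<close>
    have "pd c i \<phi> p \<bullet> ?v = 0" for i
    proof -
      have "pd c i \<phi> p \<bullet> ?v = pd c i (\<lambda>q. \<phi> q \<bullet> ?v) p"
        by (rule pd_bounded_linear[OF bounded_linear_inner_left smooth_immersion[OF c(1)] c(2), symmetric])
      also have "(\<lambda>q. \<phi> q \<bullet> ?v) = (\<lambda>q. 1 / sqrt 2)"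
        using snd\<phi> by (simp only: snd)
      finally show ?thesis by (simp only: pd_const)
    qed
    then have "snd (T (pd c i \<phi> p)) = 0" for i by (simp only: snd)
    then have "pd c i \<psi> p \<bullet> pd c j \<psi> p = T (pd c i \<phi> p) \<bullet> T (pd c j \<phi> p)"
      by (simp add: fst inner_prod_def)
    then show "pd c i \<psi> p \<bullet> pd c j \<psi> p = g c p $ i $ j"
      by (simp add: innerT gram[OF c])
  qed
  have inner\<psi>: "\<psi> q \<bullet> \<psi> q = 1 / 2" for q
    using innerT[of "\<phi> q" "\<phi> q"] by (simp add: T\<phi> inner_immersion)
  have sph\<psi>: "range \<psi> \<subseteq> sphere 0 (1 / sqrt 2)"
    by (auto simp only: mem_sphere_0 norm_eq_sqrt_inner inner\<psi> real_sqrt_divide real_sqrt_one)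
  interpret \<psi>: isometrically_immersed A g \<psi>
    by unfold_locales (rule iso)
  have "minimal A g \<psi>"
    unfolding minimal_def
  proof
    fix q
    let ?c = "chart_at A q"
    note c = chart_at(1)[of q] chart_at(2)[of q]
    have "laplacian_vec A g \<psi> q = fst (T (laplacian_vec A g \<phi> q))"
      unfolding laplacian_vec_eq[OF sm\<psi> c] laplacian_vec_eq[OF smooth_map_immersion c]
      unfolding \<psi>_def[abs_def]
      by (rule chart_laplacian_bounded_linear[OF lin chart_dom[OF c(1)] smooth_immersion[OF c(1)] c(2)])
    \<comment> \<open>This is \<Delta>\<phi> = m a - 2 m \<phi>. \<open>T\<close> sends the part
      along \<open>?v\<close> to \<open>?e\<close>, which disappears under \<open>fst\<close>; a
      multiple of \<psi> remains, radial for the small sphere and killed by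
      \<open>sphere_tan\<close>.\<close>
    also have "laplacian_vec A g \<phi> q = (?m * sqrt 2) *\<^sub>R ?v - (2 * ?m) *\<^sub>R \<phi> q"
    proof -
      have "?m *\<^sub>R a\<^sub>0 = \<tau> q + ?m *\<^sub>R \<phi> q"
        unfolding a\<^sub>0[of q, symmetric] by (simp add: a_def scaleR_add_right)
      moreover have "(?m * sqrt 2) *\<^sub>R ?v = ?m *\<^sub>R a\<^sub>0" by simp
      moreover have "(2 * ?m) *\<^sub>R \<phi> q = ?m *\<^sub>R \<phi> q + ?m *\<^sub>R \<phi> q"
        by (simp flip: scaleR_add_left)
      ultimately show ?thesis by (simp only: laplacian_immersion) simp
    qed
    also have "fst (T \<dots>) = - (2 * ?m) *\<^sub>R \<psi> q"
      by (simp only: linear_diff[OF linT] linear_scale[OF linT, of "?m * sqrt 2"]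
          linear_scale[OF linT, of "2 * ?m"] T(3)) (simp add: \<psi>_def)
    finally have "laplacian_vec A g \<psi> q = - (2 * ?m) *\<^sub>R \<psi> q" .
    then show "mean_curvature A g \<psi> q = 0"
      by (simp add: \<psi>.mean_curvature_eq[OF sph\<psi>] sphere_tan_def inner\<psi>)
  qed
  moreover have "\<phi> = T \<circ> standard_immersion \<circ> \<psi>"
  proof
    show "\<phi> q = (T \<circ> standard_immersion \<circ> \<psi>) q" for q
      using T(4)[of "\<phi> q"] by (simp add: T\<phi> standard_immersion_def)
  qed
  ultimately show ?thesis
    using \<mu> mean T(1) iso sph\<psi> by blast
qed

end
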